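(* Let $f:S^1\to S^1$ be a $C^1$-expanding map of the circle, and let $\mathcal{K}$ be any empirically stochastically stable set of $f$-invariant probability measures. Then every $\mu\in\mathcal{K}$ satisfies Pesin Entropy Formula $$h_\mu(f)=\int\log|f'|\,d\mu.$$
   Context: $M=S^1$ is the circle with its standard Riemannian metric; a $C^1$ map $f$ of $S^1$ is expanding if $|f'(x)|>1$ for all $x$. $h_\mu(f)$ denotes the metric (Kolmogorov–Sinai) entropy of $f$ with respect to $\mu$. $m$ is the Lebesgue measure on $M$; $B_\epsilon(x)$ is the open ball of radius $\epsilon$ centered at $x$. For sets $A,B\subset M$, "$A\subset B$ Lebesgue-a.e." means $m(A\setminus B)=0$. $\mathcal{M}$ is the space of Borel probability measures on $M$ with the weak$^*$ topology, and $\mathrm{dist}^*$ is a fixed metric on $\mathcal{M}$ inducing that topology; the distance from a measure to a set of measures is the infimum of the distances. $\mathcal{M}_f\subset\mathcal{M}$ is the set of $f$-invariant probability measures. $\mathbb{N}^+=\{1,2,\dots\}$. Noise. For $\epsilon>0$, $x\in M$ and a Borel set $A$, let $p_\epsilon(x,A)=\dfrac{m(A\cap B_\epsilon(f(x)))}{m(B_\epsilon(f(x)))}$. The transfer operator $\mathcal{L}_\epsilon$ on the space $C^0(M,\mathbb{C})$ of continuous functions is $(\mathcal{L}_\epsilon\varphi)(x)=\int\varphi(y)\,p_\epsilon(x,dy)$; the dual operator $\mathcal{L}_\epsilon^*:\mathcal{M}\to\mathcal{M}$ is defined by $\int\varphi\,d(\mathcal{L}^*_\epsilon\mu)=\int(\mathcal{L}_\epsilon\varphi)\,d\mu$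 for all $\varphi\in C^0(M,\mathbb{C})$. The empiric stochastic probability is $\sigma_{\epsilon,n,x}=\frac1n\sum_{j=1}^n(\mathcal{L}_\epsilon^* )^j\delta_x$, where $\delta_x$ is the Dirac measure at $x$. Empiric stochastic stability of sets. For a nonempty weak$^*$-compact set $\mathcal{K}\subset\mathcal{M}$, its basin of empiric stochastic stability $\widehat A_{\mathcal{K}}$ is the set of $x\in M$ such that for every $\rho>0$ there is $N=N(\rho)$ such that for every $n\ge N$ there is $\epsilon_0=\epsilon_0(\rho,n)>0$ with $\mathrm{dist}^*(\sigma_{\epsilon,n,x},\mathcal{K})<\rho$ for all $0<\epsilon\le\epsilon_0$. A nonempty weak$^*$-compact set $\mathcal{K}\subset\mathcal{M}_f$ is empirically stochastically stable if: (1) there is a measurable set $\widehat A\subset M$ with $m(\widehat A)>0$ such that for every $\rho>0$ and every large enough $n\in\mathbb{N}^+$ (how large may depend on $\rho$) there is $\epsilon_0>0$ (which may depend on $\rho$ and $n$ but not on $x$) with $\mathrm{dist}^*(\sigma_{\epsilon,n,x},\mathcal{K})<\rho$ for all $0<\epsilon\le\epsilon_0$ and all $x\in\widehat A$; and (2) if $\mathcal{K}'\subset\mathcal{M}_f$ is nonempty and weak$^*$-compact and $\widehat A_{\mathcal{K}}\subset\widehat A_{\mathcal{K}'}$ Lebesgue-a.e., then $\mathcal{K}\subset\mathcal{K}'$. *)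

theory Defs
  imports "HOL-Probability.Probability"
begin

text \<open>The circle is the unit circle in the complex plane. Circle maps are functions of type
  \<^typ>\<open>complex \<Rightarrow> complex\<close> that send the unit circle to itself; their values elsewhere are
  irrelevant.\<close>

abbreviation circle :: "complex set" where
  "circle \<equiv> sphere 0 1"

abbreviation circle_borel :: "complex measure" where
  "circle_borel \<equiv> restrict_space borel circle"

text \<open>Lebesgue measure of the circle is arc length, of total mass \<open>2 * pi\<close>.\<close>

definition circle_lebesgue :: "complex measure" where
  "circle_lebesgue = distr (restrict_space lborel {0..<2 * pi}) circle_borel cis"

text \<open>The Riemannian distance between \<open>x\<close> and \<open>y\<close> on the circle is the length
  \<open>\<bar>Arg (y / x)\<bar>\<close> of the shorter arc joining them.\<close>

definition circle_ball :: "complex \<Rightarrow> real \<Rightarrow> complex set" where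
  "circle_ball x r = {y \<in> circle. \<bar>Arg (y / x)\<bar> < r}"

definition C1_circle_map :: "(complex \<Rightarrow> complex) \<Rightarrow> bool" where
  "C1_circle_map f \<longleftrightarrow>
     f \<in> circle \<rightarrow> circle \<and> (\<lambda>t. f (cis t)) C1_differentiable_on UNIV"

text \<open>The curve \<open>t \<mapsto> x * cis t\<close> has unit speed on the circle and starts at \<open>x\<close>, so the following
  is \<open>\<bar>f'(x)\<bar>\<close> for the arc length metric.\<close>

definition circle_deriv_norm :: "(complex \<Rightarrow> complex) \<Rightarrow> complex \<Rightarrow> real" where
  "circle_deriv_norm f x = norm (vector_derivative (\<lambda>t. f (x * cis t)) (at 0))"

definition expanding_circle_map :: "(complex \<Rightarrow> complex) \<Rightarrow> bool" where
  "expanding_circle_map f \<longleftrightarrow> C1_circle_map f \<and> (\<forall>x\<in>circle. circle_deriv_norm f x > 1)"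

definition circle_probs :: "complex measure set" where
  "circle_probs = {\<mu>. prob_space \<mu> \<and> sets \<mu> = sets circle_borel}"

definition invariant_probs :: "(complex \<Rightarrow> complex) \<Rightarrow> complex measure set" where
  "invariant_probs f = {\<mu> \<in> circle_probs. distr \<mu> circle_borel f = \<mu>}"

text \<open>The weak-star topology on \<^const>\<open>circle_probs\<close>: the coarsest one that makes
  \<open>\<mu> \<mapsto> \<integral>\<phi> d\<mu>\<close> continuous for every continuous \<open>\<phi>\<close>.\<close>

definition weak_star_topology :: "complex measure topology" where
  "weak_star_topology = topology_generated_by
     {{\<mu> \<in> circle_probs. (\<integral>x. \<phi> x \<partial>\<mu>) \<in> U} | (\<phi> :: complex \<Rightarrow> complex) U.
        continuous_on circle \<phi> \<and> open U}"

definition noise_kernel :: "(complex \<Rightarrow> complex) \<Rightarrow> real \<Rightarrow> complex \<Rightarrow> complex measure" where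
  "noise_kernel f \<epsilon> x = uniform_measure circle_lebesgue (circle_ball (f x) \<epsilon>)"

definition transfer_op ::
  "(complex \<Rightarrow> complex) \<Rightarrow> real \<Rightarrow> (complex \<Rightarrow> complex) \<Rightarrow> complex \<Rightarrow> complex" where
  "transfer_op f \<epsilon> \<phi> x = (\<integral>y. \<phi> y \<partial>(noise_kernel f \<epsilon> x))"

definition dual_transfer_op ::
  "(complex \<Rightarrow> complex) \<Rightarrow> real \<Rightarrow> complex measure \<Rightarrow> complex measure" where
  "dual_transfer_op f \<epsilon> \<mu> = (THE \<nu>. \<nu> \<in> circle_probs \<and>
     (\<forall>\<phi> :: complex \<Rightarrow> complex. continuous_on circle \<phi> \<longrightarrow>
        (\<integral>x. \<phi> x \<partial>\<nu>) = (\<integral>x. transfer_op f \<epsilon> \<phi> x \<partial>\<mu>)))"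

definition empiric_prob ::
  "(complex \<Rightarrow> complex) \<Rightarrow> real \<Rightarrow> nat \<Rightarrow> complex \<Rightarrow> complex measure" where
  "empiric_prob f \<epsilon> n x = measure_of circle (sets circle_borel)
     (\<lambda>A. ennreal (1 / real n) *
        (\<Sum>j=1..n. emeasure ((dual_transfer_op f \<epsilon> ^^ j) (return circle_borel x)) A))"

definition dist_to_set :: "('a \<Rightarrow> 'a \<Rightarrow> real) \<Rightarrow> 'a \<Rightarrow> 'a set \<Rightarrow> real" where
  "dist_to_set d \<mu> K = (INF \<nu>\<in>K. d \<mu> \<nu>)"

text \<open>Here and below, \<open>d\<close> is the chosen metric on \<^const>\<open>circle_probs\<close> inducing the weak-star
  topology.\<close>

definition stability_basin ::
  "(complex measure \<Rightarrow> complex measure \<Rightarrow> real) \<Rightarrow> (complex \<Rightarrow> complex) \<Rightarrow>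
     complex measure set \<Rightarrow> complex set" where
  "stability_basin d f K = {x \<in> circle. \<forall>\<rho>>0. \<exists>N\<ge>1. \<forall>n\<ge>N. \<exists>\<epsilon>\<^sub>0>0. \<forall>\<epsilon>.
     0 < \<epsilon> \<and> \<epsilon> \<le> \<epsilon>\<^sub>0 \<longrightarrow> dist_to_set d (empiric_prob f \<epsilon> n x) K < \<rho>}"

text \<open>Lebesgue measurable sets are those of the completion of \<^const>\<open>circle_lebesgue\<close>.\<close>

definition empirically_stochastically_stable ::
  "(complex measure \<Rightarrow> complex measure \<Rightarrow> real) \<Rightarrow> (complex \<Rightarrow> complex) \<Rightarrow>
     complex measure set \<Rightarrow> bool" where
  "empirically_stochastically_stable d f K \<longleftrightarrow>
     K \<noteq> {} \<and> K \<subseteq> invariant_probs f \<and> compactin weak_star_topology K \<and>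
     (\<exists>A \<in> sets (completion circle_lebesgue). emeasure (completion circle_lebesgue) A > 0 \<and>
        (\<forall>\<rho>>0. \<exists>N\<ge>1. \<forall>n\<ge>N. \<exists>\<epsilon>\<^sub>0>0. \<forall>\<epsilon>. 0 < \<epsilon> \<and> \<epsilon> \<le> \<epsilon>\<^sub>0 \<longrightarrow>
           (\<forall>x\<in>A. dist_to_set d (empiric_prob f \<epsilon> n x) K < \<rho>))) \<and>
     (\<forall>K'. K' \<noteq> {} \<and> K' \<subseteq> invariant_probs f \<and> compactin weak_star_topology K' \<and>
        (AE x in circle_lebesgue. x \<in> stability_basin d f K \<longrightarrow> x \<in> stability_basin d f K')
        \<longrightarrow> K \<subseteq> K')"

definition measurable_partition :: "'a measure \<Rightarrow> 'a set set \<Rightarrow> bool" where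
  "measurable_partition \<mu> P \<longleftrightarrow> finite P \<and> P \<subseteq> sets \<mu> \<and> partition_on (space \<mu>) P"

text \<open>The convention \<open>0 * log 0 = 0\<close> holds because of the factor \<open>0\<close>.\<close>

definition partition_entropy :: "'a measure \<Rightarrow> 'a set set \<Rightarrow> real" where
  "partition_entropy \<mu> P = - (\<Sum>A\<in>P. measure \<mu> A * ln (measure \<mu> A))"

text \<open>The join of the preimages of \<open>P\<close> under \<open>f ^^ i\<close> for \<open>i < n\<close>. Among its members may be the
  empty set, which contributes nothing to the entropy.\<close>

definition iterated_join :: "'a measure \<Rightarrow> ('a \<Rightarrow> 'a) \<Rightarrow> 'a set set \<Rightarrow> nat \<Rightarrow> 'a set set" where
  "iterated_join \<mu> f P n =
     (\<lambda>s. {x \<in> space \<mu>. \<forall>i<n. (f ^^ i) x \<in> s i}) ` ({..<n} \<rightarrow>\<^sub>E P)"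

definition entropy_wrt_partition :: "'a measure \<Rightarrow> ('a \<Rightarrow> 'a) \<Rightarrow> 'a set set \<Rightarrow> real" where
  "entropy_wrt_partition \<mu> f P = lim (\<lambda>n. partition_entropy \<mu> (iterated_join \<mu> f P n) / real n)"

definition metric_entropy :: "'a measure \<Rightarrow> ('a \<Rightarrow> 'a) \<Rightarrow> ereal" where
  "metric_entropy \<mu> f =
     (SUP P \<in> {P. measurable_partition \<mu> P}. ereal (entropy_wrt_partition \<mu> f P))"

end

theory Submission
  imports Defs
begin

text \<open>
  The inequality \<open>h \<le> \<integral> ln |f'| d\<mu>\<close> is Ruelle's and holds for every invariant measure
  (\<open>metric_entropy_le\<close>). The reverse inequality is where stability enters, and it enters only through
  the minimality of \<open>K\<close>.

  Suppose that \<open>\<mu> \<in> K\<close> has entropy smaller than \<open>\<integral> ln |f'| d\<mu>\<close>. Cut the circle into arcs on which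
  \<open>f\<close> is injective. The entropy of this partition is the average information in the arc of \<open>x\<close> when
  the arcs of \<open>f x, f\<^sup>2 x, \<dots>\<close> are known. It is small, so there is a predictor of the arc of \<open>x\<close> from
  finitely many of these later arcs for which the potential
  \<open>G = ln |f'| + ln (probability predicted for the arc of x)\<close> has positive \<open>\<mu>\<close>-integral
  (\<open>low_entropy_predictor\<close>). On each arc \<open>|f'|\<close> is a Jacobian, and the predicted probabilities add up
  to at most one, so \<open>\<integral> e\<^sup>G (u \<circ> f) dm \<le> \<integral> u dm\<close> for Lebesgue measure \<open>m\<close> and every \<open>u \<ge> 0\<close>
  (\<open>nn_integral_weighted_transfer_le\<close>). If the end points of the arcs are \<open>\<mu>\<close>-null, then \<open>G\<close> has a
  continuous minorant \<open>g\<close> that keeps both properties (\<open>continuous_minorant\<close>). Iteration bounds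
  \<open>\<integral> exp (\<Sum>j<n. g \<circ> f\<^sup>j) dm\<close> by the length of the circle for all \<open>n\<close>, so by Markov's inequality and
  Borel-Cantelli the averages of \<open>g\<close> along Lebesgue almost every orbit are eventually at most any
  given \<open>c > 0\<close> (\<open>AE_average_le\<close>). No distortion estimate is involved, which is why \<open>C\<^sup>1\<close> suffices.

  For fixed \<open>n\<close>, the integral of \<open>g\<close> against the empiric stochastic probability tends to the average
  of \<open>g\<close> along the first \<open>n\<close> points of the noiseless orbit as the noise vanishes
  (\<open>empiric_prob_tendsto\<close>). Hence almost every point in the basin of \<open>K\<close> lies in the basin of the
  compact set \<open>K' = {\<nu> \<in> K. \<integral> g d\<nu> \<le> c}\<close>, and minimality yields \<open>K \<subseteq> K'\<close>. With
  \<open>0 < c < \<integral> g d\<mu>\<close> this contradicts \<open>\<mu> \<in> K\<close>.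

  Both halves treat entropy through Gibbs' inequality: the entropy of a partition is at most the mean
  of \<open>- ln q\<close> for every assignment of weights \<open>q\<close> of total at most one. Ruelle's inequality follows by
  taking for \<open>q\<close> the likelihoods of a hidden Markov chain whose states are the arcs of a fine
  partition.\<close>

section \<open>Words and Gibbs' inequality\<close>

definition words :: "'a set \<Rightarrow> nat \<Rightarrow> 'a list set" where
  "words A n = {w. set w \<subseteq> A \<and> length w = n}"

lemma words_0 [simp]: "words A 0 = {[]}"
  by (auto simp: words_def)

lemma finite_words [simp]: "finite A \<Longrightarrow> finite (words A n)"
  unfolding words_def by (rule finite_lists_length_eq)

text \<open>Every sum over words below is split at the front, at the back, or into a block and a remainder;
  all three are cases of one bijection.\<close>

lemma sum_words_append:
  assumes "finite A"
  shows "(\<Sum>w\<in>words A (m + n). h w) = (\<Sum>u\<in>words A m. \<Sum>v\<in>words A n. h (u @ v))"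
proof -
  have "(\<Sum>w\<in>words A (m + n). h w) = (\<Sum>(u, v)\<in>words A m \<times> words A n. h (u @ v))"
    by (rule sum.reindex_bij_witness[where j = "\<lambda>w. (take m w, drop m w)" and i = "\<lambda>(u, v). u @ v"])
       (auto simp: words_def dest: in_set_takeD in_set_dropD)
  then show ?thesis by (simp add: sum.cartesian_product)
qed

lemma sum_words_1: "(\<Sum>w\<in>words A (Suc 0). h w) = (\<Sum>a\<in>A. h [a])"
  by (rule sum.reindex_bij_witness[where j = hd and i = "\<lambda>a. [a]"])
     (auto simp: words_def length_Suc_conv)

lemma sum_words_Cons:
  assumes "finite A"
  shows "(\<Sum>w\<in>words A (Suc n). h w) = (\<Sum>a\<in>A. \<Sum>w\<in>words A n. h (a # w))"
  using sum_words_append[OF assms, of h "Suc 0" n] by (simp add: sum_words_1)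

lemma sum_words_snoc:
  assumes "finite A"
  shows "(\<Sum>w\<in>words A (Suc n). h w) = (\<Sum>w\<in>words A n. \<Sum>a\<in>A. h (w @ [a]))"
  using sum_words_append[OF assms, of h n "Suc 0"] by (simp add: sum_words_1)

text \<open>Nonnegativity of relative entropy, termwise from \<open>ln t \<le> t - 1\<close>. Only the total of the
  weights \<open>q\<close> is bounded, so that crude likelihoods can take the place of exact probabilities.\<close>

lemma gibbs_inequality:
  fixes p q :: "'i \<Rightarrow> real"
  assumes "finite I" "\<And>i. i \<in> I \<Longrightarrow> p i \<ge> 0" "\<And>i. i \<in> I \<Longrightarrow> q i \<ge> 0"
    and pos: "\<And>i. i \<in> I \<Longrightarrow> p i > 0 \<Longrightarrow> q i > 0"
    and le: "sum q I \<le> sum p I"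
  shows "- (\<Sum>i\<in>I. p i * ln (p i)) \<le> - (\<Sum>i\<in>I. p i * ln (q i))"
proof -
  have "p i * ln (q i) - p i * ln (p i) \<le> q i - p i" if i: "i \<in> I" for i
  proof (cases "p i = 0")
    case True
    then show ?thesis using assms(3)[OF i] by simp
  next
    case False
    then have p: "p i > 0" using assms(2)[OF i] by simp
    then have q: "q i > 0" using pos[OF i] by simp
    have "p i * ln (q i / p i) \<le> p i * (q i / p i - 1)"
      using p q by (intro mult_left_mono ln_le_minus_one) auto
    then show ?thesis using p q by (simp add: ln_div algebra_simps)
  qed
  then have "(\<Sum>i\<in>I. p i * ln (q i) - p i * ln (p i)) \<le> (\<Sum>i\<in>I. q i - p i)"
    by (rule sum_mono)
  then show ?thesis using le by (simp add: sum_subtractf)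
qed

section \<open>Entropy of a partition along a measure-preserving map\<close>

lemma (in prob_space)
  fixes h :: "'i \<Rightarrow> real"
  assumes X: "X \<in> M \<rightarrow>\<^sub>M count_space I" and I: "finite I"
  shows integrable_finite_valued: "integrable M (\<lambda>x. h (X x))"
    and integral_finite_valued:
      "(\<integral>x. h (X x) \<partial>M) = (\<Sum>i\<in>I. prob {x \<in> space M. X x = i} * h i)"
proof -
  have S: "{x \<in> space M. X x = i} \<in> sets M" if "i \<in> I" for i
    using measurable_sets[OF X, of "{i}"] that
    by (simp add: vimage_def Int_def conj_commute)
  have eq: "h (X x) = (\<Sum>i\<in>I. indicator {x \<in> space M. X x = i} x * h i)" if "x \<in> space M" for x
  proof -
    have XI: "X x \<in> I" using measurable_space[OF X that] by simp
    have "(\<Sum>i\<in>I. indicator {x \<in> space M. X x = i} x * h i) = (\<Sum>i\<in>I. if i = X x then h i else 0)"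
      using that by (intro sum.cong) (auto simp: indicator_def)
    then show ?thesis using XI I by simp
  qed
  have int: "integrable M (\<lambda>x. indicator {x \<in> space M. X x = i} x * h i)" if "i \<in> I" for i
    using S[OF that] by (auto intro!: integrable_mult_left integrable_real_indicator simp: emeasure_eq_measure)
  have int': "integrable M (\<lambda>x. \<Sum>i\<in>I. indicator {x \<in> space M. X x = i} x * h i)"
    by (rule Bochner_Integration.integrable_sum) (rule int)
  show "integrable M (\<lambda>x. h (X x))"
    by (subst Bochner_Integration.integrable_cong[OF refl eq]) (auto intro: int')
  have "(\<integral>x. h (X x) \<partial>M) = (\<integral>x. (\<Sum>i\<in>I. indicator {x \<in> space M. X x = i} x * h i) \<partial>M)"
    by (rule Bochner_Integration.integral_cong) (auto simp: eq)
  also have "\<dots> = (\<Sum>i\<in>I. \<integral>x. indicator {x \<in> space M. X x = i} x * h i \<partial>M)"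
    by (rule Bochner_Integration.integral_sum) (rule int)
  also have "\<dots> = (\<Sum>i\<in>I. prob {x \<in> space M. X x = i} * h i)"
    using S by (intro sum.cong refl) (simp add: Int_absorb2 sets.sets_into_space)
  finally show "(\<integral>x. h (X x) \<partial>M) = (\<Sum>i\<in>I. prob {x \<in> space M. X x = i} * h i)" .
qed

text \<open>The itinerary \<open>word n x\<close> is kept as a list of cells, so that concatenation of words corresponds
  to running the map on. The members of the iterated join are its level sets.\<close>

locale partitioned_system = prob_space M for M :: "'a measure" +
  fixes T :: "'a \<Rightarrow> 'a" and P :: "'a set set"
  assumes T_measurable: "T \<in> M \<rightarrow>\<^sub>M M" and T_invariant: "distr M M T = M"
    and P_partition: "measurable_partition M P"
begin

definition cell :: "'a \<Rightarrow> 'a set" where "cell x = (THE A. A \<in> P \<and> x \<in> A)"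

definition word :: "nat \<Rightarrow> 'a \<Rightarrow> 'a set list" where
  "word n x = map (\<lambda>i. cell ((T ^^ i) x)) [0..<n]"

definition word_prob :: "'a set list \<Rightarrow> real" where
  "word_prob w = prob {x \<in> space M. word (length w) x = w}"

definition join_entropy :: "nat \<Rightarrow> real" where
  "join_entropy n = partition_entropy M (iterated_join M T P n)"

lemma finite_P [simp]: "finite P"
  using P_partition by (simp add: measurable_partition_def)

lemma cell_eq: "A \<in> P \<Longrightarrow> x \<in> A \<Longrightarrow> cell x = A"
  using P_partition unfolding cell_def measurable_partition_def partition_on_def disjoint_def
  by (intro the_equality) blast+

lemma
  assumes "x \<in> space M"
  shows cell_in_P: "cell x \<in> P" and in_cell: "x \<in> cell x"
proof -
  obtain A where "A \<in> P" "x \<in> A"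
    using P_partition assms unfolding measurable_partition_def partition_on_def by blast
  then show "cell x \<in> P" "x \<in> cell x" by (simp_all add: cell_eq)
qed

lemma in_P_iff_cell: "x \<in> space M \<Longrightarrow> A \<in> P \<Longrightarrow> x \<in> A \<longleftrightarrow> cell x = A"
  using cell_eq in_cell by blast

lemma Tn_measurable: "T ^^ n \<in> M \<rightarrow>\<^sub>M M"
proof (induction n)
  case (Suc n)
  then show ?case unfolding funpow.simps by (rule measurable_comp[OF _ T_measurable])
qed (simp add: id_def)

lemma Tn_space: "x \<in> space M \<Longrightarrow> (T ^^ n) x \<in> space M"
  using measurable_space[OF Tn_measurable] .

lemma Tn_invariant: "distr M M (T ^^ n) = M"
proof (induction n)
  case 0
  then show ?case by (simp add: distr_id2 id_def)
next
  case (Suc n)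
  have "distr M M (T ^^ Suc n) = distr (distr M M (T ^^ n)) M T"
    by (simp only: funpow.simps distr_distr[OF T_measurable Tn_measurable])
  then show ?case by (simp only: Suc T_invariant)
qed

lemma integral_T:
  fixes u :: "'a \<Rightarrow> real"
  assumes "u \<in> borel_measurable M"
  shows "(\<integral>x. u ((T ^^ n) x) \<partial>M) = (\<integral>x. u x \<partial>M)"
  using integral_distr[OF Tn_measurable[of n] assms] by (simp add: Tn_invariant)

lemma integrable_T:
  fixes u :: "'a \<Rightarrow> real"
  assumes "integrable M u"
  shows "integrable M (\<lambda>x. u ((T ^^ n) x))"
  using integrable_distr[OF Tn_measurable[of n], of u] assms by (simp add: Tn_invariant)

lemma cell_measurable: "cell \<in> M \<rightarrow>\<^sub>M count_space P"
proof (subst measurable_count_space_eq2, simp, intro conjI ballI)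
  show "cell \<in> space M \<rightarrow> P" by (simp add: cell_in_P)
  fix A assume A: "A \<in> P"
  then have "A \<in> sets M" using P_partition by (auto simp: measurable_partition_def)
  moreover from this have "cell -` {A} \<inter> space M = A"
    using A sets.sets_into_space[of A M] in_P_iff_cell by auto
  ultimately show "cell -` {A} \<inter> space M \<in> sets M" by simp
qed

lemma length_word [simp]: "length (word n x) = n"
  by (simp add: word_def)

lemma word_0 [simp]: "word 0 x = []"
  by (simp add: word_def)

lemma word_append: "word (m + n) x = word m x @ word n ((T ^^ m) x)"
proof (rule nth_equalityI)
  fix i assume i: "i < length (word (m + n) x)"
  have "(T ^^ i) x = (T ^^ (i - m)) ((T ^^ m) x)" if "m \<le> i"
    using funpow_add[of "i - m" m T] that by (simp add: fun_eq_iff)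
  then show "word (m + n) x ! i = (word m x @ word n ((T ^^ m) x)) ! i"
    using i by (simp add: word_def nth_append)
qed simp

lemma word_Cons: "word (Suc n) x = cell x # word n (T x)"
  using word_append[of "Suc 0" n x] by (simp add: word_def)

lemma word_snoc: "word (Suc n) x = word n x @ [cell ((T ^^ n) x)]"
  by (simp add: word_def)

lemma word_in_words: "x \<in> space M \<Longrightarrow> word n x \<in> words P n"
  by (auto simp: words_def word_def cell_in_P Tn_space)

lemma word_measurable: "word n \<in> M \<rightarrow>\<^sub>M count_space (words P n)"
proof (subst measurable_count_space_eq2, simp, intro conjI ballI)
  show "word n \<in> space M \<rightarrow> words P n" by (simp add: word_in_words)
  fix w assume w: "w \<in> words P n"
  have eq: "word n -` {w} \<inter> space M = {x \<in> space M. \<forall>i<n. cell ((T ^^ i) x) = w ! i}"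
  proof -
    have l: "length w = n" using w by (simp add: words_def)
    have "word n x = w \<longleftrightarrow> (\<forall>i<n. cell ((T ^^ i) x) = w ! i)" for x
      unfolding list_eq_iff_nth_eq[of "word n x"] by (simp add: l) (simp add: word_def)
    then show ?thesis by blast
  qed
  have "{x \<in> space M. cell ((T ^^ i) x) = w ! i} \<in> sets M" if "i < n" for i
  proof -
    have "(\<lambda>x. cell ((T ^^ i) x)) \<in> M \<rightarrow>\<^sub>M count_space P"
      using measurable_compose[OF Tn_measurable cell_measurable] .
    moreover have "w ! i \<in> P" using w that by (auto simp: words_def)
    ultimately have "(\<lambda>x. cell ((T ^^ i) x)) -` {w ! i} \<inter> space M \<in> sets M"
      by (intro measurable_sets) auto
    then show ?thesis by (simp add: vimage_def Int_def conj_commute)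
  qed
  then have "{x \<in> space M. \<forall>i\<in>{..<n}. cell ((T ^^ i) x) = w ! i} \<in> sets M"
    by (intro sets.sets_Collect_finite_All) auto
  then show "word n -` {w} \<inter> space M \<in> sets M" unfolding eq by (simp only: Ball_def lessThan_iff)
qed

lemma borel_measurable_word: "(\<lambda>x. h (word n x)) \<in> borel_measurable M"
  for h :: "'a set list \<Rightarrow> real"
  by (rule measurable_compose[OF word_measurable]) simp

lemma integrable_word: "integrable M (\<lambda>x. h (word n x))" for h :: "'a set list \<Rightarrow> real"
  by (rule integrable_finite_valued[OF word_measurable]) simp

lemma integral_word:
  "(\<integral>x. h (word n x) \<partial>M) = (\<Sum>w\<in>words P n. word_prob w * h w)" for h :: "'a set list \<Rightarrow> real"
proof -
  have "(\<integral>x. h (word n x) \<partial>M) = (\<Sum>w\<in>words P n. prob {x \<in> space M. word n x = w} * h w)"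
    by (rule integral_finite_valued[OF word_measurable]) simp
  then show ?thesis by (simp add: word_prob_def words_def)
qed

lemma word_prob_nonneg [simp]: "0 \<le> word_prob w"
  by (simp add: word_prob_def)

lemma word_prob_Nil [simp]: "word_prob [] = 1"
  by (simp add: word_prob_def prob_space)

lemma sum_word_prob: "(\<Sum>w\<in>words P n. word_prob w) = 1"
  using integral_word[of "\<lambda>_. 1" n] by (simp add: prob_space)

text \<open>Dropping the last letter always gives a marginal; dropping the first one does so because the
  measure is invariant.\<close>

lemma word_prob_Suc:
  assumes "w \<in> words P n"
  shows sum_word_prob_snoc: "(\<Sum>A\<in>P. word_prob (w @ [A])) = word_prob w"
    and sum_word_prob_Cons: "(\<Sum>A\<in>P. word_prob (A # w)) = word_prob w"
proof -
  have l: "length w = n" using assms by (simp add: words_def)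
  have p: "word_prob w = (\<integral>x. indicator {w} (word n x) \<partial>M)"
    unfolding integral_word using assms by (simp add: indicator_def)
  have "(\<integral>x. (indicator {w} (word n x) :: real) \<partial>M) = (\<integral>x. indicator {w} (butlast (word (Suc n) x)) \<partial>M)"
    by (simp add: word_snoc)
  also have "\<dots> = (\<Sum>u\<in>words P (Suc n). word_prob u * indicator {w} (butlast u))"
    by (rule integral_word)
  also have "\<dots> = (\<Sum>u\<in>words P n. if u = w then (\<Sum>A\<in>P. word_prob (u @ [A])) else 0)"
    unfolding sum_words_snoc[OF finite_P] by (intro sum.cong) auto
  finally show "(\<Sum>A\<in>P. word_prob (w @ [A])) = word_prob w"
    using assms p by simp
  have "(\<integral>x. (indicator {w} (word n x) :: real) \<partial>M) = (\<integral>x. indicator {w} (word n ((T ^^ 1) x)) \<partial>M)"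
    by (rule integral_T[symmetric, of "\<lambda>x. indicator {w} (word n x)" 1]) (rule borel_measurable_word)
  also have "\<dots> = (\<integral>x. indicator {w} (tl (word (Suc n) x)) \<partial>M)"
    by (simp add: word_Cons)
  also have "\<dots> = (\<Sum>u\<in>words P (Suc n). word_prob u * indicator {w} (tl u))"
    by (rule integral_word)
  also have "\<dots> = (\<Sum>A\<in>P. \<Sum>u\<in>words P n. word_prob (A # u) * indicator {w} u)"
    unfolding sum_words_Cons[OF finite_P] by simp
  also have "\<dots> = (\<Sum>A\<in>P. word_prob (A # w))"
    using assms by (simp add: indicator_def)
  finally show "(\<Sum>A\<in>P. word_prob (A # w)) = word_prob w"
    using p by simp
qed

lemma
  assumes "w \<in> words P n" "A \<in> P"
  shows word_prob_Cons_le: "word_prob (A # w) \<le> word_prob w"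
    and word_prob_snoc_le: "word_prob (w @ [A]) \<le> word_prob w"
  using member_le_sum[OF assms(2), of "\<lambda>A. word_prob (A # w)"]
    member_le_sum[OF assms(2), of "\<lambda>A. word_prob (w @ [A])"] word_prob_Suc[OF assms(1)] by auto

text \<open>Distinct words can have the same level set only if it is empty, and then they contribute nothing,
  so the sum over sets in the definition of entropy may be taken over words instead.\<close>

lemma join_entropy_eq: "join_entropy n = - (\<Sum>w\<in>words P n. word_prob w * ln (word_prob w))"
proof -
  let ?C = "\<lambda>w. {x \<in> space M. word n x = w}"
  have C: "{x \<in> space M. \<forall>i<n. (T ^^ i) x \<in> s i} = ?C (map s [0..<n])" if "s \<in> {..<n} \<rightarrow>\<^sub>E P" for s
    using that by (auto simp: word_def in_P_iff_cell Tn_space PiE_iff)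
  have im: "(\<lambda>s. map s [0..<n]) ` ({..<n} \<rightarrow>\<^sub>E P) = words P n"
  proof (intro subset_antisym subsetI)
    fix w assume w: "w \<in> words P n"
    then have "restrict (\<lambda>i. w ! i) {..<n} \<in> {..<n} \<rightarrow>\<^sub>E P" "w = map (restrict (\<lambda>i. w ! i) {..<n}) [0..<n]"
      by (auto simp: words_def intro!: nth_equalityI)
    then show "w \<in> (\<lambda>s. map s [0..<n]) ` ({..<n} \<rightarrow>\<^sub>E P)" by blast
  qed (auto simp: words_def PiE_iff)
  have "iterated_join M T P n = (\<lambda>s. ?C (map s [0..<n])) ` ({..<n} \<rightarrow>\<^sub>E P)"
    unfolding iterated_join_def by (intro image_cong refl C)
  also have "\<dots> = ?C ` words P n" unfolding im[symmetric] image_image ..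
  finally have J: "iterated_join M T P n = ?C ` words P n" .
  have "(\<Sum>A\<in>?C ` words P n. prob A * ln (prob A))
      = (\<Sum>w\<in>words P n. prob (?C w) * ln (prob (?C w)))"
  proof (subst sum.reindex_nontrivial)
    fix v w assume "v \<noteq> w" "?C v = ?C w"
    then have "?C v = {}" by blast
    then show "prob (?C v) * ln (prob (?C v)) = 0" by (metis measure_empty mult_zero_left)
  qed auto
  also have "\<dots> = (\<Sum>w\<in>words P n. word_prob w * ln (word_prob w))"
    by (intro sum.cong) (auto simp: word_prob_def words_def)
  finally show ?thesis by (simp add: join_entropy_def partition_entropy_def J)
qed

lemma integral_ln_word_prob: "(\<integral>x. ln (word_prob (word n x)) \<partial>M) = - join_entropy n"
  by (simp add: join_entropy_eq integral_word[of "\<lambda>w. ln (word_prob w)"])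

lemma integral_ln_word_prob_T: "(\<integral>x. ln (word_prob (word n (T x))) \<partial>M) = - join_entropy n"
  using integral_T[of "\<lambda>x. ln (word_prob (word n x))" 1] borel_measurable_word[of "\<lambda>w. ln (word_prob w)" n]
  by (simp add: integral_ln_word_prob)

lemma join_entropy_0 [simp]: "join_entropy 0 = 0"
  by (simp add: join_entropy_eq)

lemma join_entropy_le_cross_entropy:
  assumes "\<And>w. w \<in> words P n \<Longrightarrow> q w \<ge> 0"
    and "\<And>w. w \<in> words P n \<Longrightarrow> word_prob w > 0 \<Longrightarrow> q w > 0"
    and "(\<Sum>w\<in>words P n. q w) \<le> 1"
  shows "join_entropy n \<le> - (\<Sum>w\<in>words P n. word_prob w * ln (q w))"
  unfolding join_entropy_eq using assms
  by (intro gibbs_inequality) (auto simp: sum_word_prob)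

lemma join_entropy_mono: "join_entropy n \<le> join_entropy (Suc n)"
proof -
  have "- join_entropy (Suc n) = (\<Sum>w\<in>words P n. \<Sum>A\<in>P. word_prob (w @ [A]) * ln (word_prob (w @ [A])))"
    by (simp add: join_entropy_eq sum_words_snoc)
  also have "\<dots> \<le> (\<Sum>w\<in>words P n. \<Sum>A\<in>P. word_prob (w @ [A]) * ln (word_prob w))"
  proof (intro sum_mono)
    fix w A assume wA: "w \<in> words P n" "A \<in> P"
    note le = word_prob_snoc_le[OF wA]
    show "word_prob (w @ [A]) * ln (word_prob (w @ [A])) \<le> word_prob (w @ [A]) * ln (word_prob w)"
    proof (cases "word_prob (w @ [A]) = 0")
      case False
      then have "word_prob (w @ [A]) > 0" using word_prob_nonneg[of "w @ [A]"] by linarith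
      then show ?thesis using le by (intro mult_left_mono) auto
    qed simp
  qed
  also have "\<dots> = (\<Sum>w\<in>words P n. word_prob w * ln (word_prob w))"
    by (intro sum.cong) (auto simp: sum_distrib_right[symmetric] sum_word_prob_snoc)
  finally show ?thesis by (simp add: join_entropy_eq)
qed

text \<open>Strong subadditivity. It is Gibbs' inequality for the measure under which the first and the last
  letter of a word are conditionally independent given the letters in between.\<close>

lemma join_entropy_concave:
  "join_entropy (Suc (Suc n)) - join_entropy (Suc n) \<le> join_entropy (Suc n) - join_entropy n"
proof -
  let ?p = word_prob
  \<comment> \<open>The words have the form \<open>A # u @ [B]\<close>; the middle part \<open>u\<close> may be empty.\<close>
  define q where "q w = ?p (butlast w) * ?p (tl w) / ?p (butlast (tl w))" for w
  have q: "q (A # u @ [B]) = ?p (A # u) * ?p (u @ [B]) / ?p u" for A B u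
    by (simp add: q_def butlast_append)
  have dec: "(\<Sum>w\<in>words P (Suc (Suc n)). h w) = (\<Sum>A\<in>P. \<Sum>u\<in>words P n. \<Sum>B\<in>P. h (A # u @ [B]))"
    for h :: "'a set list \<Rightarrow> real"
    by (simp only: sum_words_Cons[OF finite_P, of _ "Suc n"] sum_words_snoc[OF finite_P, of _ n])
  have dec': "(\<Sum>w\<in>words P (Suc (Suc n)). h w) = (\<Sum>u\<in>words P n. \<Sum>A\<in>P. \<Sum>B\<in>P. h (A # u @ [B]))"
    for h :: "'a set list \<Rightarrow> real"
    unfolding dec by (rule sum.swap)
  have pos: "?p (A # u) > 0 \<and> ?p (u @ [B]) > 0 \<and> ?p u > 0"
    if u: "u \<in> words P n" and AB: "A \<in> P" "B \<in> P" and p: "?p (A # u @ [B]) > 0" for A B u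
  proof -
    have "?p (A # u @ [B]) \<le> ?p (A # u)"
      using word_prob_snoc_le[of "A # u" "Suc n" B] u AB by (simp add: words_def)
    moreover have "?p (A # u @ [B]) \<le> ?p (u @ [B])"
      using word_prob_Cons_le[of "u @ [B]" "Suc n" A] u AB by (simp add: words_def)
    moreover have "?p (A # u) \<le> ?p u"
      using word_prob_Cons_le[of u n A] u AB by (simp add: words_def)
    ultimately show ?thesis using p by linarith
  qed
  have "join_entropy (Suc (Suc n)) \<le> - (\<Sum>w\<in>words P (Suc (Suc n)). ?p w * ln (q w))"
  proof (rule join_entropy_le_cross_entropy)
    show "q w \<ge> 0" for w by (simp add: q_def)
    show "q w > 0" if w: "w \<in> words P (Suc (Suc n))" and p: "?p w > 0" for w
    proof -
      obtain A v where v: "w = A # v" "A \<in> P" "v \<in> words P (Suc n)"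
        using w by (cases w) (auto simp: words_def)
      obtain u B where u: "v = u @ [B]" "B \<in> P" "u \<in> words P n"
        using v(3) by (cases v rule: rev_cases) (auto simp: words_def)
      show ?thesis using pos[OF u(3) v(2) u(2)] p unfolding v(1) u(1) q by simp
    qed
    have "(\<Sum>w\<in>words P (Suc (Suc n)). q w) = (\<Sum>u\<in>words P n. \<Sum>A\<in>P. \<Sum>B\<in>P. ?p (A # u) * ?p (u @ [B]) / ?p u)"
      unfolding dec' q ..
    also have "\<dots> = (\<Sum>u\<in>words P n. (\<Sum>A\<in>P. ?p (A # u)) * (\<Sum>B\<in>P. ?p (u @ [B])) / ?p u)"
      by (simp add: sum_product sum_divide_distrib)
    also have "\<dots> = (\<Sum>u\<in>words P n. ?p u)"
      by (intro sum.cong) (auto simp: word_prob_Suc)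
    finally show "(\<Sum>w\<in>words P (Suc (Suc n)). q w) \<le> 1" by (simp add: sum_word_prob)
  qed
  also have "(\<Sum>w\<in>words P (Suc (Suc n)). ?p w * ln (q w)) =
     (\<Sum>w\<in>words P (Suc (Suc n)). ?p w * ln (?p (butlast w)) + ?p w * ln (?p (tl w)) - ?p w * ln (?p (butlast (tl w))))"
    unfolding dec
  proof (intro sum.cong refl)
    fix A u B assume a: "A \<in> P" "u \<in> words P n" "B \<in> P"
    show "?p (A # u @ [B]) * ln (q (A # u @ [B])) =
       ?p (A # u @ [B]) * ln (?p (butlast (A # u @ [B]))) + ?p (A # u @ [B]) * ln (?p (tl (A # u @ [B])))
         - ?p (A # u @ [B]) * ln (?p (butlast (tl (A # u @ [B]))))"
    proof (cases "?p (A # u @ [B]) = 0")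
      case False
      then have "?p (A # u @ [B]) > 0" using word_prob_nonneg[of "A # u @ [B]"] by linarith
      with pos[OF a(2,1,3)] show ?thesis
        by (simp add: q ln_div ln_mult butlast_append algebra_simps)
    qed simp
  qed
  also have "\<dots> = (\<integral>x. ln (?p (butlast (word (Suc (Suc n)) x))) \<partial>M)
      + (\<integral>x. ln (?p (tl (word (Suc (Suc n)) x))) \<partial>M)
      - (\<integral>x. ln (?p (butlast (tl (word (Suc (Suc n)) x)))) \<partial>M)"
    by (simp only: sum.distrib sum_subtractf integral_word[of "\<lambda>w. ln (?p (butlast w))"]
        integral_word[of "\<lambda>w. ln (?p (tl w))"] integral_word[of "\<lambda>w. ln (?p (butlast (tl w)))"])
  also have "(\<integral>x. ln (?p (butlast (word (Suc (Suc n)) x))) \<partial>M) = - join_entropy (Suc n)"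
    by (simp add: word_snoc[of "Suc n"] integral_ln_word_prob)
  also have "(\<integral>x. ln (?p (tl (word (Suc (Suc n)) x))) \<partial>M) = - join_entropy (Suc n)"
    by (simp add: word_Cons[of "Suc n"] integral_ln_word_prob_T)
  also have "(\<integral>x. ln (?p (butlast (tl (word (Suc (Suc n)) x)))) \<partial>M) = - join_entropy n"
    by (simp add: word_Cons[of "Suc n"] word_snoc[of n] integral_ln_word_prob_T)
  finally show ?thesis by simp
qed

end

text \<open>The increments of a nondecreasing concave sequence converge, and the slopes converge to the same
  limit by averaging.\<close>

lemma concave_sequence_slope:
  fixes a :: "nat \<Rightarrow> real"
  assumes "a 0 = 0" and mono: "\<And>n. a n \<le> a (Suc n)"
    and concave: "\<And>n. a (Suc (Suc n)) - a (Suc n) \<le> a (Suc n) - a n"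
  obtains L where "(\<lambda>n. a (Suc n) - a n) \<longlonglongrightarrow> L" "(\<lambda>n. a n / real n) \<longlonglongrightarrow> L"
proof -
  define D where "D n = a (Suc n) - a n" for n
  have "decseq D" by (rule decseq_SucI) (use concave in \<open>simp add: D_def\<close>)
  moreover have "0 \<le> D n" for n using mono[of n] by (simp add: D_def)
  ultimately obtain L where L: "D \<longlonglongrightarrow> L" and LD: "\<And>n. L \<le> D n"
    using decseq_convergent[of D 0] by blast
  have lower: "real n * L \<le> a n" for n
  proof (induction n)
    case (Suc n)
    then show ?case using LD[of n] by (simp add: D_def algebra_simps)
  qed (simp add: assms(1))
  have "(\<lambda>n. a n / real n) \<longlonglongrightarrow> L"
  proof (rule LIMSEQ_I)
    fix r :: real assume r: "r > 0"
    from order_tendstoD(2)[OF L, of "L + r / 2"] r obtain K where K: "\<And>n. n \<ge> K \<Longrightarrow> D n < L + r / 2"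
      by (auto simp: eventually_sequentially)
    have upper: "a n \<le> a K + real (n - K) * (L + r / 2)" if "n \<ge> K" for n
      using that
    proof (induction n rule: dec_induct)
      case (step n)
      have "a (Suc n) = D n + a n" by (simp add: D_def)
      also have "\<dots> \<le> a K + (real (n - K) + 1) * (L + r / 2)"
        using step K[of n] by (simp add: distrib_right)
      finally show ?case using step by (simp add: Suc_diff_le add.commute)
    qed simp
    define C where "C = \<bar>a K\<bar> + real K * \<bar>L + r / 2\<bar>"
    obtain N where N: "real N > 2 * C / r" using reals_Archimedean2 by blast
    have "norm (a n / real n - L) < r" if n: "n \<ge> max (Suc K) (Suc N)" for n
    proof -
      have np: "real n > 0" and nK: "n \<ge> K" using n by auto
      have "- (real K * (L + r / 2)) \<le> real K * \<bar>L + r / 2\<bar>"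
        using mult_left_mono[OF abs_ge_minus_self[of "L + r / 2"], of "real K"] by (simp only: mult_minus_right)
      moreover have "real (n - K) * (L + r / 2) = real n * (L + r / 2) - real K * (L + r / 2)"
        using nK by (simp only: of_nat_diff left_diff_distrib)
      moreover have "x \<le> v + u + s" if "- t \<le> u" "q = s - t" "x \<le> p + q" "p \<le> v" for x p q s t u v :: real
        using that by linarith
      ultimately have "a n \<le> C + real n * (L + r / 2)"
        using upper[OF nK] abs_ge_self[of "a K"] unfolding C_def by blast
      moreover have "C < real n * (r / 2)"
      proof -
        have "2 * C / r < real n" using N n by simp
        then show ?thesis using r by (simp add: field_simps)
      qed
      ultimately have "a n < real n * (L + r)" by (simp add: algebra_simps)
      then have "a n / real n < L + r" using np by (simp add: field_simps)
      moreover have "L \<le> a n / real n" using lower[of n] np by (simp add: field_simps)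
      ultimately show ?thesis using r by (simp add: abs_less_iff)
    qed
    then show "\<exists>no. \<forall>n\<ge>no. norm (a n / real n - L) < r" by blast
  qed
  moreover have "D = (\<lambda>n. a (Suc n) - a n)" by (simp add: D_def fun_eq_iff)
  ultimately show ?thesis using that L by simp
qed

text \<open>The likelihood of a word in a hidden Markov chain that starts in state \<open>a\<close>. In each state it emits
  a block of \<open>m\<close> letters with probabilities \<open>s\<close> and then moves on with probabilities \<open>t\<close>.\<close>

primrec hidden_weight ::
  "('b list \<Rightarrow> 'i \<Rightarrow> real) \<Rightarrow> ('i \<Rightarrow> 'i \<Rightarrow> real) \<Rightarrow> 'i set \<Rightarrow> nat \<Rightarrow> nat \<Rightarrow> 'i \<Rightarrow> 'b list \<Rightarrow> real" where
  "hidden_weight s t I m 0 a w = 1"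
| "hidden_weight s t I m (Suc n) a w =
     s (take m w) a * (\<Sum>b\<in>I. t a b * hidden_weight s t I m n b (drop m w))"

lemma hidden_weight_nonneg:
  assumes "\<And>u a. 0 \<le> s u a" "\<And>a b. 0 \<le> t a b"
  shows "0 \<le> hidden_weight s t I m n a w"
  using assms by (induction n arbitrary: a w) (auto intro!: mult_nonneg_nonneg sum_nonneg)

lemma sum_hidden_weight_le:
  assumes P: "finite P" and nonneg: "\<And>u a. 0 \<le> s u a" "\<And>a b. 0 \<le> t a b"
    and s: "\<And>a. a \<in> I \<Longrightarrow> (\<Sum>u\<in>words P m. s u a) \<le> 1"
    and t: "\<And>a. a \<in> I \<Longrightarrow> (\<Sum>b\<in>I. t a b) \<le> 1"
    and a: "a \<in> I"
  shows "(\<Sum>w\<in>words P (n * m). hidden_weight s t I m n a w) \<le> 1"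
  using a
proof (induction n arbitrary: a)
  case (Suc n)
  let ?Q = "hidden_weight s t I m"
  have "(\<Sum>w\<in>words P (Suc n * m). ?Q (Suc n) a w) = (\<Sum>u\<in>words P m. \<Sum>v\<in>words P (n * m). ?Q (Suc n) a (u @ v))"
    by (simp only: mult_Suc sum_words_append[OF P])
  also have "\<dots> = (\<Sum>u\<in>words P m. \<Sum>v\<in>words P (n * m). s u a * (\<Sum>b\<in>I. t a b * ?Q n b v))"
    by (intro sum.cong) (auto simp: words_def)
  also have "\<dots> = (\<Sum>u\<in>words P m. s u a) * (\<Sum>v\<in>words P (n * m). \<Sum>b\<in>I. t a b * ?Q n b v)"
    by (simp add: sum_product)
  also have "(\<Sum>v\<in>words P (n * m). \<Sum>b\<in>I. t a b * ?Q n b v) = (\<Sum>b\<in>I. t a b * (\<Sum>v\<in>words P (n * m). ?Q n b v))"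
    by (subst sum.swap) (simp add: sum_distrib_left)
  also have "(\<Sum>u\<in>words P m. s u a) * \<dots> \<le> 1 * 1"
  proof (intro mult_mono s Suc.prems)
    have "(\<Sum>b\<in>I. t a b * (\<Sum>v\<in>words P (n * m). ?Q n b v)) \<le> (\<Sum>b\<in>I. t a b * 1)"
      by (intro sum_mono mult_left_mono Suc.IH nonneg)
    then show "(\<Sum>b\<in>I. t a b * (\<Sum>v\<in>words P (n * m). ?Q n b v)) \<le> 1"
      using t[OF Suc.prems] by simp
  qed (auto intro!: sum_nonneg mult_nonneg_nonneg nonneg hidden_weight_nonneg)
  finally show ?case by simp
qed simp

context partitioned_system
begin

text \<open>The entropy of a partition is defined through the operator \<open>lim\<close>, which says nothing about
  sequences without a limit; convergence must therefore be established first.\<close>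

lemma
  shows join_entropy_slope: "(\<lambda>n. join_entropy n / real n) \<longlonglongrightarrow> entropy_wrt_partition M T P"
    and join_entropy_increment:
      "(\<lambda>n. join_entropy (Suc n) - join_entropy n) \<longlonglongrightarrow> entropy_wrt_partition M T P"
proof -
  obtain L where L: "(\<lambda>n. join_entropy (Suc n) - join_entropy n) \<longlonglongrightarrow> L"
      "(\<lambda>n. join_entropy n / real n) \<longlonglongrightarrow> L"
    using concave_sequence_slope[of join_entropy, OF join_entropy_0 join_entropy_mono join_entropy_concave] by blast
  moreover have "entropy_wrt_partition M T P = L"
    using limI[OF L(2)] by (simp add: entropy_wrt_partition_def join_entropy_def)
  ultimately show "(\<lambda>n. join_entropy n / real n) \<longlonglongrightarrow> entropy_wrt_partition M T P"
    "(\<lambda>n. join_entropy (Suc n) - join_entropy n) \<longlonglongrightarrow> entropy_wrt_partition M T P" by simp_all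
qed

text \<open>Gibbs' inequality in the form in which it is applied: weights on words give a code, and \<open>c\<close> bounds
  the length of the code word of the itinerary of \<open>x\<close>.\<close>

lemma join_entropy_le_code_length:
  assumes q: "\<And>w. w \<in> words P n \<Longrightarrow> 0 \<le> q w" "(\<Sum>w\<in>words P n. q w) \<le> 1"
    and pos: "\<And>x. x \<in> space M \<Longrightarrow> 0 < q (word n x)"
    and c: "integrable M c" "\<And>x. x \<in> space M \<Longrightarrow> - ln (q (word n x)) \<le> c x"
  shows "join_entropy n \<le> (\<integral>x. c x \<partial>M)"
proof -
  have "join_entropy n \<le> - (\<Sum>w\<in>words P n. word_prob w * ln (q w))"
  proof (rule join_entropy_le_cross_entropy[OF q(1) _ q(2)])
    fix w assume w: "w \<in> words P n" "word_prob w > 0"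
    have "{x \<in> space M. word (length w) x = w} \<noteq> {}"
      using w(2) unfolding word_prob_def by (metis measure_empty less_irrefl)
    then obtain x where "x \<in> space M" "word n x = w" using w(1) by (auto simp: words_def)
    then show "q w > 0" using pos by blast
  qed
  also have "\<dots> = (\<integral>x. - ln (q (word n x)) \<partial>M)"
    using integral_word[of "\<lambda>w. - ln (q w)" n] by (simp add: sum_negf)
  also have "\<dots> \<le> (\<integral>x. c x \<partial>M)"
    by (rule integral_mono[OF integrable_word[of "\<lambda>w. - ln (q w)"] c])
  finally show ?thesis .
qed

text \<open>Code the itinerary in blocks of length \<open>m\<close> by the hidden Markov chain whose state at \<open>x\<close> is
  \<open>\<kappa> x\<close>. The weight of a word sums over all sequences of states, so it is at least the term of the
  actual sequence, whose logarithm is a Birkhoff sum of block costs. By invariance the mean cost per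
  block is \<open>\<integral> \<beta>\<close>, whereas the unknown initial state costs \<open>ln (card I)\<close> only once.\<close>

lemma entropy_le_block_cost:
  fixes \<kappa> :: "'a \<Rightarrow> 'i"
  assumes m: "m > 0" and I: "finite I" and \<kappa>: "\<And>x. x \<in> space M \<Longrightarrow> \<kappa> x \<in> I"
    and nonneg: "\<And>u a. 0 \<le> s u a" "\<And>a b. 0 \<le> t a b"
    and s: "\<And>a. a \<in> I \<Longrightarrow> (\<Sum>u\<in>words P m. s u a) \<le> 1"
    and t: "\<And>a. a \<in> I \<Longrightarrow> (\<Sum>b\<in>I. t a b) \<le> 1"
    and pos: "\<And>x. x \<in> space M \<Longrightarrow> 0 < s (word m x) (\<kappa> x)"
      "\<And>x. x \<in> space M \<Longrightarrow> 0 < t (\<kappa> x) (\<kappa> ((T ^^ m) x))"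
    and \<beta>: "integrable M \<beta>"
      "\<And>x. x \<in> space M \<Longrightarrow> - ln (s (word m x) (\<kappa> x)) - ln (t (\<kappa> x) (\<kappa> ((T ^^ m) x))) \<le> \<beta> x"
  shows "real m * entropy_wrt_partition M T P \<le> (\<integral>x. \<beta> x \<partial>M)"
proof -
  let ?Q = "hidden_weight s t I m"
  have Q: "0 < ?Q n (\<kappa> x) (word (n * m) x) \<and>
      - ln (?Q n (\<kappa> x) (word (n * m) x)) \<le> (\<Sum>j<n. \<beta> ((T ^^ (j * m)) x))"
    if "x \<in> space M" for n x
    using that
  proof (induction n arbitrary: x)
    case (Suc n)
    define y where "y = (T ^^ m) x"
    have y: "y \<in> space M" using Tn_space Suc.prems by (simp add: y_def)
    have wd: "word (Suc n * m) x = word m x @ word (n * m) y"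
      by (simp add: word_append y_def)
    define z where "z = s (word m x) (\<kappa> x) * (t (\<kappa> x) (\<kappa> y) * ?Q n (\<kappa> y) (word (n * m) y))"
    have zpos: "0 < z"
      using pos[OF Suc.prems] Suc.IH[OF y] by (simp add: z_def y_def)
    have "t (\<kappa> x) (\<kappa> y) * ?Q n (\<kappa> y) (word (n * m) y) \<le> (\<Sum>b\<in>I. t (\<kappa> x) b * ?Q n b (word (n * m) y))"
      by (rule member_le_sum[OF \<kappa>[OF y]]) (auto intro!: mult_nonneg_nonneg nonneg hidden_weight_nonneg I)
    then have le: "z \<le> ?Q (Suc n) (\<kappa> x) (word (Suc n * m) x)"
      unfolding wd z_def by (auto intro!: mult_left_mono nonneg)
    have "- ln (?Q (Suc n) (\<kappa> x) (word (Suc n * m) x)) \<le> - ln z"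
      using le zpos by simp
    also have "\<dots> = - ln (s (word m x) (\<kappa> x)) - ln (t (\<kappa> x) (\<kappa> y)) - ln (?Q n (\<kappa> y) (word (n * m) y))"
      using pos[OF Suc.prems] Suc.IH[OF y] by (simp add: z_def y_def ln_mult)
    also have "\<dots> \<le> \<beta> x + (\<Sum>j<n. \<beta> ((T ^^ (j * m)) y))"
      using \<beta>(2)[OF Suc.prems] Suc.IH[OF y] by (simp add: y_def)
    also have "\<dots> = (\<Sum>j<Suc n. \<beta> ((T ^^ (j * m)) x))"
    proof -
      have "(T ^^ (j * m)) y = (T ^^ (Suc j * m)) x" for j
        using funpow_add[of "j * m" m T] by (simp add: y_def fun_eq_iff add.commute)
      then show ?thesis by (simp only: sum.lessThan_Suc_shift) simp
    qed
    finally show ?case using le zpos by simp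
  qed simp
  have bound: "join_entropy (n * m) \<le> ln (real (card I)) + real n * (\<integral>x. \<beta> x \<partial>M)" for n
  proof -
    obtain x0 where "x0 \<in> space M" using not_empty by blast
    then have cI: "card I > 0" using \<kappa> I by (auto simp: card_gt_0_iff)
    define q where "q w = (\<Sum>a\<in>I. ?Q n a w) / real (card I)" for w
    have int: "integrable M (\<lambda>x. \<Sum>j<n. \<beta> ((T ^^ (j * m)) x))"
      by (intro Bochner_Integration.integrable_sum integrable_T \<beta>)
    have "join_entropy (n * m) \<le> (\<integral>x. ln (real (card I)) + (\<Sum>j<n. \<beta> ((T ^^ (j * m)) x)) \<partial>M)"
    proof (rule join_entropy_le_code_length)
      show "0 \<le> q w" for w
        by (auto simp: q_def intro!: divide_nonneg_nonneg sum_nonneg hidden_weight_nonneg nonneg)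
      have "(\<Sum>w\<in>words P (n * m). q w) = (\<Sum>a\<in>I. \<Sum>w\<in>words P (n * m). ?Q n a w) / real (card I)"
        unfolding q_def sum_divide_distrib[symmetric] by (subst sum.swap) simp
      also have "\<dots> \<le> (\<Sum>a\<in>I. 1) / real (card I)"
        by (intro divide_right_mono sum_mono sum_hidden_weight_le finite_P nonneg s t) auto
      finally show "(\<Sum>w\<in>words P (n * m). q w) \<le> 1" using cI by simp
      fix x assume x: "x \<in> space M"
      have "?Q n (\<kappa> x) (word (n * m) x) \<le> (\<Sum>a\<in>I. ?Q n a (word (n * m) x))"
        by (rule member_le_sum[OF \<kappa>[OF x]]) (auto intro!: nonneg hidden_weight_nonneg I)
      then have qge: "?Q n (\<kappa> x) (word (n * m) x) / real (card I) \<le> q (word (n * m) x)"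
        unfolding q_def by (intro divide_right_mono) auto
      moreover have Qp: "0 < ?Q n (\<kappa> x) (word (n * m) x) / real (card I)"
        using Q[OF x] cI by simp
      ultimately show "0 < q (word (n * m) x)" by linarith
      have "- ln (q (word (n * m) x)) \<le> - ln (?Q n (\<kappa> x) (word (n * m) x) / real (card I))"
        using qge Qp by simp
      also have "\<dots> = ln (real (card I)) - ln (?Q n (\<kappa> x) (word (n * m) x))"
        using Q[OF x, of n] cI by (simp add: ln_div)
      finally show "- ln (q (word (n * m) x)) \<le> ln (real (card I)) + (\<Sum>j<n. \<beta> ((T ^^ (j * m)) x))"
        using Q[OF x, of n] by linarith
    qed (use int in simp)
    also have "\<dots> = ln (real (card I)) + (\<Sum>j<n. \<integral>x. \<beta> ((T ^^ (j * m)) x) \<partial>M)"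
      using int by (simp add: prob_space Bochner_Integration.integral_sum integrable_T \<beta>(1))
    also have "\<dots> = ln (real (card I)) + real n * (\<integral>x. \<beta> x \<partial>M)"
      using \<beta>(1) by (simp add: integral_T)
    finally show ?thesis .
  qed
  have sub: "strict_mono (\<lambda>n. Suc n * m)"
    using m by (intro strict_monoI mult_strict_right_mono) auto
  have "(\<lambda>n. join_entropy (Suc n * m) / real (Suc n * m)) \<longlonglongrightarrow> entropy_wrt_partition M T P"
    using LIMSEQ_subseq_LIMSEQ[OF join_entropy_slope sub] by (simp add: comp_def)
  moreover have "(\<lambda>n. ln (real (card I)) / real m * inverse (real (Suc n)) + (\<integral>x. \<beta> x \<partial>M) / real m)
      \<longlonglongrightarrow> ln (real (card I)) / real m * 0 + (\<integral>x. \<beta> x \<partial>M) / real m"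
    by (intro tendsto_intros LIMSEQ_inverse_real_of_nat)
  moreover have "join_entropy (Suc n * m) / real (Suc n * m)
      \<le> ln (real (card I)) / real m * inverse (real (Suc n)) + (\<integral>x. \<beta> x \<partial>M) / real m" for n
  proof -
    have "join_entropy (Suc n * m) / real (Suc n * m) \<le> (ln (real (card I)) + real (Suc n) * (\<integral>x. \<beta> x \<partial>M)) / real (Suc n * m)"
      using bound[of "Suc n"] m by (intro divide_right_mono) auto
    also have "\<dots> = ln (real (card I)) / real m * inverse (real (Suc n)) + (\<integral>x. \<beta> x \<partial>M) / real m"
      unfolding of_nat_mult add_divide_distrib
      using m by (simp add: inverse_eq_divide mult.commute del: of_nat_Suc)
    finally show ?thesis .
  qed
  ultimately have "entropy_wrt_partition M T P \<le> (\<integral>x. \<beta> x \<partial>M) / real m"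
    by (intro LIMSEQ_le) auto
  then show ?thesis using m by (simp add: field_simps)
qed

text \<open>The increments of the entropies of the joins converge to the entropy of the partition, so one of
  them is smaller than \<open>c\<close>. Such an increment is the mean of \<open>- ln\<close> of the conditional probability of
  the first letter given the \<open>q\<close> following ones. Conditional probabilities may vanish; adding \<open>e\<close> to
  every count makes them positive and changes the mean by an amount that vanishes with \<open>e\<close>.\<close>

lemma low_entropy_predictor:
  assumes "entropy_wrt_partition M T P < c"
  obtains q \<tau> where "\<And>A w. A \<in> P \<Longrightarrow> w \<in> words P q \<Longrightarrow> 0 < \<tau> A w"
    "\<And>w. w \<in> words P q \<Longrightarrow> (\<Sum>A\<in>P. \<tau> A w) \<le> 1"
    "- (\<integral>x. ln (\<tau> (cell x) (word q (T x))) \<partial>M) < c"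
proof -
  from order_tendstoD(2)[OF join_entropy_increment assms]
  obtain q where q: "join_entropy (Suc q) - join_entropy q < c"
    by (auto simp: eventually_sequentially)
  let ?p = word_prob
  define \<tau> where "\<tau> e A w = (?p (A # w) + e) / (?p w + e * real (card P))" for e A w
  have Pne: "card P > 0"
    using not_empty cell_in_P by (auto simp: card_gt_0_iff)
  have S: "(\<integral>x. ln (\<tau> e (cell x) (word q (T x))) \<partial>M) = (\<Sum>A\<in>P. \<Sum>w\<in>words P q. ?p (A # w) * ln (\<tau> e A w))" for e
    using integral_word[of "\<lambda>w. ln (\<tau> e (hd w) (tl w))" "Suc q"]
    by (simp add: word_Cons sum_words_Cons)
  have "((\<lambda>e. ?p (A # w) * ln (\<tau> e A w)) \<longlongrightarrow> ?p (A # w) * (ln (?p (A # w)) - ln (?p w))) (at_right 0)"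
    if w: "A \<in> P" "w \<in> words P q" for A w
  proof (cases "?p (A # w) = 0")
    case False
    then have p: "?p (A # w) > 0" using word_prob_nonneg[of "A # w"] by linarith
    then have p': "?p w > 0" using word_prob_Cons_le[OF w(2,1)] by linarith
    have "((\<lambda>e. ?p (A # w) * ln (\<tau> e A w)) \<longlongrightarrow> ?p (A # w) * ln ((?p (A # w) + 0) / (?p w + 0 * real (card P)))) (at_right 0)"
      unfolding \<tau>_def using p p' by (intro tendsto_intros) auto
    then show ?thesis using p p' by (simp add: ln_div)
  qed simp
  then have "((\<lambda>e. \<Sum>A\<in>P. \<Sum>w\<in>words P q. ?p (A # w) * ln (\<tau> e A w)) \<longlongrightarrow>
     (\<Sum>A\<in>P. \<Sum>w\<in>words P q. ?p (A # w) * (ln (?p (A # w)) - ln (?p w)))) (at_right 0)"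
    by (intro tendsto_sum) auto
  also have "(\<Sum>A\<in>P. \<Sum>w\<in>words P q. ?p (A # w) * (ln (?p (A # w)) - ln (?p w))) = join_entropy q - join_entropy (Suc q)"
  proof -
    have "(\<Sum>A\<in>P. \<Sum>w\<in>words P q. ?p (A # w) * ln (?p w)) = (\<Sum>w\<in>words P q. (\<Sum>A\<in>P. ?p (A # w)) * ln (?p w))"
      by (subst sum.swap) (simp add: sum_distrib_right)
    also have "\<dots> = - join_entropy q"
      by (simp add: join_entropy_eq sum_word_prob_Cons)
    finally show ?thesis
      by (simp add: right_diff_distrib sum_subtractf join_entropy_eq[of "Suc q"] sum_words_Cons)
  qed
  finally have "eventually (\<lambda>e. (\<Sum>A\<in>P. \<Sum>w\<in>words P q. ?p (A # w) * ln (\<tau> e A w)) > - c) (at_right 0)"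
    using q by (intro order_tendstoD(1)) auto
  moreover have "eventually (\<lambda>e::real. e > 0) (at_right 0)"
    by (rule eventually_at_right_less)
  ultimately have "eventually (\<lambda>e. e > 0 \<and> (\<Sum>A\<in>P. \<Sum>w\<in>words P q. ?p (A # w) * ln (\<tau> e A w)) > - c) (at_right 0)"
    by eventually_elim auto
  from eventually_happens'[OF _ this]
  obtain e where e: "e > 0" "(\<Sum>A\<in>P. \<Sum>w\<in>words P q. ?p (A # w) * ln (\<tau> e A w)) > - c"
    by auto
  have den: "?p w + e * real (card P) > 0" for w
    using e(1) Pne word_prob_nonneg[of w] by (intro add_nonneg_pos) auto
  show ?thesis
  proof (rule that[of q "\<tau> e"])
    show "0 < \<tau> e A w" for A w
      unfolding \<tau>_def by (rule divide_pos_pos[OF add_nonneg_pos[OF word_prob_nonneg e(1)] den])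
    show "(\<Sum>A\<in>P. \<tau> e A w) \<le> 1" if "w \<in> words P q" for w
    proof -
      have "(\<Sum>A\<in>P. \<tau> e A w) = (?p w + e * real (card P)) / (?p w + e * real (card P))"
        unfolding \<tau>_def sum_divide_distrib[symmetric] using sum_word_prob_Cons[OF that]
        by (simp add: sum.distrib mult.commute)
      then show ?thesis using den[of w] by simp
    qed
    show "- (\<integral>x. ln (\<tau> e (cell x) (word q (T x))) \<partial>M) < c" unfolding S using e(2) by simp
  qed
qed

end

section \<open>The circle\<close>

lemma cis_Arg2pi_circle: "x \<in> circle \<Longrightarrow> cis (Arg2pi x) = x"
  using complex_norm_eq_1_exp[of x] by (simp add: cis_conv_exp)

lemma cis_in_circle [simp]: "cis t \<in> circle"
  by simp

lemma cis_add_2pi: "cis (t + 2 * pi) = cis t"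
  by (simp add: cis.ctr)

lemma cis_plus_2pi_int: "cis (t + 2 * pi * of_int k) = cis t"
  using cis_multiple_2pi[of "of_int k"] by (simp add: cis_mult[symmetric])

text \<open>Near any point the circle has a continuous logarithm, so functions on it are continuous as soon as
  they are continuous in the angle.\<close>

lemma continuous_on_circleI:
  fixes h :: "complex \<Rightarrow> 'b::topological_space"
  assumes "continuous_on UNIV (\<lambda>t. h (cis t))"
  shows "continuous_on circle h"
  unfolding continuous_on_def
proof
  fix x0 assume x0: "x0 \<in> circle"
  define s where "s = Arg2pi x0"
  have s: "cis s = x0" using cis_Arg2pi_circle[OF x0] by (simp add: s_def)
  have x0n: "x0 \<noteq> 0" using x0 by auto
  have "((\<lambda>x. x / x0) \<longlongrightarrow> x0 / x0) (at x0 within circle)"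
    using x0n by (intro tendsto_intros)
  moreover have "isCont Arg (x0 / x0)"
    using x0n by (intro continuous_at_Arg) (auto simp: complex_nonpos_Reals_iff)
  ultimately have "((\<lambda>x. Arg (x / x0)) \<longlongrightarrow> Arg (x0 / x0)) (at x0 within circle)"
    by (rule isCont_tendsto_compose[rotated])
  then have "((\<lambda>x. s + Arg (x / x0)) \<longlongrightarrow> s + Arg (x0 / x0)) (at x0 within circle)"
    by (rule tendsto_add[OF tendsto_const])
  moreover have "isCont (\<lambda>t. h (cis t)) (s + Arg (x0 / x0))"
    using assms by (simp add: continuous_on_eq_continuous_at)
  ultimately have "((\<lambda>x. h (cis (s + Arg (x / x0)))) \<longlongrightarrow> h (cis (s + Arg (x0 / x0)))) (at x0 within circle)"
    by (rule isCont_tendsto_compose[rotated])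
  moreover have eq: "cis (s + Arg (x / x0)) = x" if "x \<in> circle" for x
  proof -
    have "cis (Arg (x / x0)) = x / x0"
      using that x0 x0n by (subst cis_Arg) (auto simp: sgn_eq norm_divide)
    then show ?thesis using x0n by (simp add: cis_mult[symmetric] s)
  qed
  ultimately show "(h \<longlongrightarrow> h x0) (at x0 within circle)"
    using x0 x0n s by (subst Lim_cong_within[where g = "\<lambda>x. h (cis (s + Arg (x / x0)))"]) (simp_all add: eq)
qed

lemma bounded_on_circle:
  fixes g :: "complex \<Rightarrow> real"
  assumes "continuous_on circle g"
  shows "\<exists>B>0. \<forall>x\<in>circle. \<bar>g x\<bar> \<le> B"
proof -
  have "bounded (g ` circle)"
    by (intro compact_imp_bounded compact_continuous_image assms compact_sphere)
  then obtain B where "B > 0" "\<forall>y\<in>g ` circle. norm y \<le> B"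
    unfolding bounded_pos by blast
  then show ?thesis by fastforce
qed

lemma space_circle_borel [simp]: "space circle_borel = circle"
  by (simp add: space_restrict_space)

lemma cis_measurable_circle: "cis \<in> borel \<rightarrow>\<^sub>M circle_borel"
  by (rule measurable_restrict_space2) (auto intro!: borel_measurable_continuous_onI continuous_intros)

lemma sets_circle_lebesgue [simp]: "sets circle_lebesgue = sets circle_borel"
  and space_circle_lebesgue [simp]: "space circle_lebesgue = circle"
  by (simp_all add: circle_lebesgue_def space_restrict_space)

lemma nn_integral_circle_lebesgue:
  assumes u: "u \<in> borel_measurable circle_borel"
  shows "(\<integral>\<^sup>+x. u x \<partial>circle_lebesgue) = (\<integral>\<^sup>+t\<in>{0..<2 * pi}. u (cis t) \<partial>lborel)"
proof -
  have "cis \<in> restrict_space lborel {0..<2 * pi} \<rightarrow>\<^sub>M circle_borel"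
    using measurable_restrict_space1[OF cis_measurable_circle, of "{0..<2 * pi}"]
    by (simp cong: measurable_cong_sets add: sets_restrict_space)
  then have "(\<integral>\<^sup>+x. u x \<partial>circle_lebesgue) = (\<integral>\<^sup>+t. u (cis t) \<partial>restrict_space lborel {0..<2 * pi})"
    using u by (simp add: circle_lebesgue_def nn_integral_distr)
  then show ?thesis by (simp add: nn_integral_restrict_space)
qed

lemma nn_integral_translate:
  fixes v :: "real \<Rightarrow> ennreal"
  assumes [measurable]: "v \<in> borel_measurable borel"
  shows "(\<integral>\<^sup>+t\<in>{a + p..<b + p}. v t \<partial>lborel) = (\<integral>\<^sup>+t\<in>{a..<b}. v (t + p) \<partial>lborel)"
proof -
  have "(\<integral>\<^sup>+t\<in>{a + p..<b + p}. v t \<partial>lborel)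
      = (\<integral>\<^sup>+t. v (p + 1 * t) * indicator {a + p..<b + p} (p + 1 * t) \<partial>lborel)"
    by (subst nn_integral_real_affine[where c = 1 and t = p]) auto
  also have "\<dots> = (\<integral>\<^sup>+t\<in>{a..<b}. v (t + p) \<partial>lborel)"
    by (intro nn_integral_cong) (auto simp: indicator_def add.commute)
  finally show ?thesis .
qed

text \<open>Lebesgue measure on the circle was defined through angles in one interval, but integrals are best
  computed in whichever period suits the arc at hand.\<close>

lemma nn_integral_circle_window:
  assumes u: "u \<in> borel_measurable circle_borel"
  shows "(\<integral>\<^sup>+x. u x \<partial>circle_lebesgue) = (\<integral>\<^sup>+t\<in>{s..<s + 2 * pi}. u (cis t) \<partial>lborel)"
proof -
  have v[measurable]: "(\<lambda>t. u (cis t)) \<in> borel_measurable borel"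
    by (rule measurable_compose[OF cis_measurable_circle u])
  \<comment> \<open>Whole periods are removed by a translation. Then the window \<open>[r, r + 2 pi)\<close> is cut at \<open>2 pi\<close>, and its
  second part is translated back to \<open>[0, r)\<close>.\<close>
  define k where "k = \<lfloor>s / (2 * pi)\<rfloor>"
  define r where "r = s - 2 * pi * of_int k"
  have "of_int k \<le> s / (2 * pi)" "s / (2 * pi) < of_int k + 1"
    unfolding k_def by linarith+
  then have r: "0 \<le> r" "r \<le> 2 * pi"
    by (auto simp: r_def field_simps)
  have "(\<integral>\<^sup>+t\<in>{s..<s + 2 * pi}. u (cis t) \<partial>lborel)
      = (\<integral>\<^sup>+t\<in>{r + 2 * pi * of_int k..<(r + 2 * pi) + 2 * pi * of_int k}. u (cis t) \<partial>lborel)"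
    by (simp add: r_def)
  also have "\<dots> = (\<integral>\<^sup>+t\<in>{r..<r + 2 * pi}. u (cis t) \<partial>lborel)"
    by (subst nn_integral_translate[OF v]) (simp add: cis_plus_2pi_int)
  also have "\<dots> = (\<integral>\<^sup>+t. u (cis t) * indicator {r..<2 * pi} t + u (cis t) * indicator {0 + 2 * pi..<r + 2 * pi} t \<partial>lborel)"
    using r by (intro nn_integral_cong) (auto simp: indicator_def)
  also have "\<dots> = (\<integral>\<^sup>+t\<in>{r..<2 * pi}. u (cis t) \<partial>lborel) + (\<integral>\<^sup>+t\<in>{0 + 2 * pi..<r + 2 * pi}. u (cis t) \<partial>lborel)"
    by (rule nn_integral_add) auto
  also have "(\<integral>\<^sup>+t\<in>{0 + 2 * pi..<r + 2 * pi}. u (cis t) \<partial>lborel) = (\<integral>\<^sup>+t\<in>{0..<r}. u (cis t) \<partial>lborel)"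
    unfolding nn_integral_translate[OF v, of 0 "2 * pi" r] by (simp add: cis_add_2pi)
  also have "(\<integral>\<^sup>+t\<in>{r..<2 * pi}. u (cis t) \<partial>lborel) + (\<integral>\<^sup>+t\<in>{0..<r}. u (cis t) \<partial>lborel)
     = (\<integral>\<^sup>+t. u (cis t) * indicator {r..<2 * pi} t + u (cis t) * indicator {0..<r} t \<partial>lborel)"
    by (rule nn_integral_add[symmetric]) auto
  also have "\<dots> = (\<integral>\<^sup>+t\<in>{0..<2 * pi}. u (cis t) \<partial>lborel)"
    using r by (intro nn_integral_cong) (auto simp: indicator_def)
  finally show ?thesis by (simp add: nn_integral_circle_lebesgue[OF u])
qed

lemma nn_integral_subwindow_le:
  assumes u: "u \<in> borel_measurable circle_borel" and J: "b \<le> a + 2 * pi"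
  shows "(\<integral>\<^sup>+t\<in>{a..b}. u (cis t) \<partial>lborel) \<le> (\<integral>\<^sup>+x. u x \<partial>circle_lebesgue)"
proof -
  have "(\<integral>\<^sup>+t\<in>{a..b}. u (cis t) \<partial>lborel) \<le> (\<integral>\<^sup>+t\<in>{a..<a + 2 * pi}. u (cis t) \<partial>lborel)"
  proof (rule nn_integral_mono_AE)
    have "AE t in lborel. t \<noteq> a + 2 * pi"
      by (rule AE_lborel_singleton)
    then show "AE t in lborel. u (cis t) * indicator {a..b} t \<le> u (cis t) * indicator {a..<a + 2 * pi} t"
      by eventually_elim (use J in \<open>auto simp: indicator_def\<close>)
  qed
  then show ?thesis by (simp add: nn_integral_circle_window[OF u, of a])
qed

lemma emeasure_circle_lebesgue: "emeasure circle_lebesgue circle = ennreal (2 * pi)"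
  using nn_integral_circle_lebesgue[of "\<lambda>_. 1"] by simp

lemma has_vector_derivative_cis:
  assumes "(F has_real_derivative F') (at t)"
  shows "((\<lambda>t. cis (F t)) has_vector_derivative (F' *\<^sub>R (\<i> * cis (F t)))) (at t)"
  using has_derivative_cis[OF assms[unfolded has_field_derivative_def]]
  by (simp add: has_vector_derivative_def mult.commute scaleR_scaleR[symmetric] del: scaleR_scaleR)

text \<open>Since \<open>|f| = 1\<close>, the derivative of \<open>t \<mapsto> f (cis t)\<close> is \<open>\<i> w f\<close> with a real continuous \<open>w\<close>. An
  antiderivative of \<open>w\<close> is a lift up to an additive constant, because
  \<open>t \<mapsto> f (cis t) cis (- F t)\<close> has derivative zero.\<close>

lemma circle_map_lift:
  assumes f: "C1_circle_map f"
  obtains F F' where "\<And>t. (F has_real_derivative F' t) (at t)" "continuous_on UNIV F'"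
    "\<And>t. f (cis t) = cis (F t)" "\<And>t. circle_deriv_norm f (cis t) = \<bar>F' t\<bar>"
proof -
  define g where "g t = f (cis t)" for t
  obtain D where D: "\<And>t. (g has_vector_derivative D t) (at t)" and cD: "continuous_on UNIV D"
    using f unfolding C1_circle_map_def C1_differentiable_on_def g_def by auto
  have gn: "g t * cnj (g t) = 1" for t
  proof -
    have "norm (g t) = 1" using f by (auto simp: C1_circle_map_def g_def Pi_iff)
    then show ?thesis by (simp add: complex_norm_square[symmetric])
  qed
  define w where "w t = Im (D t * cnj (g t))" for t
  have Dw: "D t = \<i> * of_real (w t) * g t" for t
  proof -
    have "((\<lambda>t. g t * cnj (g t)) has_vector_derivative (g t * cnj (D t) + D t * cnj (g t))) (at t)"
      by (intro derivative_eq_intros has_vector_derivative_mult D has_vector_derivative_cnj)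
    moreover have "((\<lambda>t. g t * cnj (g t)) has_vector_derivative 0) (at t)"
      unfolding gn by (rule has_vector_derivative_const)
    ultimately have "g t * cnj (D t) + D t * cnj (g t) = 0"
      by (rule vector_derivative_unique_at)
    then have "Re (g t * cnj (D t) + D t * cnj (g t)) = 0" by simp
    then have "Re (D t * cnj (g t)) = 0" by simp
    then have "D t * cnj (g t) = \<i> * of_real (w t)"
      by (simp add: complex_eq_iff w_def)
    then have "D t * cnj (g t) * g t = \<i> * of_real (w t) * g t" by simp
    moreover have "D t * cnj (g t) * g t = D t" using gn[of t] by (simp add: mult.assoc mult.commute[of _ "g t"])
    ultimately show ?thesis by simp
  qed
  have cg: "continuous_on UNIV g"
    using D by (auto simp: continuous_on_eq_continuous_at intro: has_vector_derivative_continuous)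
  have cw: "continuous_on UNIV w"
    unfolding w_def by (intro continuous_intros cD cg)
  obtain F where F: "\<And>t. (F has_vector_derivative w t) (at t)"
    using einterval_antiderivative[of "-\<infinity>" "\<infinity>" w] cw
    by (auto simp: continuous_on_eq_continuous_at)
  then have F': "(F has_real_derivative w t) (at t)" for t
    by (simp add: has_real_derivative_iff_has_vector_derivative)
  have "((\<lambda>t. g t * cis (- F t)) has_vector_derivative 0) (at t)" for t
  proof -
    have "((\<lambda>t. - F t) has_real_derivative (- w t)) (at t)"
      using F' by (intro derivative_intros)
    from has_vector_derivative_mult[OF D has_vector_derivative_cis[OF this]]
    show ?thesis by (rule has_vector_derivative_eq_rhs) (simp add: Dw scaleR_conv_of_real)
  qed
  then obtain c where c: "\<And>t. g t * cis (- F t) = c"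
    using has_vector_derivative_zero_constant[of UNIV "\<lambda>t. g t * cis (- F t)"] by auto
  have "norm c = 1"
  proof -
    have "norm (g 0) = 1" using f by (auto simp: C1_circle_map_def g_def Pi_iff)
    then show ?thesis using c[of 0] by (metis norm_mult norm_cis mult_1_right)
  qed
  then have "cis (Arg2pi c) = c" by (intro cis_Arg2pi_circle) simp
  have gF: "g t = cis (Arg2pi c + F t)" for t
  proof -
    have "g t = g t * cis (- F t) * cis (F t)" by (simp add: cis_mult)
    also have "\<dots> = cis (Arg2pi c) * cis (F t)" using c \<open>cis (Arg2pi c) = c\<close> by simp
    finally show ?thesis by (simp add: cis_mult)
  qed
  have "circle_deriv_norm f (cis t) = \<bar>w t\<bar>" for t
  proof -
    have "((\<lambda>s. g (t + s)) has_vector_derivative D t) (at 0)"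
    proof -
      have "((\<lambda>s. t + s) has_vector_derivative 1) (at 0)"
        by (auto intro!: derivative_eq_intros)
      from vector_diff_chain_at[OF this, of g "D t"] D[of t] show ?thesis
        by (simp add: comp_def)
    qed
    then have "vector_derivative (\<lambda>s. f (cis t * cis s)) (at 0) = D t"
      by (simp add: g_def cis_mult vector_derivative_at)
    moreover have "norm (g t) = 1" using f by (auto simp: C1_circle_map_def g_def Pi_iff)
    ultimately show ?thesis by (simp add: circle_deriv_norm_def Dw norm_mult)
  qed
  moreover have "((\<lambda>t. Arg2pi c + F t) has_real_derivative w t) (at t)" for t
    using DERIV_add[OF DERIV_const F'[of t]] by simp
  ultimately show ?thesis
    using that[of "\<lambda>t. Arg2pi c + F t" w] cw gF unfolding g_def by blast
qed

text \<open>The number of the arc that contains \<open>x\<close> when the circle is cut into \<open>N\<close> equal arcs, the first of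
  which starts at angle \<open>\<beta>\<close>. Reduction modulo \<open>N\<close> makes the formula valid for every angle of \<open>x\<close>.\<close>

definition arc_index :: "nat \<Rightarrow> real \<Rightarrow> complex \<Rightarrow> int" where
  "arc_index N \<beta> x = \<lfloor>real N * (Arg2pi x - \<beta>) / (2 * pi)\<rfloor> mod int N"

lemma arc_index_cis:
  assumes "N > 0"
  shows "arc_index N \<beta> (cis t) = \<lfloor>real N * (t - \<beta>) / (2 * pi)\<rfloor> mod int N"
proof -
  have "cis (Arg2pi (cis t)) = cis t" by (rule cis_Arg2pi_circle) simp
  then obtain k :: int where k: "Arg2pi (cis t) = t + 2 * pi * of_int k"
    using sin_cos_eq_iff[of "Arg2pi (cis t)" t] by (auto simp: complex_eq_iff)
  have "real N * (Arg2pi (cis t) - \<beta>) / (2 * pi) = real N * (t - \<beta>) / (2 * pi) + of_int (int N * k)"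
    by (simp add: k field_simps)
  then show ?thesis unfolding arc_index_def by (simp only: floor_add_int[symmetric]) simp
qed

lemma arc_index_range: "N > 0 \<Longrightarrow> arc_index N \<beta> x \<in> {0..<int N}"
  by (simp add: arc_index_def)

lemma Arg2pi_measurable: "Arg2pi \<in> borel_measurable borel"
  unfolding borel_measurable_iff_le using closed_Arg2pi2pi_le by (auto intro: borel_closed)

lemma arc_index_measurable: "arc_index N \<beta> \<in> circle_borel \<rightarrow>\<^sub>M count_space UNIV"
proof -
  have [measurable]: "Arg2pi \<in> borel_measurable circle_borel"
    by (rule measurable_restrict_space1[OF Arg2pi_measurable])
  show ?thesis unfolding arc_index_def by measurable
qed

lemma arc_index_window:
  assumes N: "N > 0" and t: "t \<in> {\<beta>..<\<beta> + 2 * pi}" and i: "arc_index N \<beta> (cis t) = i"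
  shows "t \<in> {\<beta> + 2 * pi * of_int i / real N..\<beta> + 2 * pi * of_int (i + 1) / real N}"
proof -
  let ?z = "real N * (t - \<beta>) / (2 * pi)"
  have "0 \<le> ?z" using t by simp
  moreover have "?z < real N"
  proof -
    have "real N * (t - \<beta>) < real N * (2 * pi)" using t N by (intro mult_strict_left_mono) auto
    then show ?thesis by (simp add: pos_divide_less_eq)
  qed
  ultimately have "0 \<le> \<lfloor>?z\<rfloor>" "\<lfloor>?z\<rfloor> < int N" by (auto simp: floor_less_iff)
  then have "\<lfloor>?z\<rfloor> = i" using i by (simp add: arc_index_cis[OF N])
  then have "of_int i \<le> ?z" "?z \<le> of_int (i + 1)" by linarith+
  then show ?thesis using N by (simp add: field_simps)
qed

lemma invariant_probsD:
  assumes "\<mu> \<in> invariant_probs f"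
  shows "prob_space \<mu>" "sets \<mu> = sets circle_borel" "space \<mu> = circle" "distr \<mu> circle_borel f = \<mu>"
proof -
  show "prob_space \<mu>" "distr \<mu> circle_borel f = \<mu>" and s: "sets \<mu> = sets circle_borel"
    using assms by (auto simp: invariant_probs_def circle_probs_def)
  show "space \<mu> = circle" using sets_eq_imp_space_eq[OF s] by simp
qed


section \<open>Vanishing noise\<close>

lemma circle_probsD:
  assumes "\<mu> \<in> circle_probs"
  shows "prob_space \<mu>" "sets \<mu> = sets circle_borel" "space \<mu> = circle"
    "borel_measurable \<mu> = borel_measurable circle_borel"
proof -
  show "prob_space \<mu>" and s: "sets \<mu> = sets circle_borel"
    using assms by (auto simp: circle_probs_def)
  show "space \<mu> = circle" using sets_eq_imp_space_eq[OF s] by simp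
  show "borel_measurable \<mu> = borel_measurable circle_borel"
    by (rule measurable_cong_sets[OF s refl])
qed

lemma circle_probs_integrable:
  fixes \<phi> :: "complex \<Rightarrow> 'b::{banach, second_countable_topology}"
  assumes "\<mu> \<in> circle_probs" and "\<phi> \<in> borel_measurable circle_borel" "\<And>x. x \<in> circle \<Longrightarrow> norm (\<phi> x) \<le> B"
  shows "integrable \<mu> \<phi>"
proof -
  note m = circle_probsD[OF assms(1)]
  interpret prob_space \<mu> by (rule m)
  show ?thesis using assms(2,3) by (intro integrable_const_bound[of _ B] AE_I2) (auto simp: m)
qed

lemma norm_bounded_on_circle:
  fixes \<phi> :: "complex \<Rightarrow> 'b::real_normed_vector"
  assumes "continuous_on circle \<phi>"
  shows "\<exists>B. \<forall>x\<in>circle. norm (\<phi> x) \<le> B"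
  using bounded_on_circle[of "\<lambda>x. norm (\<phi> x)"] assms continuous_on_norm by fastforce

lemma circle_probs_integrable_continuous:
  fixes \<phi> :: "complex \<Rightarrow> 'b::{banach, second_countable_topology}"
  assumes "\<mu> \<in> circle_probs" "continuous_on circle \<phi>"
  shows "integrable \<mu> \<phi>"
proof -
  obtain B where "\<forall>x\<in>circle. norm (\<phi> x) \<le> B" using norm_bounded_on_circle[OF assms(2)] by blast
  then show ?thesis
    by (intro circle_probs_integrable[of _ _ B] assms borel_measurable_continuous_on_restrict) auto
qed

text \<open>The indicator of a closed set is a decreasing limit of continuous functions, so integrals of
  continuous functions determine a measure.\<close>

lemma circle_probs_closed_emeasure:
  assumes \<mu>: "\<mu> \<in> circle_probs" and C: "closed C" "C \<noteq> {}"
  shows "(\<lambda>k. \<integral>x. (1 / (1 + infdist x C)) ^ k \<partial>\<mu>) \<longlonglongrightarrow> measure \<mu> (C \<inter> circle)"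
proof -
  note m = circle_probsD[OF \<mu>]
  interpret prob_space \<mu> by (rule m)
  have CS: "C \<inter> circle \<in> sets \<mu>"
    unfolding m sets_restrict_space using C(1) by (auto simp: Int_commute)
  have cont: "continuous_on circle (\<lambda>x. (1 / (1 + infdist x C)) ^ k)" for k
    by (intro continuous_intros ballI) (metis add_pos_nonneg infdist_nonneg less_irrefl zero_less_one)
  have "(\<lambda>k. \<integral>x. (1 / (1 + infdist x C)) ^ k \<partial>\<mu>) \<longlonglongrightarrow> (\<integral>x. indicator (C \<inter> circle) x \<partial>\<mu>)"
  proof (rule integral_dominated_convergence[where w = "\<lambda>_. 1"])
    show "(indicator (C \<inter> circle) :: complex \<Rightarrow> real) \<in> borel_measurable \<mu>" using CS by simp
    show "(\<lambda>x. (1 / (1 + infdist x C)) ^ k) \<in> borel_measurable \<mu>" for k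
      unfolding m by (rule borel_measurable_continuous_on_restrict[OF cont])
    show "AE x in \<mu>. norm ((1 / (1 + infdist x C)) ^ k) \<le> 1" for k
      by (intro AE_I2) (auto intro!: power_le_one simp: infdist_nonneg add_nonneg_pos divide_le_eq_1)
    show "AE x in \<mu>. (\<lambda>k. (1 / (1 + infdist x C)) ^ k) \<longlonglongrightarrow> indicator (C \<inter> circle) x"
    proof (rule AE_I2)
      fix x assume "x \<in> space \<mu>"
      then have x: "x \<in> circle" by (simp add: m)
      show "(\<lambda>k. (1 / (1 + infdist x C)) ^ k) \<longlonglongrightarrow> indicator (C \<inter> circle) x"
      proof (cases "x \<in> C")
        case True
        then show ?thesis using x by simp
      next
        case False
        then have "infdist x C > 0"
          using in_closed_iff_infdist_zero[OF C] infdist_nonneg[of x C] by (metis order_le_less)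
        then show ?thesis using False by (simp add: LIMSEQ_power_zero)
      qed
    qed
  qed simp
  then show ?thesis using CS by (simp add: Int_absorb2 sets.sets_into_space)
qed

lemma circle_probs_eqI:
  assumes \<mu>: "\<mu> \<in> circle_probs" and \<nu>: "\<nu> \<in> circle_probs"
    and eq: "\<And>\<phi> :: complex \<Rightarrow> complex. continuous_on circle \<phi> \<Longrightarrow> (\<integral>x. \<phi> x \<partial>\<mu>) = (\<integral>x. \<phi> x \<partial>\<nu>)"
  shows "\<mu> = \<nu>"
proof -
  note m = circle_probsD[OF \<mu>] and n = circle_probsD[OF \<nu>]
  interpret \<mu>: prob_space \<mu> by (rule m)
  interpret \<nu>: prob_space \<nu> by (rule n)
  have idm: "(\<lambda>x. x) \<in> \<mu> \<rightarrow>\<^sub>M borel" "(\<lambda>x. x) \<in> \<nu> \<rightarrow>\<^sub>M borel"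
    unfolding m n by (rule borel_measurable_continuous_on_restrict, rule continuous_on_id)+
  have real_eq: "(\<integral>x. h x \<partial>\<mu>) = (\<integral>x. h x \<partial>\<nu>)" if "continuous_on circle h" for h :: "complex \<Rightarrow> real"
  proof -
    have "(\<integral>x. complex_of_real (h x) \<partial>\<mu>) = (\<integral>x. complex_of_real (h x) \<partial>\<nu>)"
      by (intro eq continuous_intros that)
    then show ?thesis by simp
  qed
  have closed_eq: "measure \<mu> (C \<inter> circle) = measure \<nu> (C \<inter> circle)" if C: "closed C" for C
  proof (cases "C = {}")
    case False
    have "(\<integral>x. (1 / (1 + infdist x C)) ^ k \<partial>\<mu>) = (\<integral>x. (1 / (1 + infdist x C)) ^ k \<partial>\<nu>)" for k
      by (intro real_eq continuous_intros ballI) (metis add_pos_nonneg infdist_nonneg less_irrefl zero_less_one)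
    with circle_probs_closed_emeasure[OF \<mu> C False] circle_probs_closed_emeasure[OF \<nu> C False]
    show ?thesis by (auto intro: LIMSEQ_unique)
  qed simp
  have D: "distr \<mu> borel (\<lambda>x. x) = distr \<nu> borel (\<lambda>x. x)"
  proof (rule measure_eqI_generator_eq[where \<Omega> = UNIV and E = "Collect closed" and A = "\<lambda>_. UNIV"])
    show "Int_stable (Collect closed :: complex set set)" by (auto simp: Int_stable_def)
    fix C :: "complex set" assume "C \<in> Collect closed"
    then have C: "closed C" by simp
    then have CB: "C \<in> sets borel" by (rule borel_closed)
    show "emeasure (distr \<mu> borel (\<lambda>x. x)) C = emeasure (distr \<nu> borel (\<lambda>x. x)) C"
      using closed_eq[OF C]
      by (simp add: emeasure_distr[OF idm(1) CB] emeasure_distr[OF idm(2) CB] m(3) n(3)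
          \<mu>.emeasure_eq_measure \<nu>.emeasure_eq_measure)
  next
    show "emeasure (distr \<mu> borel (\<lambda>x. x)) UNIV \<noteq> \<infinity>" for i :: nat
      using prob_space.emeasure_space_1[OF \<mu>.prob_space_distr[OF idm(1)]] by simp
  qed (auto simp: borel_eq_closed)
  show ?thesis
  proof (rule measure_eqI)
    fix A assume A: "A \<in> sets \<mu>"
    have "circle \<inter> UNIV \<in> sets (borel :: complex measure)" by (simp add: borel_closed)
    then have AB: "A \<in> sets borel" and AC: "A \<subseteq> circle"
      using A unfolding m by (auto simp: sets_restrict_space)
    then have "A \<inter> circle = A" by blast
    then show "emeasure \<mu> A = emeasure \<nu> A"
      using emeasure_distr[OF idm(1) AB] emeasure_distr[OF idm(2) AB] D by (simp add: m(3) n(3))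
  qed (simp add: m n)
qed

text \<open>The random angle by which the noise rotates \<open>f x\<close>. With it all noise kernels are images of a single
  measure, which gives measurability in \<open>x\<close> and Fubini's theorem without a theory of kernels.\<close>

definition noise_law :: "real \<Rightarrow> real measure" where
  "noise_law \<epsilon> = uniform_measure lborel {-\<epsilon><..<\<epsilon>}"

lemma prob_space_noise_law: "\<epsilon> > 0 \<Longrightarrow> prob_space (noise_law \<epsilon>)"
  unfolding noise_law_def by (rule prob_space_uniform_measure) auto

lemma sets_noise_law [simp]: "sets (noise_law \<epsilon>) = sets borel"
  by (simp add: noise_law_def)

lemma space_noise_law [simp]: "space (noise_law \<epsilon>) = UNIV"
  by (simp add: noise_law_def)

text \<open>Balls are rewritten through the cosine, which is continuous, whereas the argument has a jump.\<close>

lemma circle_ball_eq: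
  assumes \<epsilon>: "0 < \<epsilon>" "\<epsilon> \<le> 1" and y: "y \<in> circle"
  shows "circle_ball y \<epsilon> = {x \<in> circle. cos \<epsilon> < Re (x / y)}"
proof -
  have "\<bar>Arg (x / y)\<bar> < \<epsilon> \<longleftrightarrow> cos \<epsilon> < Re (x / y)" if x: "x \<in> circle" for x
  proof -
    define a where "a = Arg (x / y)"
    have "norm (x / y) = 1" using x y by (simp add: norm_divide)
    then have "cis a = x / y" unfolding a_def by (subst cis_Arg) (auto simp: sgn_eq)
    then have "cos a = Re (x / y)" by (metis cis.sel(1))
    moreover have "\<bar>a\<bar> \<le> pi" using Arg_bounded[of "x / y"] by (simp add: a_def abs_le_iff)
    moreover have "cos \<bar>a\<bar> = cos a" by simp
    ultimately show ?thesis
      using cos_mono_less_eq[of \<epsilon> "\<bar>a\<bar>"] \<epsilon> pi_gt3 by (simp add: a_def)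
  qed
  then show ?thesis by (auto simp: circle_ball_def)
qed

lemma cis_in_circle_ball:
  assumes \<epsilon>: "0 < \<epsilon>" "\<epsilon> \<le> 1" and t: "\<bar>t - s\<bar> \<le> pi"
  shows "cis t \<in> circle_ball (cis s) \<epsilon> \<longleftrightarrow> \<bar>t - s\<bar> < \<epsilon>"
proof -
  have "Re (cis t / cis s) = cos \<bar>t - s\<bar>" by (simp add: cis_divide)
  then show ?thesis
    using cos_mono_less_eq[of \<epsilon> "\<bar>t - s\<bar>"] \<epsilon> t pi_gt3 by (simp add: circle_ball_eq)
qed

lemma circle_ball_measurable:
  assumes \<epsilon>: "0 < \<epsilon>" "\<epsilon> \<le> 1" and y: "y \<in> circle"
  shows "circle_ball y \<epsilon> \<in> sets circle_borel"
proof -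
  have "open {x. cos \<epsilon> < Re (x / y)}"
    using y by (intro open_Collect_less continuous_intros) auto
  then have "circle \<inter> {x. cos \<epsilon> < Re (x / y)} \<in> sets circle_borel"
    unfolding sets_restrict_space by (intro imageI borel_open)
  moreover have "circle \<inter> {x. cos \<epsilon> < Re (x / y)} = circle_ball y \<epsilon>"
    by (auto simp: circle_ball_eq[OF assms])
  ultimately show ?thesis by simp
qed

lemma rotate_measurable: "(\<lambda>(y, t). y * cis t) \<in> circle_borel \<Otimes>\<^sub>M borel \<rightarrow>\<^sub>M circle_borel"
proof (rule measurable_restrict_space2)
  show "(\<lambda>(y, t). y * cis t) \<in> space (circle_borel \<Otimes>\<^sub>M borel) \<rightarrow> circle"
    by (auto simp: space_pair_measure norm_mult)
  have [measurable]: "(\<lambda>x. x) \<in> circle_borel \<rightarrow>\<^sub>M borel"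
    by (rule borel_measurable_continuous_on_restrict) (rule continuous_on_id)
  have [measurable]: "cis \<in> borel \<rightarrow>\<^sub>M borel"
    by (intro borel_measurable_continuous_onI continuous_intros)
  have "fst \<in> circle_borel \<Otimes>\<^sub>M (borel :: real measure) \<rightarrow>\<^sub>M borel"
    using measurable_compose[OF measurable_fst, of "\<lambda>x. x" circle_borel borel] by simp
  then have [measurable]: "fst \<in> borel_measurable (circle_borel \<Otimes>\<^sub>M (borel :: real measure))" .
  show "(\<lambda>(y, t). y * cis t) \<in> borel_measurable (circle_borel \<Otimes>\<^sub>M borel)"
    unfolding split_beta by measurable
qed

lemma rotate_measurable1: "y \<in> circle \<Longrightarrow> (\<lambda>t. y * cis t) \<in> borel \<rightarrow>\<^sub>M circle_borel"
  using measurable_compose[OF measurable_Pair1' rotate_measurable, of y] by simp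

lemma noise_kernel_eq:
  assumes \<epsilon>: "0 < \<epsilon>" "\<epsilon> \<le> 1" and y: "f x \<in> circle"
  shows "noise_kernel f \<epsilon> x = distr (noise_law \<epsilon>) circle_borel (\<lambda>t. f x * cis t)"
proof -
  define s where "s = Arg2pi (f x)"
  have s: "f x = cis s" using cis_Arg2pi_circle[OF y] by (simp add: s_def)
  have ballS: "circle_ball (cis s) \<epsilon> \<in> sets circle_borel" by (rule circle_ball_measurable[OF \<epsilon>]) simp
  have ball: "emeasure circle_lebesgue (circle_ball (cis s) \<epsilon> \<inter> A)
      = emeasure lborel ({-\<epsilon><..<\<epsilon>} \<inter> {t. cis s * cis t \<in> A})" if A: "A \<in> sets circle_borel" for A
  proof -
    have AS: "circle_ball (cis s) \<epsilon> \<inter> A \<in> sets circle_borel" using ballS A by (rule sets.Int)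
    have rot: "(\<lambda>t. cis s * cis t) \<in> borel \<rightarrow>\<^sub>M circle_borel" by (rule rotate_measurable1) simp
    have TS: "{t. cis s * cis t \<in> A} \<in> sets borel"
      using measurable_sets[OF rot A] by (simp add: vimage_def)
    have cS: "{t. cis t \<in> A} \<in> sets borel"
      using measurable_sets[OF cis_measurable_circle A] by (simp add: vimage_def)
    have "emeasure circle_lebesgue (circle_ball (cis s) \<epsilon> \<inter> A)
      = (\<integral>\<^sup>+x. indicator (circle_ball (cis s) \<epsilon> \<inter> A) x \<partial>circle_lebesgue)"
      using AS by simp
    also have "\<dots> = (\<integral>\<^sup>+t\<in>{s - pi..<(s - pi) + 2 * pi}. indicator (circle_ball (cis s) \<epsilon> \<inter> A) (cis t) \<partial>lborel)"
      using AS by (intro nn_integral_circle_window) simp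
    also have "\<dots> = (\<integral>\<^sup>+t. indicator ({s - \<epsilon><..<s + \<epsilon>} \<inter> {t. cis t \<in> A}) t \<partial>lborel)"
    proof (rule nn_integral_cong)
      fix t :: real
      show "(indicator (circle_ball (cis s) \<epsilon> \<inter> A) (cis t) * indicator {s - pi..<(s - pi) + 2 * pi} t :: ennreal)
        = indicator ({s - \<epsilon><..<s + \<epsilon>} \<inter> {t. cis t \<in> A}) t"
      proof (cases "\<bar>t - s\<bar> \<le> pi")
        case True
        have "t \<in> {s - \<epsilon><..<s + \<epsilon>} \<longleftrightarrow> \<bar>t - s\<bar> < \<epsilon>" by auto
        then show ?thesis using cis_in_circle_ball[OF \<epsilon> True] \<epsilon> pi_gt3 by (auto simp: indicator_def)
      next
        case False
        then show ?thesis using \<epsilon> pi_gt3 by (auto simp: indicator_def)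
      qed
    qed
    also have "\<dots> = (\<integral>\<^sup>+t. indicator ({s - \<epsilon><..<s + \<epsilon>} \<inter> {t. cis t \<in> A}) (s + 1 * t) \<partial>lborel)"
      using cS by (subst nn_integral_real_affine[where c = 1 and t = s]) auto
    also have "\<dots> = (\<integral>\<^sup>+t. indicator ({-\<epsilon><..<\<epsilon>} \<inter> {t. cis s * cis t \<in> A}) t \<partial>lborel)"
      by (intro nn_integral_cong) (auto simp: indicator_def cis_mult)
    also have "\<dots> = emeasure lborel ({-\<epsilon><..<\<epsilon>} \<inter> {t. cis s * cis t \<in> A})"
      using TS by (intro nn_integral_indicator) auto
    finally show ?thesis .
  qed
  have total: "emeasure circle_lebesgue (circle_ball (cis s) \<epsilon>) = emeasure lborel {-\<epsilon><..<\<epsilon>}"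
  proof -
    have top: "circle \<in> sets circle_borel" using sets.top[of circle_borel] by simp
    have "circle_ball (cis s) \<epsilon> \<inter> circle = circle_ball (cis s) \<epsilon>" by (auto simp: circle_ball_def)
    moreover have "{-\<epsilon><..<\<epsilon>} \<inter> {t. cis s * cis t \<in> circle} = {-\<epsilon><..<\<epsilon>}" by (auto simp: norm_mult)
    ultimately show ?thesis using ball[OF top] by simp
  qed
  show ?thesis
  proof (rule measure_eqI)
    show "sets (noise_kernel f \<epsilon> x) = sets (distr (noise_law \<epsilon>) circle_borel (\<lambda>t. f x * cis t))"
      by (simp add: noise_kernel_def)
    fix A assume "A \<in> sets (noise_kernel f \<epsilon> x)"
    then have A: "A \<in> sets circle_borel" by (simp add: noise_kernel_def)
    have rot: "(\<lambda>t. f x * cis t) \<in> borel \<rightarrow>\<^sub>M circle_borel" by (rule rotate_measurable1[OF y])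
    have rot': "(\<lambda>t. f x * cis t) \<in> noise_law \<epsilon> \<rightarrow>\<^sub>M circle_borel"
      using rot unfolding measurable_cong_sets[OF sets_noise_law refl] .
    have TS: "{t. f x * cis t \<in> A} \<in> sets borel"
      using measurable_sets[OF rot A] by (simp add: vimage_def)
    have "emeasure (noise_kernel f \<epsilon> x) A
        = emeasure circle_lebesgue (circle_ball (cis s) \<epsilon> \<inter> A) / emeasure circle_lebesgue (circle_ball (cis s) \<epsilon>)"
      unfolding noise_kernel_def s using ballS A by (intro emeasure_uniform_measure) auto
    also have "\<dots> = emeasure lborel ({-\<epsilon><..<\<epsilon>} \<inter> {t. f x * cis t \<in> A}) / emeasure lborel {-\<epsilon><..<\<epsilon>}"
      by (simp only: ball[OF A] total s)
    also have "\<dots> = emeasure (noise_law \<epsilon>) {t. f x * cis t \<in> A}"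
      unfolding noise_law_def using TS by (intro emeasure_uniform_measure[symmetric]) auto
    also have "\<dots> = emeasure (distr (noise_law \<epsilon>) circle_borel (\<lambda>t. f x * cis t)) A"
      by (simp add: emeasure_distr[OF rot' A] vimage_def)
    finally show "emeasure (noise_kernel f \<epsilon> x) A = emeasure (distr (noise_law \<epsilon>) circle_borel (\<lambda>t. f x * cis t)) A" .
  qed
qed

lemma transfer_op_eq:
  assumes \<epsilon>: "0 < \<epsilon>" "\<epsilon> \<le> 1" and y: "f x \<in> circle" and \<phi>: "\<phi> \<in> borel_measurable circle_borel"
  shows "transfer_op f \<epsilon> \<phi> x = (\<integral>t. \<phi> (f x * cis t) \<partial>noise_law \<epsilon>)"
proof -
  have "(\<lambda>t. f x * cis t) \<in> noise_law \<epsilon> \<rightarrow>\<^sub>M circle_borel"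
    using rotate_measurable1[OF y] unfolding measurable_cong_sets[OF sets_noise_law refl] .
  then show ?thesis unfolding transfer_op_def noise_kernel_eq[of \<epsilon> f x, OF \<epsilon> y] using \<phi> by (rule integral_distr)
qed

locale circle_dynamics =
  fixes f :: "complex \<Rightarrow> complex"
  assumes f_continuous: "continuous_on circle f" and f_in_circle: "\<And>x. x \<in> circle \<Longrightarrow> f x \<in> circle"
begin

lemma f_borel: "f \<in> circle_borel \<rightarrow>\<^sub>M circle_borel"
  by (intro measurable_restrict_space2 borel_measurable_continuous_on_restrict f_continuous) (auto dest: f_in_circle)

lemma noisy_image_measurable:
  "(\<lambda>(x, t). f x * cis t) \<in> circle_borel \<Otimes>\<^sub>M borel \<rightarrow>\<^sub>M circle_borel"
proof -
  have "(\<lambda>(x, t). (f x, t)) \<in> circle_borel \<Otimes>\<^sub>M (borel :: real measure) \<rightarrow>\<^sub>M circle_borel \<Otimes>\<^sub>M borel"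
    using f_borel by measurable
  from measurable_compose[OF this rotate_measurable] show ?thesis by (simp add: split_beta)
qed

lemma transfer_op_circle:
  assumes "0 < \<epsilon>" "\<epsilon> \<le> 1" and "\<phi> \<in> borel_measurable circle_borel" and x: "x \<in> circle"
  shows "transfer_op f \<epsilon> \<phi> x = (\<integral>t. \<phi> (f x * cis t) \<partial>noise_law \<epsilon>)"
  using assms(1,2) f_in_circle[OF x] assms(3) by (rule transfer_op_eq)

lemma transfer_op_measurable:
  fixes \<phi> :: "complex \<Rightarrow> complex"
  assumes \<epsilon>: "0 < \<epsilon>" "\<epsilon> \<le> 1" and \<phi>: "\<phi> \<in> borel_measurable circle_borel"
  shows "transfer_op f \<epsilon> \<phi> \<in> borel_measurable circle_borel"
proof -
  interpret prob_space "noise_law \<epsilon>" by (rule prob_space_noise_law[OF \<epsilon>(1)])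
  have "(\<lambda>(x, t). \<phi> (f x * cis t)) \<in> borel_measurable (circle_borel \<Otimes>\<^sub>M borel)"
    using measurable_compose[OF noisy_image_measurable \<phi>] by (simp add: split_beta)
  then have "(\<lambda>(x, t). \<phi> (f x * cis t)) \<in> borel_measurable (circle_borel \<Otimes>\<^sub>M noise_law \<epsilon>)"
    by (subst measurable_cong_sets[OF sets_pair_measure_cong[OF refl sets_noise_law] refl])
  then have "(\<lambda>x. \<integral>t. \<phi> (f x * cis t) \<partial>noise_law \<epsilon>) \<in> borel_measurable circle_borel"
    by (rule borel_measurable_lebesgue_integral)
  then show ?thesis
    by (rule measurable_cong[THEN iffD1, rotated]) (simp add: transfer_op_circle[OF \<epsilon> \<phi>])
qed

text \<open>Applied with \<open>c = \<phi> (f x)\<close>, this bounds the error of replacing one noisy step by a noiseless one;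
  applied with \<open>c = 0\<close>, it bounds the transferred function itself.\<close>

lemma transfer_op_bound:
  fixes \<phi> :: "complex \<Rightarrow> complex"
  assumes \<epsilon>: "0 < \<epsilon>" "\<epsilon> \<le> 1" and \<phi>: "\<phi> \<in> borel_measurable circle_borel" and x: "x \<in> circle"
    and B: "\<And>t. \<bar>t\<bar> < \<epsilon> \<Longrightarrow> norm (\<phi> (f x * cis t) - c) \<le> B" and bd: "\<And>y. y \<in> circle \<Longrightarrow> norm (\<phi> y) \<le> B'"
  shows "norm (transfer_op f \<epsilon> \<phi> x - c) \<le> B"
proof -
  interpret prob_space "noise_law \<epsilon>" by (rule prob_space_noise_law[OF \<epsilon>(1)])
  have "(\<lambda>t. f x * cis t) \<in> noise_law \<epsilon> \<rightarrow>\<^sub>M circle_borel"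
    using rotate_measurable1[OF f_in_circle[OF x]] unfolding measurable_cong_sets[OF sets_noise_law refl] .
  from measurable_compose[OF this \<phi>]
  have int: "integrable (noise_law \<epsilon>) (\<lambda>t. \<phi> (f x * cis t))"
    using f_in_circle[OF x] by (intro integrable_const_bound[of _ B'] AE_I2 bd) (auto simp: norm_mult)
  have "transfer_op f \<epsilon> \<phi> x - c = (\<integral>t. \<phi> (f x * cis t) - c \<partial>noise_law \<epsilon>)"
    using int by (simp add: transfer_op_circle[OF \<epsilon> \<phi> x] prob_space[simplified])
  also have "norm \<dots> \<le> (\<integral>t. norm (\<phi> (f x * cis t) - c) \<partial>noise_law \<epsilon>)"
    by (rule integral_norm_bound)
  also have "\<dots> \<le> (\<integral>t. B \<partial>noise_law \<epsilon>)"
  proof (rule integral_mono_AE)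
    show "AE t in noise_law \<epsilon>. norm (\<phi> (f x * cis t) - c) \<le> B"
      unfolding noise_law_def using \<epsilon>(1) by (subst AE_uniform_measure) (auto intro!: B)
  qed (use int in auto)
  finally show ?thesis by (simp add: prob_space[simplified])
qed

text \<open>The dual operator is the law of a noisy image of a random point: draw \<open>x\<close> from \<open>\<mu>\<close>, an independent
  angle from the noise, and rotate \<open>f x\<close> by it.\<close>

lemma dual_transfer_op_exists:
  assumes \<epsilon>: "0 < \<epsilon>" "\<epsilon> \<le> 1" and \<mu>: "\<mu> \<in> circle_probs"
  shows "\<exists>\<nu>\<in>circle_probs. \<forall>\<phi> :: complex \<Rightarrow> complex. continuous_on circle \<phi> \<longrightarrow>
      (\<integral>x. \<phi> x \<partial>\<nu>) = (\<integral>x. transfer_op f \<epsilon> \<phi> x \<partial>\<mu>)"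
proof -
  note m = circle_probsD[OF \<mu>]
  interpret \<mu>: prob_space \<mu> by (rule m)
  interpret N: prob_space "noise_law \<epsilon>" by (rule prob_space_noise_law[OF \<epsilon>(1)])
  interpret pair_prob_space \<mu> "noise_law \<epsilon>" ..
  define \<nu> where "\<nu> = distr (\<mu> \<Otimes>\<^sub>M noise_law \<epsilon>) circle_borel (\<lambda>(x, t). f x * cis t)"
  have G: "(\<lambda>(x, t). f x * cis t) \<in> \<mu> \<Otimes>\<^sub>M noise_law \<epsilon> \<rightarrow>\<^sub>M circle_borel"
    unfolding measurable_cong_sets[OF sets_pair_measure_cong[OF m(2) sets_noise_law] refl]
    by (rule noisy_image_measurable)
  have "prob_space \<nu>" unfolding \<nu>_def by (rule prob_space_distr[OF G])
  then have "\<nu> \<in> circle_probs" by (simp add: circle_probs_def \<nu>_def)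
  moreover have "(\<integral>x. \<phi> x \<partial>\<nu>) = (\<integral>x. transfer_op f \<epsilon> \<phi> x \<partial>\<mu>)" if \<phi>c: "continuous_on circle \<phi>"
    for \<phi> :: "complex \<Rightarrow> complex"
  proof -
    have \<phi>: "\<phi> \<in> borel_measurable circle_borel" by (rule borel_measurable_continuous_on_restrict[OF \<phi>c])
    obtain B where B: "\<forall>x\<in>circle. norm (\<phi> x) \<le> B" using norm_bounded_on_circle[OF \<phi>c] by blast
    have meas: "(\<lambda>(x, t). \<phi> (f x * cis t)) \<in> borel_measurable (\<mu> \<Otimes>\<^sub>M noise_law \<epsilon>)"
      using measurable_compose[OF G \<phi>] by (simp add: split_beta)
    have int: "integrable (\<mu> \<Otimes>\<^sub>M noise_law \<epsilon>) (\<lambda>(x, t). \<phi> (f x * cis t))"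
    proof (rule P.integrable_const_bound[of _ B])
      show "AE z in \<mu> \<Otimes>\<^sub>M noise_law \<epsilon>. norm (case z of (x, t) \<Rightarrow> \<phi> (f x * cis t)) \<le> B"
      proof (rule AE_I2)
        fix z assume "z \<in> space (\<mu> \<Otimes>\<^sub>M noise_law \<epsilon>)"
        then have "fst z \<in> circle" by (auto simp: space_pair_measure m)
        then have "f (fst z) * cis (snd z) \<in> circle" using f_in_circle[of "fst z"] by (simp add: norm_mult)
        then show "norm (case z of (x, t) \<Rightarrow> \<phi> (f x * cis t)) \<le> B" using B by (simp add: split_beta)
      qed
    qed (rule meas)
    have "(\<integral>x. \<phi> x \<partial>\<nu>) = (\<integral>z. \<phi> ((\<lambda>(x, t). f x * cis t) z) \<partial>(\<mu> \<Otimes>\<^sub>M noise_law \<epsilon>))"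
      unfolding \<nu>_def by (rule integral_distr[OF G \<phi>])
    also have "\<dots> = (\<integral>z. (\<lambda>(x, t). \<phi> (f x * cis t)) z \<partial>(\<mu> \<Otimes>\<^sub>M noise_law \<epsilon>))"
      by (simp add: split_beta)
    also have "\<dots> = (\<integral>x. \<integral>t. \<phi> (f x * cis t) \<partial>noise_law \<epsilon> \<partial>\<mu>)"
      using integral_fst'[OF int] by simp
    also have "\<dots> = (\<integral>x. transfer_op f \<epsilon> \<phi> x \<partial>\<mu>)"
      by (intro Bochner_Integration.integral_cong refl) (simp add: m transfer_op_circle[OF \<epsilon> \<phi>])
    finally show ?thesis .
  qed
  ultimately show ?thesis by blast
qed

lemma
  assumes \<epsilon>: "0 < \<epsilon>" "\<epsilon> \<le> 1" and \<mu>: "\<mu> \<in> circle_probs"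
  shows dual_transfer_op_in_circle_probs: "dual_transfer_op f \<epsilon> \<mu> \<in> circle_probs"
    and integral_dual_transfer_op: "continuous_on circle \<phi> \<Longrightarrow>
      (\<integral>x. \<phi> x \<partial>dual_transfer_op f \<epsilon> \<mu>) = (\<integral>x. transfer_op f \<epsilon> \<phi> x \<partial>\<mu>)"
proof -
  let ?Q = "\<lambda>\<nu>. \<nu> \<in> circle_probs \<and> (\<forall>\<phi> :: complex \<Rightarrow> complex. continuous_on circle \<phi> \<longrightarrow>
        (\<integral>x. \<phi> x \<partial>\<nu>) = (\<integral>x. transfer_op f \<epsilon> \<phi> x \<partial>\<mu>))"
  obtain \<nu> where \<nu>: "?Q \<nu>" using dual_transfer_op_exists[OF assms] by blast
  have "\<nu>' = \<nu>" if "?Q \<nu>'" for \<nu>' using that \<nu> by (intro circle_probs_eqI) auto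
  with \<nu> have "?Q (dual_transfer_op f \<epsilon> \<mu>)" unfolding dual_transfer_op_def by (rule theI)
  then show "dual_transfer_op f \<epsilon> \<mu> \<in> circle_probs" "continuous_on circle \<phi> \<Longrightarrow>
      (\<integral>x. \<phi> x \<partial>dual_transfer_op f \<epsilon> \<mu>) = (\<integral>x. transfer_op f \<epsilon> \<phi> x \<partial>\<mu>)" by blast+
qed

abbreviation noisy_orbit_law :: "real \<Rightarrow> nat \<Rightarrow> complex \<Rightarrow> complex measure" where
  "noisy_orbit_law \<epsilon> j x \<equiv> (dual_transfer_op f \<epsilon> ^^ j) (return circle_borel x)"

lemma noisy_orbit_law_in_circle_probs:
  assumes \<epsilon>: "0 < \<epsilon>" "\<epsilon> \<le> 1" and x: "x \<in> circle"
  shows "noisy_orbit_law \<epsilon> j x \<in> circle_probs"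
proof (induction j)
  case 0
  then show ?case using x by (simp add: circle_probs_def prob_space_return)
next
  case (Suc j)
  then show ?case using dual_transfer_op_in_circle_probs[OF \<epsilon>] by simp
qed

lemma eventually_noise: "eventually (\<lambda>\<epsilon>::real. 0 < \<epsilon> \<and> \<epsilon> \<le> 1) (at_right 0)"
  unfolding eventually_at_right_field by (intro exI[of _ 1]) auto

text \<open>By induction on the time. The last step of the noisy orbit is removed at a cost that is uniform in the
  position, by uniform continuity of \<open>\<phi>\<close>; what remains is the claim for \<open>\<phi> \<circ> f\<close> one step earlier.\<close>

lemma noisy_orbit_law_tendsto:
  fixes \<phi> :: "complex \<Rightarrow> complex"
  assumes x: "x \<in> circle" and "continuous_on circle \<phi>"
  shows "((\<lambda>\<epsilon>. \<integral>y. \<phi> y \<partial>noisy_orbit_law \<epsilon> j x) \<longlongrightarrow> \<phi> ((f ^^ j) x)) (at_right 0)"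
  using assms(2)
proof (induction j arbitrary: \<phi>)
  case 0
  have "(\<integral>y. \<phi> y \<partial>return circle_borel x) = \<phi> x"
    using x by (intro integral_return borel_measurable_continuous_on_restrict 0) auto
  then show ?case by simp
next
  case (Suc j)
  note \<phi>c = Suc.prems
  have \<phi>: "\<phi> \<in> borel_measurable circle_borel" by (rule borel_measurable_continuous_on_restrict[OF \<phi>c])
  obtain B where B: "\<forall>x\<in>circle. norm (\<phi> x) \<le> B" using norm_bounded_on_circle[OF \<phi>c] by blast
  have fc: "continuous_on circle (\<lambda>y. \<phi> (f y))"
    by (rule continuous_on_compose2[OF \<phi>c f_continuous]) (use f_in_circle in blast)
  have IH: "((\<lambda>\<epsilon>. \<integral>y. \<phi> (f y) \<partial>noisy_orbit_law \<epsilon> j x) \<longlongrightarrow> \<phi> (f ((f ^^ j) x))) (at_right 0)"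
    by (rule Suc.IH[OF fc])
  have "((\<lambda>\<epsilon>. (\<integral>y. \<phi> y \<partial>noisy_orbit_law \<epsilon> (Suc j) x) - (\<integral>y. \<phi> (f y) \<partial>noisy_orbit_law \<epsilon> j x)) \<longlongrightarrow> 0) (at_right 0)"
  proof (rule tendstoI)
    fix e :: real assume e: "e > 0"
    have "uniformly_continuous_on circle \<phi>" by (intro compact_uniformly_continuous \<phi>c compact_sphere)
    then obtain d where d: "d > 0"
      "\<And>y z. y \<in> circle \<Longrightarrow> z \<in> circle \<Longrightarrow> dist y z < d \<Longrightarrow> dist (\<phi> y) (\<phi> z) < e / 2"
      unfolding uniformly_continuous_on_def using e by (metis half_gt_zero)
    have "continuous_on UNIV cis" by (intro continuous_intros)
    then have "isCont cis 0" by (simp add: continuous_on_eq_continuous_at)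
    then obtain r where r: "r > 0" "\<And>t. \<bar>t\<bar> < r \<Longrightarrow> norm (cis t - 1) < d"
      using d(1) unfolding continuous_at_eps_delta dist_norm by (metis cis_zero diff_zero real_norm_def)
    have near: "norm (\<phi> (f y * cis t) - \<phi> (f y)) \<le> e / 2" if y: "y \<in> circle" and t: "\<bar>t\<bar> < r" for y t
    proof -
      have n1: "norm (f y) = 1" using f_in_circle[OF y] by simp
      have "f y * cis t - f y = f y * (cis t - 1)" by (simp add: algebra_simps)
      then have "dist (f y * cis t) (f y) < d" using r(2)[OF t] n1 by (simp add: dist_norm norm_mult)
      then have "dist (\<phi> (f y * cis t)) (\<phi> (f y)) < e / 2"
        using n1 by (intro d(2)) (auto simp: norm_mult)
      then show ?thesis by (simp add: dist_norm)
    qed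
    have "eventually (\<lambda>\<epsilon>. \<epsilon> < r) (at_right 0)"
      using r(1) unfolding eventually_at_right_field by (intro exI[of _ r]) auto
    then show "eventually (\<lambda>\<epsilon>. dist ((\<integral>y. \<phi> y \<partial>noisy_orbit_law \<epsilon> (Suc j) x) - (\<integral>y. \<phi> (f y) \<partial>noisy_orbit_law \<epsilon> j x)) 0 < e) (at_right 0)"
      using eventually_noise
    proof eventually_elim
      fix \<epsilon> assume er: "\<epsilon> < r" and \<epsilon>': "0 < \<epsilon> \<and> \<epsilon> \<le> 1"
      then have \<epsilon>: "0 < \<epsilon>" "\<epsilon> \<le> 1" by auto
      let ?\<nu> = "noisy_orbit_law \<epsilon> j x"
      have \<nu>: "?\<nu> \<in> circle_probs" by (rule noisy_orbit_law_in_circle_probs[OF \<epsilon> x])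
      note n = circle_probsD[OF \<nu>]
      interpret prob_space ?\<nu> by (rule n)
      have close: "norm (transfer_op f \<epsilon> \<phi> y - \<phi> (f y)) \<le> e / 2" if y: "y \<in> circle" for y
        using B er by (intro transfer_op_bound[OF \<epsilon> \<phi> y, of _ _ B] near y) auto
      have int_T: "integrable ?\<nu> (transfer_op f \<epsilon> \<phi>)"
      proof (rule circle_probs_integrable[OF \<nu> transfer_op_measurable[OF \<epsilon> \<phi>], of B])
        fix y assume y: "y \<in> circle"
        show "norm (transfer_op f \<epsilon> \<phi> y) \<le> B"
          using transfer_op_bound[OF \<epsilon> \<phi> y, of 0 B B] B f_in_circle[OF y] by (simp add: norm_mult)
      qed
      have int_f: "integrable ?\<nu> (\<lambda>y. \<phi> (f y))" by (rule circle_probs_integrable_continuous[OF \<nu> fc])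
      have "(\<integral>y. \<phi> y \<partial>noisy_orbit_law \<epsilon> (Suc j) x) = (\<integral>y. transfer_op f \<epsilon> \<phi> y \<partial>?\<nu>)"
        using integral_dual_transfer_op[OF \<epsilon> \<nu> \<phi>c] by simp
      then have "(\<integral>y. \<phi> y \<partial>noisy_orbit_law \<epsilon> (Suc j) x) - (\<integral>y. \<phi> (f y) \<partial>?\<nu>)
          = (\<integral>y. transfer_op f \<epsilon> \<phi> y - \<phi> (f y) \<partial>?\<nu>)"
        using int_T int_f by simp
      also have "norm \<dots> \<le> (\<integral>y. norm (transfer_op f \<epsilon> \<phi> y - \<phi> (f y)) \<partial>?\<nu>)"
        by (rule integral_norm_bound)
      also have "\<dots> \<le> (\<integral>y. e / 2 \<partial>?\<nu>)"
        using int_T int_f close by (intro integral_mono) (auto simp: n)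
      also have "\<dots> < e" using e by (simp add: prob_space)
      finally show "dist ((\<integral>y. \<phi> y \<partial>noisy_orbit_law \<epsilon> (Suc j) x) - (\<integral>y. \<phi> (f y) \<partial>?\<nu>)) 0 < e"
        by (simp add: dist_norm)
    qed
  qed
  from tendsto_add[OF this IH] show ?case by simp
qed

text \<open>The empiric probability is the law of the noisy orbit at a uniformly random time, which identifies
  the set function that defines it with a measure.\<close>

lemma
  fixes g :: "complex \<Rightarrow> real"
  assumes \<epsilon>: "0 < \<epsilon>" "\<epsilon> \<le> 1" and x: "x \<in> circle" and n: "n \<ge> 1"
  shows empiric_prob_in_circle_probs: "empiric_prob f \<epsilon> n x \<in> circle_probs"
    and integral_empiric_prob: "continuous_on circle g \<Longrightarrow>
      (\<integral>y. g y \<partial>empiric_prob f \<epsilon> n x) = (\<Sum>j=1..n. \<integral>y. g y \<partial>noisy_orbit_law \<epsilon> j x) / real n"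
proof -
  let ?\<nu> = "\<lambda>j. noisy_orbit_law \<epsilon> j x"
  let ?p = "measure_pmf (pmf_of_set {1..n})"
  note \<nu> = noisy_orbit_law_in_circle_probs[OF \<epsilon> x]
  have sub: "?\<nu> \<in> ?p \<rightarrow>\<^sub>M subprob_algebra circle_borel"
    using circle_probsD(1,2)[OF \<nu>] by (auto simp: space_subprob_algebra prob_space_imp_subprob_space)
  define M where "M = ?p \<bind> ?\<nu>"
  have nn: "nn_integral ?p h = (\<Sum>j=1..n. h j) / ennreal (real n)" for h :: "nat \<Rightarrow> ennreal"
    using n by (simp add: nn_integral_pmf_of_set ennreal_of_nat_eq_real_of_nat)
  have sets_M: "sets M = sets circle_borel"
    unfolding M_def using sub by (subst sets_bind[where N = circle_borel]) (auto simp: circle_probsD(2)[OF \<nu>])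
  have space_M: "space M = circle" using sets_eq_imp_space_eq[OF sets_M] by simp
  have em: "emeasure M A = ennreal (1 / real n) * (\<Sum>j=1..n. emeasure (?\<nu> j) A)" if "A \<in> sets circle_borel" for A
  proof -
    have "emeasure M A = (\<integral>\<^sup>+j. emeasure (?\<nu> j) A \<partial>?p)"
      unfolding M_def by (rule emeasure_bind[OF _ sub that]) simp
    also have "\<dots> = (\<Sum>j=1..n. emeasure (?\<nu> j) A) / ennreal (real n)" by (rule nn)
    also have "\<dots> = ennreal (1 / real n) * (\<Sum>j=1..n. emeasure (?\<nu> j) A)"
      using n by (simp add: divide_ennreal_def inverse_ennreal mult.commute inverse_eq_divide)
    finally show ?thesis .
  qed
  have "empiric_prob f \<epsilon> n x = measure_of circle (sets circle_borel) (emeasure M)"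
    unfolding empiric_prob_def
  proof (rule measure_of_eq)
    show "sets circle_borel \<subseteq> Pow circle" using sets.sets_into_space[of _ circle_borel] by auto
    fix A assume "A \<in> sigma_sets circle (sets circle_borel)"
    then have "A \<in> sets circle_borel" using sets.sigma_sets_eq[of circle_borel] by simp
    then show "ennreal (1 / real n) * (\<Sum>j=1..n. emeasure (?\<nu> j) A) = emeasure M A" by (simp add: em)
  qed
  also have "\<dots> = M"
    using measure_of_of_measure[of M] by (simp only: sets_M space_M)
  finally have eq: "empiric_prob f \<epsilon> n x = M" .
  have "prob_space M" unfolding M_def
    by (rule measure_pmf.prob_space_bind[OF _ sub]) (simp add: circle_probsD(1)[OF \<nu>])
  then have M: "M \<in> circle_probs" by (simp add: circle_probs_def sets_M)
  then show "empiric_prob f \<epsilon> n x \<in> circle_probs" by (simp add: eq)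
  assume g: "continuous_on circle g"
  obtain B where B: "\<forall>y\<in>circle. \<bar>g y\<bar> \<le> B" using bounded_on_circle[OF g] by blast
  \<comment> \<open>The formula for mixtures holds for nonnegative integrands, so \<open>g\<close> is shifted by a bound.
  The maximum changes nothing on the circle and gives nonnegativity off it.\<close>
  define h where "h y = max 0 (g y + B)" for y
  have hc: "continuous_on circle h" unfolding h_def by (intro continuous_intros g)
  have h0: "0 \<le> h y" for y by (simp add: h_def)
  have hm: "(\<lambda>y. ennreal (h y)) \<in> borel_measurable circle_borel"
    by (intro measurable_compose[OF _ measurable_ennreal] borel_measurable_continuous_on_restrict hc)
  have int_h: "(\<integral>y. h y \<partial>\<eta>) = (\<integral>y. g y \<partial>\<eta>) + B" if \<eta>: "\<eta> \<in> circle_probs" for \<eta>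
  proof -
    interpret prob_space \<eta> by (rule circle_probsD[OF \<eta>])
    have "(\<integral>y. h y \<partial>\<eta>) = (\<integral>y. g y + B \<partial>\<eta>)"
    proof (intro Bochner_Integration.integral_cong refl)
      fix y assume "y \<in> space \<eta>"
      then have "\<bar>g y\<bar> \<le> B" using B circle_probsD(3)[OF \<eta>] by blast
      then show "h y = g y + B" by (simp add: h_def)
    qed
    then show ?thesis using circle_probs_integrable_continuous[OF \<eta> g] by (simp add: prob_space)
  qed
  have nn_h: "(\<integral>\<^sup>+y. ennreal (h y) \<partial>\<eta>) = ennreal (\<integral>y. h y \<partial>\<eta>)" if "\<eta> \<in> circle_probs" for \<eta>
    using circle_probs_integrable_continuous[OF that hc] h0 by (intro nn_integral_eq_integral) auto
  have Ih0: "0 \<le> (\<integral>y. h y \<partial>\<eta>)" for \<eta> :: "complex measure" using h0 by (simp add: integral_nonneg_AE)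
  have "ennreal (\<integral>y. h y \<partial>M) = (\<Sum>j=1..n. ennreal (\<integral>y. h y \<partial>?\<nu> j)) / ennreal (real n)"
  proof -
    have "(\<integral>\<^sup>+y. ennreal (h y) \<partial>M) = (\<integral>\<^sup>+j. (\<integral>\<^sup>+y. ennreal (h y) \<partial>?\<nu> j) \<partial>?p)"
      unfolding M_def by (rule nn_integral_bind[OF hm sub])
    also have "\<dots> = (\<Sum>j=1..n. \<integral>\<^sup>+y. ennreal (h y) \<partial>?\<nu> j) / ennreal (real n)" by (rule nn)
    finally show ?thesis by (simp only: nn_h[OF M] nn_h[OF \<nu>])
  qed
  also have "\<dots> = ennreal ((\<Sum>j=1..n. \<integral>y. h y \<partial>?\<nu> j) / real n)"
    using n Ih0 by (simp add: sum_ennreal divide_ennreal sum_nonneg)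
  finally have "(\<integral>y. h y \<partial>M) = (\<Sum>j=1..n. \<integral>y. h y \<partial>?\<nu> j) / real n"
    using Ih0 n by (subst (asm) ennreal_inj) (auto intro!: divide_nonneg_nonneg sum_nonneg)
  then have "(\<integral>y. g y \<partial>M) + B = ((\<Sum>j=1..n. \<integral>y. g y \<partial>?\<nu> j) + real n * B) / real n"
    by (simp add: int_h[OF M] int_h[OF \<nu>] sum.distrib)
  then show "(\<integral>y. g y \<partial>empiric_prob f \<epsilon> n x) = (\<Sum>j=1..n. \<integral>y. g y \<partial>?\<nu> j) / real n"
    using n by (simp add: eq add_divide_distrib)
qed

lemma empiric_prob_tendsto:
  fixes g :: "complex \<Rightarrow> real"
  assumes x: "x \<in> circle" and n: "n \<ge> 1" and g: "continuous_on circle g"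
  shows "((\<lambda>\<epsilon>. \<integral>y. g y \<partial>empiric_prob f \<epsilon> n x) \<longlongrightarrow> (\<Sum>j=1..n. g ((f ^^ j) x)) / real n) (at_right 0)"
proof -
  have gc: "continuous_on circle (\<lambda>y. complex_of_real (g y))" by (intro continuous_intros g)
  have "((\<lambda>\<epsilon>. \<integral>y. g y \<partial>noisy_orbit_law \<epsilon> j x) \<longlongrightarrow> g ((f ^^ j) x)) (at_right 0)" for j
    using tendsto_Re[OF noisy_orbit_law_tendsto[OF x gc, of j]] by simp
  then have "((\<lambda>\<epsilon>. (\<Sum>j=1..n. \<integral>y. g y \<partial>noisy_orbit_law \<epsilon> j x) / real n) \<longlongrightarrow> (\<Sum>j=1..n. g ((f ^^ j) x)) / real n) (at_right 0)"
    using n by (intro tendsto_intros) auto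
  moreover have "eventually (\<lambda>\<epsilon>. (\<Sum>j=1..n. \<integral>y. g y \<partial>noisy_orbit_law \<epsilon> j x) / real n = (\<integral>y. g y \<partial>empiric_prob f \<epsilon> n x)) (at_right 0)"
    using eventually_noise by eventually_elim (simp add: integral_empiric_prob[OF _ _ x n g])
  ultimately show ?thesis by (rule Lim_transform_eventually)
qed

end

section \<open>Expanding maps and their transfer operator\<close>

text \<open>An expanding map together with a lift of it to the line; the derivative of the lift measures the
  expansion up to a sign that depends only on the orientation.\<close>

locale expanding_lift =
  fixes f :: "complex \<Rightarrow> complex" and F F' :: "real \<Rightarrow> real"
  assumes F_deriv: "\<And>t. (F has_real_derivative F' t) (at t)"
    and F'_cont: "continuous_on UNIV F'"
    and lift: "\<And>t. f (cis t) = cis (F t)"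
    and deriv_norm: "\<And>t. circle_deriv_norm f (cis t) = \<bar>F' t\<bar>"
    and expanding: "\<And>x. x \<in> circle \<Longrightarrow> circle_deriv_norm f x > 1"
begin

lemma F'_gt_1: "\<bar>F' t\<bar> > 1"
  using expanding[of "cis t"] by (simp add: deriv_norm)

lemma F_cont: "continuous_on UNIV F"
  using F_deriv by (auto simp: continuous_on_eq_continuous_at intro: DERIV_isCont)

lemma f_cont: "continuous_on circle f"
  by (rule continuous_on_circleI) (auto simp: lift intro!: continuous_intros F_cont)

lemma f_circle: "x \<in> circle \<Longrightarrow> f x \<in> circle"
  using lift[of "Arg2pi x"] by (simp add: cis_Arg2pi_circle)

sublocale circle_dynamics f
  by standard (rule f_cont, rule f_circle)

lemma fn_lift: "(f ^^ n) (cis t) = cis ((F ^^ n) t)"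
  by (induction n) (auto simp: lift)

lemma fn_circle: "x \<in> circle \<Longrightarrow> (f ^^ n) x \<in> circle"
  by (induction n) (simp_all add: f_circle[simplified])

lemma Fn_cont: "continuous_on UNIV (F ^^ n)"
proof (induction n)
  case (Suc n)
  then show ?case
    using continuous_on_compose2[OF F_cont Suc] by (simp add: comp_def)
qed (simp add: id_def)

lemma fn_cont: "continuous_on circle (f ^^ n)"
  by (rule continuous_on_circleI) (auto simp: fn_lift intro!: continuous_intros Fn_cont)

lemma fn_measurable: "f ^^ n \<in> circle_borel \<rightarrow>\<^sub>M circle_borel"
  by (intro measurable_restrict_space2 borel_measurable_continuous_on_restrict fn_cont) (auto dest: fn_circle)

lemma deriv_norm_cont: "continuous_on circle (circle_deriv_norm f)"
  by (rule continuous_on_circleI) (auto simp: deriv_norm intro!: continuous_intros F'_cont)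

definition log_deriv :: "complex \<Rightarrow> real" where
  "log_deriv x = ln (circle_deriv_norm f x)"

lemma log_deriv_cont: "continuous_on circle log_deriv"
  unfolding log_deriv_def using expanding by (intro continuous_intros deriv_norm_cont) force

lemma log_deriv_pos: "x \<in> circle \<Longrightarrow> log_deriv x > 0"
  unfolding log_deriv_def by (intro ln_gt_zero expanding)

lemma exp_log_deriv: "x \<in> circle \<Longrightarrow> exp (log_deriv x) = circle_deriv_norm f x"
  using expanding[of x] by (simp add: log_deriv_def)

lemma log_deriv_integrable:
  assumes "\<mu> \<in> invariant_probs f"
  shows "integrable \<mu> log_deriv"
proof -
  note m = invariant_probsD[OF assms]
  interpret prob_space \<mu> by (rule m)
  have "borel_measurable \<mu> = borel_measurable circle_borel"
    by (rule measurable_cong_sets) (simp_all add: m(2))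
  moreover obtain B where "\<forall>x\<in>circle. \<bar>log_deriv x\<bar> \<le> B"
    using bounded_on_circle[OF log_deriv_cont] by blast
  ultimately show ?thesis
    using borel_measurable_continuous_on_restrict[OF log_deriv_cont]
    by (intro integrable_const_bound[of _ B] AE_I2) (auto simp: m)
qed

lemma F'_constant_sign: "(\<forall>t. F' t > 0) \<or> (\<forall>t. F' t < 0)"
proof (rule ccontr)
  assume "\<not> ?thesis"
  then obtain a b where "F' a \<le> 0" "0 \<le> F' b" by (auto simp: not_less)
  moreover have "is_interval (range F')"
    using connected_continuous_image[OF F'_cont] by (simp add: is_interval_connected_1)
  ultimately have "0 \<in> range F'"
    using mem_is_interval_1_I[of "range F'" "F' a" "F' b" 0] by auto
  then show False using F'_gt_1 by (metis abs_zero imageE not_one_less_zero)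
qed

text \<open>If the lift moves the arc over at most one full turn, then \<open>f\<close> is injective on the arc up to its end
  points, and the change of variables \<open>y = f x\<close> reaches every point of the circle at most once.\<close>

lemma nn_integral_arc_le:
  assumes u: "u \<in> borel_measurable circle_borel" and ab: "a < b"
    and len: "\<And>t. \<bar>F' t\<bar> * (b - a) \<le> 2 * pi"
  shows "(\<integral>\<^sup>+t\<in>{a..b}. u (f (cis t)) * ennreal (circle_deriv_norm f (cis t)) \<partial>lborel)
    \<le> (\<integral>\<^sup>+x. u x \<partial>circle_lebesgue)"
proof -
  have v[measurable]: "(\<lambda>t. u (cis t)) \<in> borel_measurable borel"
    by (rule measurable_compose[OF cis_measurable_circle u])
  obtain z where z: "F b - F a = (b - a) * F' z"
    using MVT2[OF ab F_deriv] by blast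
  have F'ab: "continuous_on {a..b} F'" by (rule continuous_on_subset[OF F'_cont]) simp
  consider "\<forall>t. F' t > 0" | "\<forall>t. F' t < 0" using F'_constant_sign by blast
  then show ?thesis
  proof cases
    case 1
    then have abs: "\<bar>F' t\<bar> = F' t" for t by (simp add: less_imp_le)
    have "(\<integral>\<^sup>+t\<in>{a..b}. u (f (cis t)) * ennreal (circle_deriv_norm f (cis t)) \<partial>lborel)
       = (\<integral>\<^sup>+t\<in>{a..b}. u (cis (F t)) * ennreal (F' t) \<partial>lborel)"
      by (intro nn_integral_cong) (simp add: lift deriv_norm abs)
    also have "\<dots> = (\<integral>\<^sup>+t\<in>{F a..F b}. u (cis t) \<partial>lborel)"
      using 1 by (intro nn_integral_substitution_aux[symmetric] F_deriv F'ab ab v) (auto simp: less_imp_le)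
    also have "\<dots> \<le> (\<integral>\<^sup>+x. u x \<partial>circle_lebesgue)"
      using z len[of z] abs[of z] by (intro nn_integral_subwindow_le u) (simp add: mult.commute)
    finally show ?thesis .
  next
    case 2
    then have abs: "\<bar>F' t\<bar> = - F' t" for t by (simp add: less_imp_le)
    have "(\<integral>\<^sup>+t\<in>{a..b}. u (f (cis t)) * ennreal (circle_deriv_norm f (cis t)) \<partial>lborel)
       = (\<integral>\<^sup>+t\<in>{a..b}. u (cis (- (- F t))) * ennreal (- F' t) \<partial>lborel)"
      by (intro nn_integral_cong) (simp add: lift deriv_norm abs)
    also have "\<dots> = (\<integral>\<^sup>+t\<in>{- F a..- F b}. u (cis (- t)) \<partial>lborel)"
      using 2 by (intro nn_integral_substitution_aux[symmetric, where f = "\<lambda>t. u (cis (- t))"] ab)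
        (auto simp: less_imp_le intro!: derivative_intros F_deriv continuous_intros F'ab)
    also have "\<dots> = (\<integral>\<^sup>+t\<in>{F b..F a}. u (cis t) \<partial>lborel)"
      by (subst nn_integral_real_affine[where c = "-1" and t = 0])
        (auto intro!: nn_integral_cong simp: indicator_def)
    also have "\<dots> \<le> (\<integral>\<^sup>+x. u x \<partial>circle_lebesgue)"
    proof (intro nn_integral_subwindow_le u)
      have "F a - F b = \<bar>F' z\<bar> * (b - a)" using z unfolding abs[of z] by (simp add: algebra_simps)
      then show "F a \<le> F b + 2 * pi" using len[of z] by simp
    qed
    finally show ?thesis .
  qed
qed

lemma nn_integral_arc_index_le:
  assumes u: "u \<in> borel_measurable circle_borel" and N: "N > 0" "\<And>t. \<bar>F' t\<bar> \<le> real N"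
  shows "(\<integral>\<^sup>+x. u (f x) * ennreal (circle_deriv_norm f x) * indicator {x. arc_index N \<beta> x = i} x \<partial>circle_lebesgue)
    \<le> (\<integral>\<^sup>+x. u x \<partial>circle_lebesgue)"
proof -
  let ?a = "\<beta> + 2 * pi * of_int i / real N" and ?b = "\<beta> + 2 * pi * of_int (i + 1) / real N"
  have [measurable]: "(\<lambda>x. u (f x)) \<in> borel_measurable circle_borel"
      "circle_deriv_norm f \<in> borel_measurable circle_borel"
    by (rule measurable_compose[OF f_borel u])
       (rule borel_measurable_continuous_on_restrict[OF deriv_norm_cont])
  have [measurable]: "arc_index N \<beta> \<in> circle_borel \<rightarrow>\<^sub>M count_space UNIV" by (rule arc_index_measurable)
  have "(\<lambda>x. u (f x) * ennreal (circle_deriv_norm f x) * indicator {x. arc_index N \<beta> x = i} x) \<in> borel_measurable circle_borel"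
    by measurable
  then have "(\<integral>\<^sup>+x. u (f x) * ennreal (circle_deriv_norm f x) * indicator {x. arc_index N \<beta> x = i} x \<partial>circle_lebesgue)
     = (\<integral>\<^sup>+t. u (f (cis t)) * ennreal (circle_deriv_norm f (cis t)) * indicator {x. arc_index N \<beta> x = i} (cis t) * indicator {\<beta>..<\<beta> + 2 * pi} t \<partial>lborel)"
    by (rule nn_integral_circle_window)
  also have "\<dots> \<le> (\<integral>\<^sup>+t\<in>{?a..?b}. u (f (cis t)) * ennreal (circle_deriv_norm f (cis t)) \<partial>lborel)"
    using arc_index_window[OF N(1), of _ \<beta> i] by (intro nn_integral_mono) (simp add: indicator_def)
  also have "\<dots> \<le> (\<integral>\<^sup>+x. u x \<partial>circle_lebesgue)"
  proof (rule nn_integral_arc_le[OF u])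
    show "?a < ?b" using N by (simp add: divide_simps)
    fix t
    have "?b - ?a = 2 * pi / real N" by (simp add: add_divide_distrib[symmetric] diff_divide_distrib[symmetric] algebra_simps)
    moreover have "\<bar>F' t\<bar> * (2 * pi / real N) \<le> real N * (2 * pi / real N)"
      using N by (intro mult_right_mono) auto
    ultimately show "\<bar>F' t\<bar> * (?b - ?a) \<le> 2 * pi" using N(1) by simp
  qed
  finally show ?thesis .
qed

text \<open>The inequality \<open>\<integral> e\<^sup>G (u \<circ> f) dm \<le> \<integral> u dm\<close> for \<open>e\<^sup>G = |f'| \<tau>\<close>: a point \<open>y\<close> has at most one
  preimage in each arc, and the weights \<open>\<tau> i y\<close> of these preimages add up to at most one.\<close>

lemma nn_integral_weighted_transfer_le:
  fixes \<tau> :: "int \<Rightarrow> complex \<Rightarrow> real"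
  assumes u: "u \<in> borel_measurable circle_borel" and N: "N > 0" "\<And>t. \<bar>F' t\<bar> \<le> real N"
    and \<tau>: "\<And>i. \<tau> i \<in> borel_measurable circle_borel" "\<And>i x. x \<in> circle \<Longrightarrow> 0 \<le> \<tau> i x"
      "\<And>x. x \<in> circle \<Longrightarrow> (\<Sum>i\<in>{0..<int N}. \<tau> i x) \<le> 1"
  shows "(\<integral>\<^sup>+x. u (f x) * ennreal (circle_deriv_norm f x * \<tau> (arc_index N \<beta> x) (f x)) \<partial>circle_lebesgue)
    \<le> (\<integral>\<^sup>+x. u x \<partial>circle_lebesgue)"
proof -
  let ?h = "\<lambda>i x. u (f x) * ennreal (\<tau> i (f x)) * ennreal (circle_deriv_norm f x) * indicator {x. arc_index N \<beta> x = i} x"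
  note [measurable] = \<tau>(1) u
  have [measurable]: "f \<in> circle_borel \<rightarrow>\<^sub>M circle_borel" by (rule f_borel)
  have [measurable]: "circle_deriv_norm f \<in> borel_measurable circle_borel"
    by (rule borel_measurable_continuous_on_restrict[OF deriv_norm_cont])
  have [measurable]: "arc_index N \<beta> \<in> circle_borel \<rightarrow>\<^sub>M count_space UNIV" by (rule arc_index_measurable)
  have hm: "?h i \<in> borel_measurable circle_lebesgue" for i
  proof -
    have "?h i \<in> borel_measurable circle_borel" by measurable
    then show ?thesis by (simp cong: measurable_cong_sets)
  qed
  have "(\<integral>\<^sup>+x. u (f x) * ennreal (circle_deriv_norm f x * \<tau> (arc_index N \<beta> x) (f x)) \<partial>circle_lebesgue)
     = (\<integral>\<^sup>+x. (\<Sum>i\<in>{0..<int N}. ?h i x) \<partial>circle_lebesgue)"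
  proof (rule nn_integral_cong)
    fix x assume x: "x \<in> space circle_lebesgue"
    let ?i = "arc_index N \<beta> x"
    have "(\<Sum>i\<in>{0..<int N}. ?h i x) = (\<Sum>i\<in>{0..<int N}. if i = ?i then ?h ?i x else 0)"
      by (intro sum.cong) auto
    also have "\<dots> = ?h ?i x" using arc_index_range[OF N(1), of \<beta> x] by simp
    also have "\<dots> = u (f x) * ennreal (circle_deriv_norm f x * \<tau> ?i (f x))"
      using x expanding[of x] \<tau>(2)[OF f_circle, of x] by (simp add: ennreal_mult mult_ac)
    finally show "u (f x) * ennreal (circle_deriv_norm f x * \<tau> ?i (f x)) = (\<Sum>i\<in>{0..<int N}. ?h i x)" by simp
  qed
  also have "\<dots> = (\<Sum>i\<in>{0..<int N}. \<integral>\<^sup>+x. ?h i x \<partial>circle_lebesgue)"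
    by (rule nn_integral_sum) (rule hm)
  also have "\<dots> \<le> (\<Sum>i\<in>{0..<int N}. \<integral>\<^sup>+x. u x * ennreal (\<tau> i x) \<partial>circle_lebesgue)"
    by (intro sum_mono nn_integral_arc_index_le[where u = "\<lambda>x. u x * ennreal (\<tau> _ x)"] N) measurable
  also have "\<dots> = (\<integral>\<^sup>+x. (\<Sum>i\<in>{0..<int N}. u x * ennreal (\<tau> i x)) \<partial>circle_lebesgue)"
    by (rule nn_integral_sum[symmetric]) (simp cong: measurable_cong_sets)
  also have "\<dots> \<le> (\<integral>\<^sup>+x. u x \<partial>circle_lebesgue)"
  proof (rule nn_integral_mono)
    fix x assume x: "x \<in> space circle_lebesgue"
    have "(\<Sum>i\<in>{0..<int N}. u x * ennreal (\<tau> i x)) = u x * ennreal (\<Sum>i\<in>{0..<int N}. \<tau> i x)"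
      using x \<tau>(2) by (simp add: sum_distrib_left[symmetric] sum_ennreal)
    also have "\<dots> \<le> u x * 1"
      using \<tau>(3)[of x] x by (intro mult_left_mono) auto
    finally show "(\<Sum>i\<in>{0..<int N}. u x * ennreal (\<tau> i x)) \<le> u x" by simp
  qed
  finally show ?thesis .
qed

lemma invariant_partitioned_system:
  assumes \<mu>: "\<mu> \<in> invariant_probs f" and P: "measurable_partition \<mu> P"
  shows "partitioned_system \<mu> f P"
proof -
  note m = invariant_probsD[OF \<mu>]
  interpret prob_space \<mu> by (rule m)
  show ?thesis
  proof
    show "f \<in> \<mu> \<rightarrow>\<^sub>M \<mu>" unfolding measurable_cong_sets[OF m(2) m(2)] by (rule f_borel)
    have "distr \<mu> \<mu> f = distr \<mu> circle_borel f" by (rule distr_cong) (simp_all add: m(2))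
    then show "distr \<mu> \<mu> f = \<mu>" by (simp add: m(4))
  qed fact
qed

lemma nn_integral_exp_sum_le:
  fixes g :: "complex \<Rightarrow> real"
  assumes g: "continuous_on circle g"
    and step: "\<And>u. u \<in> borel_measurable circle_borel \<Longrightarrow>
      (\<integral>\<^sup>+x. u (f x) * ennreal (exp (g x)) \<partial>circle_lebesgue) \<le> (\<integral>\<^sup>+x. u x \<partial>circle_lebesgue)"
  shows "(\<integral>\<^sup>+x. ennreal (exp (\<Sum>j<n. g ((f ^^ j) x))) \<partial>circle_lebesgue) \<le> ennreal (2 * pi)"
proof (induction n)
  case 0
  then show ?case by (simp add: emeasure_circle_lebesgue)
next
  case (Suc n)
  have gm: "g \<in> borel_measurable circle_borel" by (rule borel_measurable_continuous_on_restrict[OF g])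
  have "(\<integral>\<^sup>+x. ennreal (exp (\<Sum>j<Suc n. g ((f ^^ j) x))) \<partial>circle_lebesgue)
     = (\<integral>\<^sup>+x. ennreal (exp (\<Sum>j<n. g ((f ^^ j) (f x)))) * ennreal (exp (g x)) \<partial>circle_lebesgue)"
    by (intro nn_integral_cong)
       (simp del: sum.lessThan_Suc funpow.simps add: sum.lessThan_Suc_shift funpow_Suc_right exp_add ennreal_mult[symmetric] mult.commute)
  also have "\<dots> \<le> (\<integral>\<^sup>+x. ennreal (exp (\<Sum>j<n. g ((f ^^ j) x))) \<partial>circle_lebesgue)"
  proof (rule step)
    have [measurable]: "(\<lambda>x. g ((f ^^ j) x)) \<in> borel_measurable circle_borel" for j
      by (rule measurable_compose[OF fn_measurable gm])
    show "(\<lambda>x. ennreal (exp (\<Sum>j<n. g ((f ^^ j) x)))) \<in> borel_measurable circle_borel"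
      by measurable
  qed
  finally show ?case using Suc by (rule order_trans)
qed

text \<open>The exponentials of the Birkhoff sums of \<open>g\<close> have bounded Lebesgue integrals, so the set where the
  sum exceeds \<open>c n\<close> has measure \<open>O(e\<^sup>-\<^sup>c\<^sup>n)\<close>. Empiric averages start at time one; shifting the
  sum by one step costs at most twice a bound of \<open>g\<close>.\<close>

lemma AE_average_le:
  fixes g :: "complex \<Rightarrow> real"
  assumes g: "continuous_on circle g" and c: "c > 0"
    and step: "\<And>u. u \<in> borel_measurable circle_borel \<Longrightarrow>
      (\<integral>\<^sup>+x. u (f x) * ennreal (exp (g x)) \<partial>circle_lebesgue) \<le> (\<integral>\<^sup>+x. u x \<partial>circle_lebesgue)"
  shows "AE x in circle_lebesgue. eventually (\<lambda>n. (\<Sum>j=1..n. g ((f ^^ j) x)) \<le> c * real n) sequentially"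
proof -
  obtain B where B0: "\<forall>x\<in>circle. \<bar>g x\<bar> \<le> B"
    using bounded_on_circle[OF g] by blast
  note B = bspec[OF B0]
  have gm: "g \<in> borel_measurable circle_borel" by (rule borel_measurable_continuous_on_restrict[OF g])
  have gj: "(\<lambda>x. g ((f ^^ j) x)) \<in> borel_measurable circle_borel" for j
    by (rule measurable_compose[OF fn_measurable gm])
  have Lm: "borel_measurable circle_lebesgue = borel_measurable circle_borel"
    by (rule measurable_cong_sets) simp_all
  define E where "E n = {x \<in> space circle_lebesgue. c * real n < (\<Sum>j=1..n. g ((f ^^ j) x))}" for n
  have E: "E n \<in> sets circle_lebesgue" for n
  proof -
    have [measurable]: "(\<lambda>x. \<Sum>j=1..n. g ((f ^^ j) x)) \<in> borel_measurable circle_lebesgue"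
      unfolding Lm by (rule borel_measurable_sum) (rule gj)
    show ?thesis unfolding E_def by measurable
  qed
  define K where "K = 2 * pi * exp (2 * B)"
  have bound: "emeasure circle_lebesgue (E n) \<le> ennreal (K * exp (- c) ^ n)" for n
  proof -
    let ?v = "\<lambda>x. ennreal (exp (\<Sum>j<n. g ((f ^^ j) x)))"
    have vm: "?v \<in> borel_measurable circle_lebesgue"
      unfolding Lm by (intro measurable_compose[OF _ measurable_ennreal] measurable_compose[OF borel_measurable_sum borel_measurable_exp] gj measurable_ident)
    have "E n \<subseteq> {x \<in> space circle_lebesgue. 1 \<le> ennreal (exp (2 * B - c * real n)) * ?v x}"
    proof
      fix x assume x: "x \<in> E n"
      then have xc: "x \<in> circle" by (simp add: E_def)
      have "(\<Sum>j=1..n. g ((f ^^ j) x)) = (\<Sum>j<n. g ((f ^^ Suc j) x))"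
        by (rule sum.reindex_bij_witness[where i = Suc and j = "\<lambda>j. j - 1"]) auto
      also have "\<dots> = (\<Sum>j<n. g ((f ^^ j) x)) + g ((f ^^ n) x) - g x"
        using sum.lessThan_Suc_shift[of "\<lambda>j. g ((f ^^ j) x)" n] by simp
      finally have "c * real n \<le> (\<Sum>j<n. g ((f ^^ j) x)) + 2 * B"
        using x B[OF xc] B[OF fn_circle[OF xc, of n]] by (simp add: E_def abs_le_iff)
      then have "1 \<le> exp (2 * B - c * real n) * exp (\<Sum>j<n. g ((f ^^ j) x))"
        by (simp add: exp_add[symmetric])
      then show "x \<in> {x \<in> space circle_lebesgue. 1 \<le> ennreal (exp (2 * B - c * real n)) * ?v x}"
        using xc by (simp add: ennreal_mult[symmetric])
    qed
    then have "emeasure circle_lebesgue (E n) \<le> emeasure circle_lebesgue {x \<in> space circle_lebesgue. 1 \<le> ennreal (exp (2 * B - c * real n)) * ?v x}"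
    proof (rule emeasure_mono)
      note [measurable] = vm
      show "{x \<in> space circle_lebesgue. 1 \<le> ennreal (exp (2 * B - c * real n)) * ?v x} \<in> sets circle_lebesgue"
        by measurable
    qed
    also have "\<dots> \<le> ennreal (exp (2 * B - c * real n)) * (\<integral>\<^sup>+x. ?v x * indicator (space circle_lebesgue) x \<partial>circle_lebesgue)"
    proof (rule nn_integral_Markov_inequality)
      note [measurable] = vm
      show "(\<lambda>x. ?v x * indicator (space circle_lebesgue) x) \<in> borel_measurable circle_lebesgue" by measurable
    qed (rule sets.top)
    also have "\<dots> = ennreal (exp (2 * B - c * real n)) * (\<integral>\<^sup>+x. ?v x \<partial>circle_lebesgue)"
      by (intro arg_cong2[where f = "(*)"] nn_integral_cong refl) simp
    also have "\<dots> \<le> ennreal (exp (2 * B - c * real n)) * ennreal (2 * pi)"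
      by (intro mult_left_mono nn_integral_exp_sum_le g step) auto
    also have "\<dots> = ennreal (K * exp (- c) ^ n)"
    proof -
      have "exp (- c) ^ n = exp (- (c * real n))"
        by (simp add: exp_of_nat_mult[symmetric] mult.commute)
      moreover have "exp (2 * B - c * real n) = exp (2 * B) * exp (- (c * real n))"
        by (simp add: exp_add[symmetric])
      ultimately show ?thesis by (simp add: K_def ennreal_mult[symmetric] mult_ac)
    qed
    finally show ?thesis .
  qed
  have "AE x in circle_lebesgue. eventually (\<lambda>n. x \<in> space circle_lebesgue - E n) sequentially"
  proof (rule borel_cantelli_AE1[OF E])
    show "emeasure circle_lebesgue (E n) < \<infinity>" for n
      using bound[of n] by (rule order_le_less_trans) simp
    have K0: "0 \<le> K" by (simp add: K_def)
    have le: "norm (measure circle_lebesgue (E n)) \<le> K * exp (- c) ^ n" for n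
      using bound[of n] K0 by (simp add: measure_def enn2real_leI)
    have "summable (\<lambda>n. K * exp (- c) ^ n)"
      using c by (intro summable_mult summable_geometric) simp
    then show "summable (\<lambda>n. measure circle_lebesgue (E n))"
      by (rule summable_comparison_test') (rule le)
  qed
  then show ?thesis
  proof eventually_elim
    fix x assume "eventually (\<lambda>n. x \<in> space circle_lebesgue - E n) sequentially"
    then show "eventually (\<lambda>n. (\<Sum>j=1..n. g ((f ^^ j) x)) \<le> c * real n) sequentially"
    proof (rule eventually_mono)
      fix n assume "x \<in> space circle_lebesgue - E n"
      then have "\<not> c * real n < (\<Sum>j=1..n. g ((f ^^ j) x))" unfolding E_def Diff_iff mem_Collect_eq by argo
      then show "(\<Sum>j=1..n. g ((f ^^ j) x)) \<le> c * real n" by (rule leI)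
    qed
  qed
qed

end

section \<open>Ruelle's inequality\<close>

lemma same_arc_Arg2pi:
  assumes N: "N > 0" and xy: "x \<in> circle" "y \<in> circle" and eq: "arc_index N 0 x = arc_index N 0 y"
  shows "\<bar>Arg2pi x - Arg2pi y\<bar> \<le> 2 * pi / real N"
proof -
  define i where "i = arc_index N 0 x"
  have W: "Arg2pi z \<in> {2 * pi * of_int i / real N..2 * pi * of_int i / real N + 2 * pi / real N}"
    if z: "z \<in> circle" "arc_index N 0 z = i" for z
    using arc_index_window[OF N, of "Arg2pi z" 0 i] Arg2pi[of z] z cis_Arg2pi_circle[OF z(1)]
    by (simp add: distrib_left add_divide_distrib)
  show ?thesis using W[OF xy(1)] W[OF xy(2)] eq by (auto simp: i_def abs_le_iff)
qed

lemma inner_regular_real: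
  fixes A :: "real set"
  assumes "prob_space \<nu>" "sets \<nu> = sets borel" "A \<in> sets borel" "\<delta> > 0"
  obtains K where "K \<subseteq> A" "compact K" "measure \<nu> A - \<delta> < measure \<nu> K"
proof -
  interpret prob_space \<nu> by fact
  have "\<exists>K. K \<subseteq> A \<and> compact K \<and> measure \<nu> A - \<delta> < measure \<nu> K"
  proof (rule ccontr)
    assume "\<not> ?thesis"
    then have le: "measure \<nu> K \<le> measure \<nu> A - \<delta>" if "K \<subseteq> A" "compact K" for K
      using that by (meson not_less)
    from le[of "{}"] have nn: "0 \<le> measure \<nu> A - \<delta>" by simp
    have fin: "emeasure \<nu> (space \<nu>) \<noteq> \<infinity>" by (simp add: emeasure_space_1)
    have "emeasure \<nu> A \<le> ennreal (measure \<nu> A - \<delta>)"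
      unfolding inner_regular[OF assms(2) fin assms(3)]
      using le by (intro SUP_least) (auto simp: emeasure_eq_measure intro!: ennreal_leI)
    then show False using nn assms(4) by (simp add: emeasure_eq_measure)
  qed
  then show ?thesis using that by blast
qed

lemma finitely_many_compact_separated:
  fixes K :: "'b \<Rightarrow> real set"
  assumes "finite U" "\<And>u. u \<in> U \<Longrightarrow> compact (K u)"
    and disj: "\<And>u v. u \<in> U \<Longrightarrow> v \<in> U \<Longrightarrow> u \<noteq> v \<Longrightarrow> K u \<inter> K v = {}"
  shows "\<exists>\<eta>>0. \<forall>u\<in>U. \<forall>v\<in>U. \<forall>s\<in>K u. \<forall>t\<in>K v. \<bar>s - t\<bar> < \<eta> \<longrightarrow> u = v"
proof -
  have "\<exists>\<eta>>0. \<forall>s\<in>K u. \<forall>t\<in>K v. u \<noteq> v \<longrightarrow> \<eta> \<le> dist s t" if "u \<in> U" "v \<in> U" for u v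
  proof (cases "u = v")
    case False
    then show ?thesis
      using separate_compact_closed[OF assms(2)[OF that(1)] compact_imp_closed[OF assms(2)[OF that(2)]] disj[OF that False]]
      by auto
  qed (auto intro: exI[of _ 1])
  then obtain e where e: "\<And>u v. u \<in> U \<Longrightarrow> v \<in> U \<Longrightarrow> e u v > 0"
    "\<And>u v s t. u \<in> U \<Longrightarrow> v \<in> U \<Longrightarrow> s \<in> K u \<Longrightarrow> t \<in> K v \<Longrightarrow> u \<noteq> v \<Longrightarrow> e u v \<le> dist s t"
    by metis
  define \<eta> where "\<eta> = Min (insert 1 ((\<lambda>(u, v). e u v) ` (U \<times> U)))"
  have fin: "finite (insert 1 ((\<lambda>(u, v). e u v) ` (U \<times> U)))" using assms(1) by simp
  have "\<eta> > 0" unfolding \<eta>_def using fin e(1) by (subst Min_gr_iff) auto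
  moreover have "\<eta> \<le> e u v" if "u \<in> U" "v \<in> U" for u v
    unfolding \<eta>_def using fin that by (intro Min_le) auto
  moreover have "u = v" if "u \<in> U" "v \<in> U" "s \<in> K u" "t \<in> K v" "\<bar>s - t\<bar> < \<eta>" for u v s t
    using e(2)[OF that(1-4)] \<open>\<And>u v. u \<in> U \<Longrightarrow> v \<in> U \<Longrightarrow> \<eta> \<le> e u v\<close>[OF that(1,2)] that(5)
    by (fastforce simp: dist_real_def)
  ultimately show ?thesis by blast
qed

text \<open>On fine arcs a finite-valued function is almost a function of the arc. Approximate its level sets by
  compact sets from inside; these have positive distance from each other, so an arc that is shorter
  than this distance meets at most one of them. The argument is carried out in the angle.\<close>

lemma arc_predictor:
  fixes X :: "complex \<Rightarrow> 'b"
  assumes \<mu>: "prob_space \<mu>" "sets \<mu> = sets circle_borel"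
    and X: "X \<in> circle_borel \<rightarrow>\<^sub>M count_space U" and U: "finite U" and \<delta>: "\<delta> > 0"
  obtains N0 where "\<And>N. N \<ge> N0 \<Longrightarrow> N > 0 \<Longrightarrow> \<exists>pred E. E \<in> sets \<mu> \<and> measure \<mu> E \<le> \<delta> \<and>
    (\<forall>x\<in>circle - E. X x = pred (arc_index N 0 x))"
proof -
  interpret prob_space \<mu> by fact
  have sp: "space \<mu> = circle" using sets_eq_imp_space_eq[OF \<mu>(2)] by simp
  have Am: "Arg2pi \<in> \<mu> \<rightarrow>\<^sub>M borel"
    unfolding measurable_cong_sets[OF \<mu>(2) refl] by (rule measurable_restrict_space1[OF Arg2pi_measurable])
  define \<nu> where "\<nu> = distr \<mu> borel Arg2pi"
  interpret \<nu>: prob_space \<nu> unfolding \<nu>_def by (rule prob_space_distr[OF Am])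
  have s\<nu>: "sets \<nu> = sets borel" by (simp add: \<nu>_def)
  have Xcis: "(\<lambda>t. X (cis t)) \<in> borel \<rightarrow>\<^sub>M count_space U"
    by (rule measurable_compose[OF cis_measurable_circle X])
  define A where "A u = {t. X (cis t) = u}" for u
  have A: "A u \<in> sets borel" if "u \<in> U" for u
    using measurable_sets[OF Xcis, of "{u}"] that by (simp add: A_def vimage_def)
  have A_cover: "(\<Union>u\<in>U. A u) = UNIV"
    using measurable_space[OF Xcis] by (auto simp: A_def)
  have "U \<noteq> {}" using A_cover by auto
  then have cU: "card U > 0" using U by (simp add: card_gt_0_iff)
  \<comment> \<open>The loss \<open>\<delta>\<close> is shared equally between the level sets.\<close>
  define \<delta>' where "\<delta>' = \<delta> / real (card U)"
  have \<delta>': "\<delta>' > 0" using \<delta> cU by (simp add: \<delta>'_def)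
  have "\<exists>K. K \<subseteq> A u \<and> compact K \<and> measure \<nu> (A u) - \<delta>' < measure \<nu> K" if "u \<in> U" for u
    using inner_regular_real[OF \<nu>.prob_space_axioms s\<nu> A[OF that] \<delta>'] by metis
  then obtain K where K: "\<And>u. u \<in> U \<Longrightarrow> K u \<subseteq> A u" "\<And>u. u \<in> U \<Longrightarrow> compact (K u)"
    "\<And>u. u \<in> U \<Longrightarrow> measure \<nu> (A u) - \<delta>' < measure \<nu> (K u)" by metis
  have disj: "K u \<inter> K v = {}" if "u \<in> U" "v \<in> U" "u \<noteq> v" for u v
    using K(1)[OF that(1)] K(1)[OF that(2)] that(3) by (auto simp: A_def)
  have "\<exists>\<eta>>0. \<forall>u\<in>U. \<forall>v\<in>U. \<forall>s\<in>K u. \<forall>t\<in>K v. \<bar>s - t\<bar> < \<eta> \<longrightarrow> u = v"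
    by (rule finitely_many_compact_separated[of U K]) (simp_all add: U K(2) disj)
  then obtain \<eta> where \<eta>': "\<eta> > 0" "\<forall>u\<in>U. \<forall>v\<in>U. \<forall>s\<in>K u. \<forall>t\<in>K v. \<bar>s - t\<bar> < \<eta> \<longrightarrow> u = v"
    by blast
  then have \<eta>: "\<eta> > 0" "\<And>u v s t. u \<in> U \<Longrightarrow> v \<in> U \<Longrightarrow> s \<in> K u \<Longrightarrow> t \<in> K v \<Longrightarrow> \<bar>s - t\<bar> < \<eta> \<Longrightarrow> u = v"
    by blast+
  have KB: "K u \<in> sets borel" if "u \<in> U" for u using K(2)[OF that] by (intro borel_compact)
  define E where "E = {x \<in> circle. Arg2pi x \<notin> (\<Union>u\<in>U. K u)}"
  have KU: "(\<Union>u\<in>U. K u) \<in> sets borel" using KB U by (intro sets.finite_UN) auto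
  have Eeq: "E = Arg2pi -` (- (\<Union>u\<in>U. K u)) \<inter> space \<mu>" by (auto simp: E_def sp)
  have KUc: "- (\<Union>u\<in>U. K u) \<in> sets borel" using KU by (rule borel_comp)
  have E: "E \<in> sets \<mu>" unfolding Eeq using KUc by (rule measurable_sets[OF Am])
  have "measure \<mu> E = measure \<nu> (- (\<Union>u\<in>U. K u))"
    unfolding \<nu>_def Eeq by (rule measure_distr[OF Am KUc, symmetric])
  also have "\<dots> = 1 - measure \<nu> (\<Union>u\<in>U. K u)"
  proof -
    have "space \<nu> = UNIV" by (simp add: \<nu>_def)
    then show ?thesis using \<nu>.prob_compl[of "\<Union>u\<in>U. K u"] KU s\<nu> by (simp add: Compl_eq_Diff_UNIV)
  qed
  also have "measure \<nu> (\<Union>u\<in>U. K u) = (\<Sum>u\<in>U. measure \<nu> (K u))"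
    using KB s\<nu> by (intro \<nu>.finite_measure_finite_Union U) (auto simp: disjoint_family_on_def disj)
  also have "1 = (\<Sum>u\<in>U. measure \<nu> (A u))"
  proof -
    have "measure \<nu> (\<Union>u\<in>U. A u) = (\<Sum>u\<in>U. measure \<nu> (A u))"
      using A s\<nu> by (intro \<nu>.finite_measure_finite_Union U) (auto simp: disjoint_family_on_def A_def)
    then show ?thesis using \<nu>.prob_space by (simp add: A_cover \<nu>_def)
  qed
  also have "(\<Sum>u\<in>U. measure \<nu> (A u)) - (\<Sum>u\<in>U. measure \<nu> (K u)) \<le> (\<Sum>u\<in>U. \<delta>')"
    unfolding sum_subtractf[symmetric] using K(3) by (intro sum_mono) (simp add: algebra_simps less_imp_le)
  also have "\<dots> = \<delta>" using cU by (simp add: \<delta>'_def)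
  finally have E\<delta>: "measure \<mu> E \<le> \<delta>" .
  obtain N0 :: nat where N0: "real N0 > 2 * pi / \<eta>" using reals_Archimedean2 by blast
  show ?thesis
  proof (rule that[of N0])
    fix N assume N: "N \<ge> N0" "N > 0"
    have "2 * pi / \<eta> < real N" using N N0 by linarith
    then have small: "2 * pi / real N < \<eta>" using N(2) \<eta>(1) by (simp add: field_simps)
    \<comment> \<open>An arc that meets none of the compact sets gets an arbitrary value; its points all lie in \<open>E\<close>.\<close>
    define pred where "pred a = (SOME u. u \<in> U \<and> (\<exists>x\<in>circle. arc_index N 0 x = a \<and> Arg2pi x \<in> K u))" for a
    have "X x = pred (arc_index N 0 x)" if x: "x \<in> circle - E" for x
    proof -
      obtain u where u: "u \<in> U" "Arg2pi x \<in> K u" using x by (auto simp: E_def)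
      have "X x = u" using K(1)[OF u(1)] u(2) x cis_Arg2pi_circle[of x] by (auto simp: A_def)
      moreover have "pred (arc_index N 0 x) \<in> U \<and>
          (\<exists>y\<in>circle. arc_index N 0 y = arc_index N 0 x \<and> Arg2pi y \<in> K (pred (arc_index N 0 x)))"
        unfolding pred_def by (rule someI[of _ u]) (use u x in blast)
      then obtain y where y: "y \<in> circle" "arc_index N 0 y = arc_index N 0 x"
          "Arg2pi y \<in> K (pred (arc_index N 0 x))" "pred (arc_index N 0 x) \<in> U" by blast
      have "\<bar>Arg2pi x - Arg2pi y\<bar> < \<eta>"
        using same_arc_Arg2pi[OF N(2), of x y] x y(1,2) small by simp
      then have "u = pred (arc_index N 0 x)" by (rule \<eta>(2)[OF u(1) y(4) u(2) y(3)])
      ultimately show ?thesis by simp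
    qed
    then show "\<exists>pred E. E \<in> sets \<mu> \<and> measure \<mu> E \<le> \<delta> \<and> (\<forall>x\<in>circle - E. X x = pred (arc_index N 0 x))"
      using E E\<delta> by blast
  qed
qed

context expanding_lift
begin

definition log_deriv_sum :: "nat \<Rightarrow> complex \<Rightarrow> real" where
  "log_deriv_sum m x = (\<Sum>j<m. log_deriv ((f ^^ j) x))"

lemma log_deriv_sum_cont: "continuous_on circle (log_deriv_sum m)"
  unfolding log_deriv_sum_def
  by (intro continuous_intros continuous_on_compose2[OF log_deriv_cont fn_cont]) (use fn_circle in blast)

lemma Fn_deriv:
  "\<exists>d. ((F ^^ m) has_real_derivative d) (at t) \<and> \<bar>d\<bar> = exp (log_deriv_sum m (cis t))"
proof (induction m)
  case 0
  have "((\<lambda>x. x) has_real_derivative 1) (at t)" by (rule DERIV_ident)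
  then show ?case by (auto simp: log_deriv_sum_def id_def intro!: exI[of _ 1])
next
  case (Suc m)
  then obtain d where d: "((F ^^ m) has_real_derivative d) (at t)" "\<bar>d\<bar> = exp (log_deriv_sum m (cis t))" by blast
  have "((F ^^ Suc m) has_real_derivative F' ((F ^^ m) t) * d) (at t)"
    using DERIV_chain[OF F_deriv d(1)] by simp
  moreover have "\<bar>F' ((F ^^ m) t) * d\<bar> = exp (log_deriv_sum (Suc m) (cis t))"
    using exp_log_deriv[of "cis ((F ^^ m) t)"]
    by (simp add: abs_mult d(2) log_deriv_sum_def exp_add deriv_norm fn_lift)
  ultimately show ?case by blast
qed

text \<open>The geometric input of Ruelle's inequality: \<open>f\<^sup>m\<close> stretches a short arc at most by the factor
  \<open>E = exp (log_deriv_sum m x + 1)\<close>, where the summand one absorbs the variation of the logarithm of the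
  derivative along the arc. The image then meets at most \<open>2 E + 2\<close> arcs of the same length.\<close>

lemma arc_image_meets_few_arcs:
  obtains N0 where "\<And>N x. N \<ge> N0 \<Longrightarrow> N > 0 \<Longrightarrow> x \<in> circle \<Longrightarrow>
    real (card {arc_index N 0 ((f ^^ m) y) |y. y \<in> circle \<and> arc_index N 0 y = arc_index N 0 x})
      \<le> 4 * exp (log_deriv_sum m x + 1)"
proof -
  have "continuous_on {0..2 * pi} (\<lambda>t. log_deriv_sum m (cis t))"
    by (rule continuous_on_compose2[OF log_deriv_sum_cont]) (auto intro!: continuous_intros)
  then have "uniformly_continuous_on {0..2 * pi} (\<lambda>t. log_deriv_sum m (cis t))"
    by (intro compact_uniformly_continuous) auto
  then obtain \<delta> where \<delta>: "\<delta> > 0"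
    "\<And>s t. s \<in> {0..2 * pi} \<Longrightarrow> t \<in> {0..2 * pi} \<Longrightarrow> \<bar>s - t\<bar> < \<delta> \<Longrightarrow>
       \<bar>log_deriv_sum m (cis s) - log_deriv_sum m (cis t)\<bar> < 1"
    unfolding uniformly_continuous_on_def dist_real_def by (metis zero_less_one)
  obtain N0 :: nat where N0: "real N0 > 2 * pi / \<delta>" using reals_Archimedean2 by blast
  show ?thesis
  proof (rule that[of N0])
    fix N x assume N: "N \<ge> N0" "N > 0" and x: "x \<in> circle"
    have "2 * pi / \<delta> < real N" using N N0 by linarith
    then have small: "2 * pi / real N < \<delta>" using N(2) \<delta>(1) by (simp add: field_simps)
    define E where "E = exp (log_deriv_sum m x + 1)"
    have E1: "E \<ge> 1"
      unfolding E_def log_deriv_sum_def using fn_circle[OF x] log_deriv_pos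
      by (auto intro!: add_nonneg_nonneg sum_nonneg less_imp_le[OF log_deriv_pos])
    define z where "z = real N * (F ^^ m) (Arg2pi x) / (2 * pi)"
    let ?R = "{arc_index N 0 ((f ^^ m) y) |y. y \<in> circle \<and> arc_index N 0 y = arc_index N 0 x}"
    have "arc_index N 0 ((f ^^ m) y) \<in> (\<lambda>k. k mod int N) ` {\<lfloor>z - E\<rfloor>..\<lfloor>z + E\<rfloor>}"
      if y: "y \<in> circle" "arc_index N 0 y = arc_index N 0 x" for y
    proof -
      let ?s = "Arg2pi x" and ?t = "Arg2pi y"
      have st: "\<bar>?t - ?s\<bar> \<le> 2 * pi / real N" using same_arc_Arg2pi[OF N(2) y(1) x y(2)] .
      have rng: "?s \<in> {0..2 * pi}" "?t \<in> {0..2 * pi}"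
        using Arg2pi[of x] Arg2pi[of y] by auto
      obtain D where D: "\<And>t. ((F ^^ m) has_real_derivative D t) (at t)"
          "\<And>t. \<bar>D t\<bar> = exp (log_deriv_sum m (cis t))"
        using Fn_deriv[of m] by metis
      define S where "S = {0..2 * pi} \<inter> {?s - 2 * pi / real N..?s + 2 * pi / real N}"
      have D_le: "norm (D \<xi>) \<le> E" if "\<xi> \<in> S" for \<xi>
      proof -
        have "\<bar>\<xi> - ?s\<bar> < \<delta>" "\<xi> \<in> {0..2 * pi}" using that small by (auto simp: S_def)
        then show ?thesis
          using \<delta>(2)[of \<xi> ?s] rng cis_Arg2pi_circle[OF x] by (simp add: D(2) E_def)
      qed
      have "norm ((F ^^ m) ?t - (F ^^ m) ?s) \<le> E * norm (?t - ?s)"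
      proof (rule field_differentiable_bound[OF _ DERIV_subset[OF D(1)] D_le])
        show "convex S" unfolding S_def by (intro convex_Int convex_real_interval)
        show "?t \<in> S" "?s \<in> S" using rng st by (auto simp: S_def abs_le_iff)
      qed auto
      also have "\<dots> \<le> E * (2 * pi / real N)" using st E1 by (intro mult_left_mono) auto
      finally have "\<bar>(F ^^ m) ?t - (F ^^ m) ?s\<bar> \<le> 2 * pi / real N * E" by (simp add: mult.commute)
      then have "real N / (2 * pi) * \<bar>(F ^^ m) ?t - (F ^^ m) ?s\<bar> \<le> real N / (2 * pi) * (2 * pi / real N * E)"
        by (intro mult_left_mono) auto
      moreover have "real N / (2 * pi) * \<bar>(F ^^ m) ?t - (F ^^ m) ?s\<bar> = \<bar>real N * (F ^^ m) ?t / (2 * pi) - z\<bar>"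
      proof -
        have "real N * (F ^^ m) ?t / (2 * pi) - z = real N / (2 * pi) * ((F ^^ m) ?t - (F ^^ m) ?s)"
          by (simp add: z_def right_diff_distrib)
        then show ?thesis by (simp only: abs_mult) simp
      qed
      ultimately have "\<bar>real N * (F ^^ m) ?t / (2 * pi) - z\<bar> \<le> E" using N(2) by simp
      then have "\<lfloor>real N * (F ^^ m) ?t / (2 * pi)\<rfloor> \<in> {\<lfloor>z - E\<rfloor>..\<lfloor>z + E\<rfloor>}"
        by (auto intro!: floor_mono simp: abs_le_iff)
      moreover have "arc_index N 0 ((f ^^ m) y) = \<lfloor>real N * (F ^^ m) ?t / (2 * pi)\<rfloor> mod int N"
        using arc_index_cis[OF N(2), of 0 "(F ^^ m) ?t"] fn_lift[of m ?t] cis_Arg2pi_circle[OF y(1)] by simp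
      ultimately show ?thesis by blast
    qed
    then have "?R \<subseteq> (\<lambda>k. k mod int N) ` {\<lfloor>z - E\<rfloor>..\<lfloor>z + E\<rfloor>}" by blast
    then have "card ?R \<le> card {\<lfloor>z - E\<rfloor>..\<lfloor>z + E\<rfloor>}" by (intro surj_card_le) auto
    then have "real (card ?R) \<le> of_int (\<lfloor>z + E\<rfloor> - \<lfloor>z - E\<rfloor> + 1)"
      using E1 floor_mono[of "z - E" "z + E"] by simp
    \<comment> \<open>The image is spread over an interval of length \<open>2 E\<close> in units of arcs, and rounding adds at most two;
  as \<open>E \<ge> 1\<close>, the sum is at most \<open>4 E\<close>.\<close>
    also have "\<dots> \<le> 4 * E" using E1 by linarith
    finally show "real (card ?R) \<le> 4 * exp (log_deriv_sum m x + 1)" by (simp add: E_def)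
  qed
qed

end

context expanding_lift
begin

text \<open>The hidden states are the arcs of a fine partition. From an arc the chain moves with equal
  probabilities to the arcs that meet its image under \<open>f\<^sup>m\<close>, at a cost of
  \<open>\<Sum>j<m. ln |f'| \<circ> f\<^sup>j\<close> plus a constant. It emits the predicted word with probability at least
  one half, and every other word with a small positive probability; this costs at most \<open>ln 2\<close> except
  on a set so small that its contribution to the mean is at most one. The constants do not depend
  on \<open>m\<close> and disappear on division by \<open>m\<close>.\<close>

lemma block_entropy_le:
  assumes \<mu>: "\<mu> \<in> invariant_probs f" and P: "measurable_partition \<mu> P" and m: "m > 0"
  shows "real m * entropy_wrt_partition \<mu> f P \<le> real m * (\<integral>x. log_deriv x \<partial>\<mu>) + (2 + ln 4 + ln 2)"
proof -
  note mu = invariant_probsD[OF \<mu>]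
  interpret partitioned_system \<mu> f P by (rule invariant_partitioned_system[OF \<mu> P])
  define w where "w = real (card (words P m))"
  obtain x0 where "x0 \<in> space \<mu>" using not_empty by blast
  then have "words P m \<noteq> {}" using word_in_words by blast
  then have w: "w \<ge> 1"
    using finite_words[OF finite_P, of m] by (simp add: w_def Suc_le_eq card_gt_0_iff)
  \<comment> \<open>The cost of a wrongly predicted word. The exceptional set is chosen of measure at most \<open>1 / L\<close>.\<close>
  define L where "L = ln (2 * w)"
  have L: "L > 0" using w by (simp add: L_def)
  have X: "word m \<in> circle_borel \<rightarrow>\<^sub>M count_space (words P m)"
    using word_measurable[of m] unfolding measurable_cong_sets[OF mu(2) refl] .
  have "1 / L > 0" using L by simp
  from arc_predictor[OF mu(1,2) X _ this]
  obtain N1 where N1: "\<And>N. N \<ge> N1 \<Longrightarrow> N > 0 \<Longrightarrow> \<exists>pred E. E \<in> sets \<mu> \<and> measure \<mu> E \<le> 1 / L \<and>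
    (\<forall>x\<in>circle - E. word m x = pred (arc_index N 0 x))"
    by (metis finite_P finite_words)
  obtain N2 where N2: "\<And>N x. N \<ge> N2 \<Longrightarrow> N > 0 \<Longrightarrow> x \<in> circle \<Longrightarrow>
    real (card {arc_index N 0 ((f ^^ m) y) |y. y \<in> circle \<and> arc_index N 0 y = arc_index N 0 x})
      \<le> 4 * exp (log_deriv_sum m x + 1)"
    by (rule arc_image_meets_few_arcs[of m]) blast
  define N where "N = max (max N1 N2) 1"
  have N: "N > 0" "N \<ge> N1" "N \<ge> N2" by (auto simp: N_def)
  obtain pred E where E: "E \<in> sets \<mu>" "measure \<mu> E \<le> 1 / L"
    and pred: "\<And>x. x \<in> circle \<Longrightarrow> x \<notin> E \<Longrightarrow> word m x = pred (arc_index N 0 x)"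
    using N1[OF N(2,1)] by blast
  let ?I = "{0..<int N}" and ?\<kappa> = "arc_index N 0"
  define s where "s u a = (if u = pred a then 1 / 2 else 0) + 1 / (2 * w)" for u a
  define R where "R a = {?\<kappa> ((f ^^ m) y) |y. y \<in> circle \<and> ?\<kappa> y = a}" for a
  define t where "t a b = (if b \<in> R a then 1 / real (card (R a)) else 0)" for a b
  define \<beta> where "\<beta> x = (log_deriv_sum m x + 1 + ln 4) + (ln 2 + L * indicator E x)" for x
  have RI: "R a \<subseteq> ?I" for a using arc_index_range[OF N(1)] by (auto simp: R_def)
  then have finR: "finite (R a)" for a by (rule finite_subset) simp
  have inR: "?\<kappa> ((f ^^ m) x) \<in> R (?\<kappa> x)" if "x \<in> circle" for x
    using that by (auto simp: R_def)
  then have cR: "card (R (?\<kappa> x)) > 0" if "x \<in> circle" for x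
    using finR that by (fastforce simp: card_gt_0_iff)
  have int_terms: "integrable \<mu> (\<lambda>x. log_deriv ((f ^^ j) x))" for j
    by (rule integrable_T[OF log_deriv_integrable[OF \<mu>]])
  have int_S: "integrable \<mu> (log_deriv_sum m)"
    unfolding log_deriv_sum_def by (rule Bochner_Integration.integrable_sum) (rule int_terms)
  have int_E: "integrable \<mu> (indicator E :: _ \<Rightarrow> real)"
    using E(1) by (intro integrable_real_indicator) (auto simp: emeasure_eq_measure)
  have int_\<beta>: "integrable \<mu> \<beta>"
    unfolding \<beta>_def by (intro Bochner_Integration.integrable_add int_S integrable_mult_right int_E) auto
  have "real m * entropy_wrt_partition \<mu> f P \<le> (\<integral>x. \<beta> x \<partial>\<mu>)"
  proof (rule entropy_le_block_cost[where s = s and t = t and \<kappa> = ?\<kappa> and I = ?I, OF m])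
    show "?\<kappa> x \<in> ?I" for x by (rule arc_index_range[OF N(1)])
    show "0 \<le> s u a" for u a using w by (simp add: s_def)
    show "0 \<le> t a b" for a b by (simp add: t_def)
    show "(\<Sum>u\<in>words P m. s u a) \<le> 1" for a
    proof -
      have "(\<Sum>u\<in>words P m. if u = pred a then 1 / 2 else (0::real)) \<le> 1 / 2"
        by (simp add: sum.delta)
      moreover have "(\<Sum>u\<in>words P m. 1 / (2 * w)) = 1 / 2"
        using w by (simp add: w_def[symmetric])
      ultimately show ?thesis by (simp add: s_def sum.distrib)
    qed
    show "(\<Sum>b\<in>?I. t a b) \<le> 1" for a
    proof -
      have "(\<Sum>b\<in>?I. t a b) = (\<Sum>b\<in>R a. 1 / real (card (R a)))"
        unfolding t_def using RI[of a] by (simp add: sum.If_cases Int_absorb1)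
      then show ?thesis by simp
    qed
    fix x assume "x \<in> space \<mu>"
    then have x: "x \<in> circle" by (simp add: mu)
    have s_ge: "1 / (2 * w) \<le> s (word m x) (?\<kappa> x)" by (simp add: s_def)
    moreover have wpos: "0 < 1 / (2 * w)" using w by simp
    ultimately show spos: "0 < s (word m x) (?\<kappa> x)" by linarith
    show "0 < t (?\<kappa> x) (?\<kappa> ((f ^^ m) x))"
      using inR[OF x] cR[OF x] by (simp add: t_def)
    have "- ln (s (word m x) (?\<kappa> x)) \<le> ln 2 + L * indicator E x"
    proof (cases "x \<in> E")
      case True
      have "ln (1 / (2 * w)) \<le> ln (s (word m x) (?\<kappa> x))" using s_ge wpos spos by simp
      then have "- ln (s (word m x) (?\<kappa> x)) \<le> L" using w by (simp add: L_def ln_div)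
      then show ?thesis using True by (simp add: add_increasing)
    next
      case False
      have "1 / 2 \<le> s (word m x) (?\<kappa> x)" using pred[OF x False] w by (simp add: s_def)
      then have "ln (1 / 2) \<le> ln (s (word m x) (?\<kappa> x))" using spos by (subst ln_le_cancel_iff) auto
      then show ?thesis using False by (simp add: ln_div)
    qed
    moreover have "- ln (t (?\<kappa> x) (?\<kappa> ((f ^^ m) x))) \<le> log_deriv_sum m x + 1 + ln 4"
    proof -
      have "real (card (R (?\<kappa> x))) \<le> 4 * exp (log_deriv_sum m x + 1)"
        unfolding R_def using N2[OF N(3,1) x] .
      then have "ln (real (card (R (?\<kappa> x)))) \<le> ln (4 * exp (log_deriv_sum m x + 1))"
        using cR[OF x] by (subst ln_le_cancel_iff) auto
      also have "\<dots> = ln 4 + (log_deriv_sum m x + 1)" by (simp add: ln_mult)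
      finally show ?thesis using inR[OF x] cR[OF x] by (simp add: t_def ln_div)
    qed
    ultimately show "- ln (s (word m x) (?\<kappa> x)) - ln (t (?\<kappa> x) (?\<kappa> ((f ^^ m) x))) \<le> \<beta> x"
      by (simp add: \<beta>_def)
  qed (use int_\<beta> in auto)
  also have "(\<integral>x. \<beta> x \<partial>\<mu>) = (\<integral>x. log_deriv_sum m x \<partial>\<mu>) + 1 + ln 4 + ln 2 + L * measure \<mu> E"
    unfolding \<beta>_def using int_S int_E E(1)
    by (simp add: prob_space Int_absorb2 sets.sets_into_space)
  also have "(\<integral>x. log_deriv_sum m x \<partial>\<mu>) = real m * (\<integral>x. log_deriv x \<partial>\<mu>)"
    unfolding log_deriv_sum_def using int_terms
    by (simp add: Bochner_Integration.integral_sum integral_T[OF borel_measurable_integrable[OF log_deriv_integrable[OF \<mu>]]])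
  finally have "real m * entropy_wrt_partition \<mu> f P \<le> real m * (\<integral>x. log_deriv x \<partial>\<mu>) + 1 + ln 4 + ln 2 + L * measure \<mu> E" .
  moreover have "L * measure \<mu> E \<le> L * (1 / L)" using E(2) L by (intro mult_left_mono) auto
  ultimately show ?thesis using L by simp
qed

lemma metric_entropy_le:
  assumes \<mu>: "\<mu> \<in> invariant_probs f"
  shows "metric_entropy \<mu> f \<le> ereal (\<integral>x. log_deriv x \<partial>\<mu>)"
  unfolding metric_entropy_def
proof (rule SUP_least)
  fix P assume "P \<in> {P. measurable_partition \<mu> P}"
  then have P: "measurable_partition \<mu> P" by simp
  let ?h = "entropy_wrt_partition \<mu> f P" and ?I = "\<integral>x. log_deriv x \<partial>\<mu>"
  have "?h \<le> ?I"
  proof (rule ccontr)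
    assume "\<not> ?thesis"
    then have "?h - ?I > 0" by simp
    from reals_Archimedean3[OF this] obtain m where m: "2 + ln 4 + ln 2 < real m * (?h - ?I)" by blast
    have "0 < real m * (?h - ?I)"
      by (rule less_trans[OF _ m]) (auto intro!: add_pos_nonneg)
    then have "m > 0" by (cases m) auto
    from block_entropy_le[OF \<mu> P this] m show False by (simp add: right_diff_distrib)
  qed
  then show "ereal ?h \<le> ereal ?I" by simp
qed

end

section \<open>Measures of small entropy are avoided by Lebesgue almost every orbit\<close>

definition arc_partition :: "nat \<Rightarrow> real \<Rightarrow> complex set set" where
  "arc_partition N \<beta> = (\<lambda>i. {x \<in> circle. arc_index N \<beta> x = i}) ` {0..<int N}"

lemma arc_nonempty:
  assumes N: "N > 0" and i: "i \<in> {0..<int N}"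
  shows "\<exists>x\<in>circle. arc_index N \<beta> x = i"
proof
  have "real N * (\<beta> + 2 * pi * of_int i / real N - \<beta>) / (2 * pi) = of_int i"
    using N by simp
  then show "arc_index N \<beta> (cis (\<beta> + 2 * pi * of_int i / real N)) = i"
    unfolding arc_index_cis[OF N] using i by simp
qed simp

lemma inj_on_arcs:
  assumes N: "N > 0"
  shows "inj_on (\<lambda>i. {x \<in> circle. arc_index N \<beta> x = i}) {0..<int N}"
proof (rule inj_onI)
  fix i j assume i: "i \<in> {0..<int N}"
    and eq: "{x \<in> circle. arc_index N \<beta> x = i} = {x \<in> circle. arc_index N \<beta> x = j}"
  obtain x where "x \<in> circle" "arc_index N \<beta> x = i" using arc_nonempty[OF N i] by blast
  with eq show "i = j" by blast
qed

lemma measurable_partition_arcs: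
  assumes N: "N > 0" and \<mu>: "sets \<mu> = sets circle_borel"
  shows "measurable_partition \<mu> (arc_partition N \<beta>)"
proof -
  have sp: "space \<mu> = circle" using sets_eq_imp_space_eq[OF \<mu>] by simp
  have "{x \<in> circle. arc_index N \<beta> x = i} \<in> sets circle_borel" for i
    using measurable_sets[OF arc_index_measurable, of "{i}" N \<beta>] by (simp add: vimage_def Int_def conj_commute)
  moreover have "partition_on circle (arc_partition N \<beta>)"
  proof (rule partition_onI)
    show "\<Union> (arc_partition N \<beta>) = circle"
      using arc_index_range[OF N] by (auto simp: arc_partition_def)
    show "{} \<notin> arc_partition N \<beta>"
      using arc_nonempty[OF N] by (fastforce simp: arc_partition_def)
  qed (auto simp: arc_partition_def disjnt_def)
  ultimately show ?thesis
    unfolding measurable_partition_def by (auto simp: arc_partition_def \<mu> sp)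
qed

text \<open>The level sets of \<open>x \<mapsto> x ^ N\<close> are disjoint, so only countably many of them have positive measure.\<close>

lemma exists_null_angle:
  assumes "prob_space \<mu>" "sets \<mu> = sets circle_borel"
  shows "\<exists>\<beta>. measure \<mu> {x \<in> circle. x ^ N = cis \<beta>} = 0"
proof (rule ccontr)
  assume *: "\<not> ?thesis"
  interpret prob_space \<mu> by fact
  have sp: "space \<mu> = circle" using sets_eq_imp_space_eq[OF assms(2)] by simp
  have m: "(\<lambda>x. x ^ N) \<in> \<mu> \<rightarrow>\<^sub>M (borel :: complex measure)"
    unfolding measurable_cong_sets[OF assms(2) refl]
    by (intro borel_measurable_continuous_on_restrict continuous_intros)
  interpret D: prob_space "distr \<mu> borel (\<lambda>x. x ^ N)" by (rule prob_space_distr[OF m])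
  have "measure (distr \<mu> borel (\<lambda>x. x ^ N)) {cis \<beta>} \<noteq> 0" for \<beta>
  proof -
    have "(\<lambda>x. x ^ N) -` {cis \<beta>} \<inter> space \<mu> = {x \<in> circle. x ^ N = cis \<beta>}" by (auto simp: sp)
    then show ?thesis using * by (simp add: measure_distr[OF m])
  qed
  then have "cis ` {0..<1} \<subseteq> {y. measure (distr \<mu> borel (\<lambda>x. x ^ N)) {y} \<noteq> 0}" by auto
  then have "countable (cis ` {0..<1})" using D.countable_support countable_subset by blast
  moreover have "inj_on cis {0..<1}"
  proof (rule inj_onI)
    fix s t :: real assume st: "s \<in> {0..<1}" "t \<in> {0..<1}" "cis s = cis t"
    then have "cos s = cos t" by (simp add: complex_eq_iff)
    with st pi_gt3 show "s = t" by (auto intro: cos_inj_pi[of s t])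
  qed
  ultimately have "countable {0..<1::real}" by (rule countable_image_inj_on)
  then show False using uncountable_half_open_interval_1[of "0::real" 1] by simp
qed

context expanding_lift
begin

text \<open>The boundaries of the arcs are the solutions of \<open>x ^ N = cis (N \<beta>)\<close>.\<close>

lemma arc_index_locally_constant:
  assumes N: "N > 0" and s: "((f ^^ j) (cis s)) ^ N \<noteq> cis (real N * \<beta>)"
  shows "eventually (\<lambda>t. arc_index N \<beta> ((f ^^ j) (cis t)) = arc_index N \<beta> ((f ^^ j) (cis s))) (at s)"
proof -
  let ?z = "\<lambda>t. real N * ((F ^^ j) t - \<beta>) / (2 * pi)"
  have "isCont (F ^^ j) s"
    using Fn_cont by (simp add: continuous_on_eq_continuous_at)
  then have lim: "(?z \<longlongrightarrow> ?z s) (at s)"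
    unfolding isCont_def by (intro tendsto_intros) auto
  moreover have "?z s \<notin> \<int>"
  proof
    assume "?z s \<in> \<int>"
    then obtain k where "?z s = of_int k" by (auto elim: Ints_cases)
    then have "real N * (F ^^ j) s = real N * \<beta> + 2 * pi * of_int k"
      by (simp add: field_simps)
    then have "cis (real N * (F ^^ j) s) = cis (real N * \<beta>)" by (simp add: cis_plus_2pi_int)
    then show False using s by (simp add: fn_lift Complex.DeMoivre)
  qed
  ultimately have "eventually (\<lambda>t. \<lfloor>?z t\<rfloor> = \<lfloor>?z s\<rfloor>) (at s)"
    by (rule eventually_floor_eq)
  then show ?thesis
    by eventually_elim (simp add: fn_lift arc_index_cis[OF N])
qed

text \<open>The predictor of \<open>low_entropy_predictor\<close> depends on finitely many arc numbers, so \<open>G\<close> is bounded and is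
  discontinuous only where one of the points \<open>x, f x, \<dots>, f\<^sup>q x\<close> is an end point of an arc. These points
  are the zeros of the continuous function \<open>\<phi>\<close> and form a \<open>\<mu>\<close>-null set. Cutting \<open>G\<close> off near them,
  towards its lower bound \<open>- B\<close>, gives continuous functions \<open>g k \<le> G\<close> that converge to \<open>G\<close> almost
  everywhere.\<close>

lemma continuous_minorant:
  assumes \<mu>: "\<mu> \<in> invariant_probs f"
    and low: "metric_entropy \<mu> f < ereal (\<integral>x. log_deriv x \<partial>\<mu>)"
  obtains g :: "complex \<Rightarrow> real" where "continuous_on circle g" "(\<integral>x. g x \<partial>\<mu>) > 0"
    "\<And>u. u \<in> borel_measurable circle_borel \<Longrightarrow>
      (\<integral>\<^sup>+x. u (f x) * ennreal (exp (g x)) \<partial>circle_lebesgue) \<le> (\<integral>\<^sup>+x. u x \<partial>circle_lebesgue)"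
proof -
  note m = invariant_probsD[OF \<mu>]
  obtain C where C0: "\<forall>x\<in>circle. \<bar>circle_deriv_norm f x\<bar> \<le> C"
    using bounded_on_circle[OF deriv_norm_cont] by blast
  note C = bspec[OF C0]
  \<comment> \<open>With at least \<open>sup |f'|\<close> arcs, the image of an arc covers the circle at most once.\<close>
  obtain N where NC: "real N > max C 0" using reals_Archimedean2 by blast
  then have N: "N > 0" by auto
  have NF: "\<bar>F' t\<bar> \<le> real N" for t
    using C[of "cis t"] NC by (simp add: deriv_norm)
  obtain \<beta>' where \<beta>': "measure \<mu> {x \<in> circle. x ^ N = cis \<beta>'} = 0"
    using exists_null_angle[OF m(1,2)] by blast
  define \<beta> where "\<beta> = \<beta>' / real N"
  have N\<beta>: "real N * \<beta> = \<beta>'" using N by (simp add: \<beta>_def)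
  let ?P = "arc_partition N \<beta>"
  let ?A = "\<lambda>i. {x \<in> circle. arc_index N \<beta> x = i}"
  have P: "measurable_partition \<mu> ?P" by (rule measurable_partition_arcs[OF N m(2)])
  interpret partitioned_system \<mu> f ?P by (rule invariant_partitioned_system[OF \<mu> P])
  have "ereal (entropy_wrt_partition \<mu> f ?P) \<le> metric_entropy \<mu> f"
    unfolding metric_entropy_def using P by (intro SUP_upper) simp
  then have "entropy_wrt_partition \<mu> f ?P < (\<integral>x. log_deriv x \<partial>\<mu>)"
    using low by (metis ereal_less_eq(3) le_less_trans less_ereal.simps(1))
  then obtain q \<tau> where \<tau>pos: "\<And>A w. A \<in> ?P \<Longrightarrow> w \<in> words ?P q \<Longrightarrow> 0 < \<tau> A w"
    and \<tau>sum: "\<And>w. w \<in> words ?P q \<Longrightarrow> (\<Sum>A\<in>?P. \<tau> A w) \<le> 1"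
    and \<tau>int: "- (\<integral>x. ln (\<tau> (cell x) (word q (f x))) \<partial>\<mu>) < (\<integral>x. log_deriv x \<partial>\<mu>)"
    by (rule low_entropy_predictor) blast
  have cell: "cell x = ?A (arc_index N \<beta> x)" if "x \<in> circle" for x
    using that arc_index_range[OF N] by (intro cell_eq) (auto simp: arc_partition_def)
  have meas_eq: "borel_measurable circle_borel = borel_measurable \<mu>"
    by (rule measurable_cong_sets) (simp_all add: m(2))
  have log_deriv_int: "integrable \<mu> log_deriv" by (rule log_deriv_integrable[OF \<mu>])
  define \<xi> where "\<xi> x = ln (\<tau> (cell x) (word q (f x)))" for x
  have \<xi>_word: "\<xi> x = ln (\<tau> (hd (word (Suc q) x)) (tl (word (Suc q) x)))" for x
    by (simp add: \<xi>_def word_Cons)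
  have \<xi>_int: "integrable \<mu> \<xi>"
    unfolding \<xi>_word[abs_def] by (rule integrable_word[of "\<lambda>w. ln (\<tau> (hd w) (tl w))"])
  define G where "G x = log_deriv x + \<xi> x" for x
  have G_int: "integrable \<mu> G"
    unfolding G_def by (intro Bochner_Integration.integrable_add log_deriv_int \<xi>_int)
  have G_pos: "(\<integral>x. G x \<partial>\<mu>) > 0"
    using \<tau>int unfolding G_def by (simp add: log_deriv_int \<xi>_int) (simp add: \<xi>_def)
  define B where "B = (\<Sum>w\<in>words ?P (Suc q). \<bar>ln (\<tau> (hd w) (tl w))\<bar>)"
  have \<xi>B: "\<bar>\<xi> x\<bar> \<le> B" if "x \<in> circle" for x
    unfolding B_def \<xi>_word using that word_in_words[of x "Suc q"]
    by (intro member_le_sum[of _ _ "\<lambda>w. \<bar>ln (\<tau> (hd w) (tl w))\<bar>"]) (auto simp: m)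
  obtain B' where B'0: "\<forall>x\<in>circle. \<bar>log_deriv x\<bar> \<le> B'"
    using bounded_on_circle[OF log_deriv_cont] by blast
  note B' = bspec[OF B'0]
  \<comment> \<open>An upper bound for \<open>G + B\<close>, which is nonnegative because \<open>ln |f'| > 0\<close>.\<close>
  define D where "D = B' + 2 * B"
  have H: "0 \<le> G x + B" "G x + B \<le> D" if "x \<in> circle" for x
    using \<xi>B[OF that] B'[OF that] log_deriv_pos[OF that] by (auto simp: G_def D_def abs_le_iff)
  define \<phi> where "\<phi> x = (\<Prod>j\<le>q. norm ((f ^^ j) x ^ N - cis \<beta>'))" for x
  have \<phi>0: "0 \<le> \<phi> x" for x by (simp add: \<phi>_def prod_nonneg)
  have \<phi>_cont: "continuous_on circle \<phi>"
    unfolding \<phi>_def by (intro continuous_intros fn_cont)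
  define g where "g k x = min 1 (real k * \<phi> x) * (G x + B) - B" for k x
  have g_le: "g k x \<le> G x" if "x \<in> circle" for k x
    using mult_right_mono[OF min.cobounded1[of 1 "real k * \<phi> x"] H(1)[OF that]] by (simp add: g_def)
  have g_cont: "continuous_on circle (g k)" for k
  proof (rule continuous_on_circleI, unfold continuous_on_eq_continuous_at[OF open_UNIV], rule ballI, unfold isCont_def)
    fix s :: real
    have "isCont (\<lambda>t. \<phi> (cis t)) s"
    proof -
      have "continuous_on UNIV (\<lambda>t. \<phi> (cis t))"
        by (rule continuous_on_compose2[OF \<phi>_cont]) (auto intro!: continuous_intros)
      then show ?thesis by (simp add: continuous_on_eq_continuous_at)
    qed
    then have \<phi>_lim: "((\<lambda>t. \<phi> (cis t)) \<longlongrightarrow> \<phi> (cis s)) (at s)" by (simp add: isCont_def)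
    show "((\<lambda>t. g k (cis t)) \<longlongrightarrow> g k (cis s)) (at s)"
    proof (cases "\<phi> (cis s) = 0")
      case True
      have "((\<lambda>t. real k * \<phi> (cis t) * D) \<longlongrightarrow> real k * \<phi> (cis s) * D) (at s)"
        by (intro tendsto_intros \<phi>_lim)
      then have lim0: "((\<lambda>t. real k * \<phi> (cis t) * D) \<longlongrightarrow> 0) (at s)" by (simp add: True)
      have "((\<lambda>t. min 1 (real k * \<phi> (cis t)) * (G (cis t) + B)) \<longlongrightarrow> 0) (at s)"
      proof (rule tendsto_sandwich[OF _ _ tendsto_const lim0])
        show "eventually (\<lambda>t. 0 \<le> min 1 (real k * \<phi> (cis t)) * (G (cis t) + B)) (at s)"
          using H(1)[OF cis_in_circle] \<phi>0 by (intro always_eventually allI mult_nonneg_nonneg) auto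
        show "eventually (\<lambda>t. min 1 (real k * \<phi> (cis t)) * (G (cis t) + B) \<le> real k * \<phi> (cis t) * D) (at s)"
          using H[OF cis_in_circle] \<phi>0 by (intro always_eventually allI mult_mono) auto
      qed
      from tendsto_diff[OF this tendsto_const[of B]] show ?thesis by (simp add: g_def True)
    next
      case False
      then have "\<forall>j\<in>{..q}. ((f ^^ j) (cis s)) ^ N \<noteq> cis (real N * \<beta>)"
        by (auto simp: \<phi>_def N\<beta>)
      then have "\<forall>j\<in>{..q}. eventually (\<lambda>t. arc_index N \<beta> ((f ^^ j) (cis t)) = arc_index N \<beta> ((f ^^ j) (cis s))) (at s)"
        using arc_index_locally_constant[OF N] by blast
      then have "eventually (\<lambda>t. \<forall>j\<in>{..q}. arc_index N \<beta> ((f ^^ j) (cis t)) = arc_index N \<beta> ((f ^^ j) (cis s))) (at s)"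
        by (intro eventually_ball_finite) auto
      then have ev: "eventually (\<lambda>t. log_deriv (cis t) + \<xi> (cis s) = G (cis t)) (at s)"
      proof eventually_elim
        fix t assume t: "\<forall>j\<in>{..q}. arc_index N \<beta> ((f ^^ j) (cis t)) = arc_index N \<beta> ((f ^^ j) (cis s))"
        have "cell ((f ^^ j) (cis t)) = cell ((f ^^ j) (cis s))" if "j < Suc q" for j
        proof -
          have "arc_index N \<beta> ((f ^^ j) (cis t)) = arc_index N \<beta> ((f ^^ j) (cis s))"
            using t that by simp
          then show ?thesis unfolding cell[OF fn_circle[OF cis_in_circle]] by simp
        qed
        then have "word (Suc q) (cis t) = word (Suc q) (cis s)" unfolding word_def by simp
        then have "\<xi> (cis t) = \<xi> (cis s)" unfolding \<xi>_word by simp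
        then show "log_deriv (cis t) + \<xi> (cis s) = G (cis t)" by (simp add: G_def)
      qed
      have "isCont (\<lambda>t. log_deriv (cis t)) s"
      proof -
        have "continuous_on UNIV (\<lambda>t. log_deriv (cis t))"
          by (rule continuous_on_compose2[OF log_deriv_cont]) (auto intro!: continuous_intros)
        then show ?thesis by (simp add: continuous_on_eq_continuous_at)
      qed
      then have "((\<lambda>t. log_deriv (cis t) + \<xi> (cis s)) \<longlongrightarrow> log_deriv (cis s) + \<xi> (cis s)) (at s)"
        unfolding isCont_def by (intro tendsto_intros)
      then have "((\<lambda>t. G (cis t)) \<longlongrightarrow> G (cis s)) (at s)"
        unfolding G_def[of "cis s"] by (rule Lim_transform_eventually[OF _ ev])
      then show ?thesis unfolding g_def by (intro tendsto_intros \<phi>_lim)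
    qed
  qed
  have "AE x in \<mu>. \<phi> x \<noteq> 0"
  proof -
    have "AE x in \<mu>. (f ^^ j) x ^ N \<noteq> cis \<beta>'" for j
    proof -
      have S: "{x \<in> circle. x ^ N = cis \<beta>'} \<in> sets \<mu>"
      proof -
        have "(\<lambda>x. x ^ N) \<in> circle_borel \<rightarrow>\<^sub>M (borel :: complex measure)"
          by (intro borel_measurable_continuous_on_restrict continuous_intros)
        from measurable_sets[OF this, of "{cis \<beta>'}"] show ?thesis
          by (simp add: m vimage_def Int_def conj_commute)
      qed
      have "emeasure \<mu> {x \<in> circle. x ^ N = cis \<beta>'} = 0" using \<beta>' by (simp add: emeasure_eq_measure)
      then have "AE y in distr \<mu> \<mu> (f ^^ j). y \<notin> {x \<in> circle. x ^ N = cis \<beta>'}"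
        unfolding Tn_invariant using S by (intro AE_not_in) (simp add: null_sets_def)
      then have "AE x in \<mu>. (f ^^ j) x \<notin> {x \<in> circle. x ^ N = cis \<beta>'}"
        by (rule AE_distrD[OF Tn_measurable])
      then show ?thesis using AE_space
        by eventually_elim (use fn_circle in \<open>auto simp: m\<close>)
    qed
    then have "AE x in \<mu>. \<forall>j\<in>{..q}. (f ^^ j) x ^ N \<noteq> cis \<beta>'"
      by (intro AE_finite_allI) auto
    then show ?thesis by eventually_elim (simp add: \<phi>_def)
  qed
  then have lim: "AE x in \<mu>. (\<lambda>k. g k x) \<longlonglongrightarrow> G x"
  proof eventually_elim
    fix x assume "\<phi> x \<noteq> 0"
    then have p: "\<phi> x > 0" using \<phi>0[of x] by simp
    obtain K where K: "real K > 1 / \<phi> x" using reals_Archimedean2 by blast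
    have "g k x = G x" if "k \<ge> K" for k
    proof -
      have "1 / \<phi> x < real k" using K that by linarith
      then have "1 \<le> real k * \<phi> x" using p by (simp add: pos_divide_less_eq)
      then show ?thesis by (simp add: g_def)
    qed
    then show "(\<lambda>k. g k x) \<longlonglongrightarrow> G x"
      by (intro tendsto_eventually) (auto simp: eventually_sequentially)
  qed
  have "(\<lambda>k. \<integral>x. g k x \<partial>\<mu>) \<longlonglongrightarrow> (\<integral>x. G x \<partial>\<mu>)"
  proof (rule integral_dominated_convergence[OF _ _ _ lim])
    show "G \<in> borel_measurable \<mu>" using G_int by simp
    show "g k \<in> borel_measurable \<mu>" for k
      using borel_measurable_continuous_on_restrict[OF g_cont] by (simp add: meas_eq)
    show "integrable \<mu> (\<lambda>_. D + B)" by simp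
    show "AE x in \<mu>. norm (g k x) \<le> D + B" for k
    proof (rule AE_I2)
      fix x assume "x \<in> space \<mu>"
      then have x: "x \<in> circle" by (simp add: m)
      have "0 \<le> B" using \<xi>B[OF x] by linarith
      have "0 \<le> min 1 (real k * \<phi> x) * (G x + B)" using H(1)[OF x] \<phi>0[of x] by (intro mult_nonneg_nonneg) auto
      moreover have "min 1 (real k * \<phi> x) * (G x + B) \<le> 1 * D" using H[OF x] \<phi>0[of x] by (intro mult_mono) auto
      ultimately show "norm (g k x) \<le> D + B" using \<open>0 \<le> B\<close> by (simp add: g_def abs_le_iff)
    qed
  qed
  from order_tendstoD(1)[OF this G_pos] obtain k where k: "(\<integral>x. g k x \<partial>\<mu>) > 0"
    by (auto simp: eventually_sequentially)
  show ?thesis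
  proof (rule that[OF g_cont k])
    fix u :: "complex \<Rightarrow> ennreal" assume u: "u \<in> borel_measurable circle_borel"
    \<comment> \<open>The weight is extended by zero to indices that number no arc and to points off the circle.\<close>
    define \<theta> where "\<theta> i y = (if i \<in> {0..<int N} \<and> y \<in> circle then \<tau> (?A i) (word q y) else 0)" for i y
    have A: "?A i \<in> ?P" if "i \<in> {0..<int N}" for i using that by (auto simp: arc_partition_def)
    have w: "word q y \<in> words ?P q" if "y \<in> circle" for y using word_in_words that by (simp add: m)
    have "(\<integral>\<^sup>+x. u (f x) * ennreal (exp (g k x)) \<partial>circle_lebesgue)
       \<le> (\<integral>\<^sup>+x. u (f x) * ennreal (circle_deriv_norm f x * \<theta> (arc_index N \<beta> x) (f x)) \<partial>circle_lebesgue)"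
    proof (intro nn_integral_mono mult_left_mono ennreal_leI)
      fix x assume "x \<in> space circle_lebesgue"
      then have x: "x \<in> circle" by simp
      have "exp (g k x) \<le> exp (G x)" using g_le[OF x] by simp
      also have "\<dots> = circle_deriv_norm f x * \<tau> (cell x) (word q (f x))"
        using \<tau>pos[OF cell_in_P w, of x "f x"] x f_circle[OF x]
        by (simp add: G_def exp_add exp_log_deriv[simplified] \<xi>_def m)
      also have "\<dots> = circle_deriv_norm f x * \<theta> (arc_index N \<beta> x) (f x)"
        using arc_index_range[OF N] f_circle[OF x] by (simp add: \<theta>_def cell[OF x])
      finally show "exp (g k x) \<le> circle_deriv_norm f x * \<theta> (arc_index N \<beta> x) (f x)" .
    qed simp
    also have "\<dots> \<le> (\<integral>\<^sup>+x. u x \<partial>circle_lebesgue)"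
    proof (rule nn_integral_weighted_transfer_le[OF u N NF])
      show "\<theta> i \<in> borel_measurable circle_borel" for i
      proof (cases "i \<in> {0..<int N}")
        case True
        have "(\<lambda>y. \<tau> (?A i) (word q y)) \<in> borel_measurable circle_borel"
          unfolding meas_eq by (rule borel_measurable_word)
        then show ?thesis
          by (rule measurable_cong[THEN iffD1, rotated]) (use True in \<open>simp add: \<theta>_def\<close>)
      next
        case False
        then have "\<theta> i = (\<lambda>_. 0)" by (auto simp: \<theta>_def fun_eq_iff)
        then show ?thesis by simp
      qed
      show "0 \<le> \<theta> i x" for i x using \<tau>pos[OF A w, of i x] by (auto simp: \<theta>_def less_imp_le)
      show "(\<Sum>i\<in>{0..<int N}. \<theta> i x) \<le> 1" if x: "x \<in> circle" for x
      proof -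
        have "(\<Sum>i\<in>{0..<int N}. \<theta> i x) = (\<Sum>A\<in>?P. \<tau> A (word q x))"
        proof -
          have "sum h ?P = (\<Sum>i\<in>{0..<int N}. h (?A i))" for h :: "complex set \<Rightarrow> real"
            unfolding arc_partition_def by (rule sum.reindex[OF inj_on_arcs[OF N], unfolded comp_def])
          then show ?thesis using x by (simp add: \<theta>_def)
        qed
        then show ?thesis using \<tau>sum[OF w[OF x]] by simp
      qed
    qed
    finally show "(\<integral>\<^sup>+x. u (f x) * ennreal (exp (g k x)) \<partial>circle_lebesgue) \<le> (\<integral>\<^sup>+x. u x \<partial>circle_lebesgue)" .
  qed
qed

end

section \<open>Stable sets satisfy the entropy formula\<close>

text \<open>A point that is close to \<open>K\<close> and has \<open>J\<close> not much above \<open>c\<close> is close to the part of \<open>K\<close> where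
  \<open>J \<le> c\<close>: otherwise a convergent subsequence of near points in \<open>K\<close> would have its limit in that part.\<close>

lemma (in Metric_space) near_compact_sublevel:
  assumes K: "compactin mtopology K" and J: "continuous_map mtopology euclideanreal J" and \<rho>: "\<rho> > 0"
  obtains \<rho>' where "\<rho>' > 0"
    "\<And>\<nu> \<kappa>. \<nu> \<in> M \<Longrightarrow> \<kappa> \<in> K \<Longrightarrow> d \<nu> \<kappa> < \<rho>' \<Longrightarrow> J \<nu> < c + \<rho>' \<Longrightarrow> \<exists>\<kappa>'\<in>K. J \<kappa>' \<le> c \<and> d \<nu> \<kappa>' < \<rho>"
proof -
  have "\<exists>\<rho>'>0. \<forall>\<nu>\<in>M. \<forall>\<kappa>\<in>K. d \<nu> \<kappa> < \<rho>' \<and> J \<nu> < c + \<rho>' \<longrightarrow> (\<exists>\<kappa>'\<in>K. J \<kappa>' \<le> c \<and> d \<nu> \<kappa>' < \<rho>)"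
  proof (rule ccontr)
    assume neg: "\<not> ?thesis"
    have "\<exists>\<nu> \<kappa>. \<nu> \<in> M \<and> \<kappa> \<in> K \<and> d \<nu> \<kappa> < inverse (real (Suc k)) \<and> J \<nu> < c + inverse (real (Suc k)) \<and>
        (\<forall>\<kappa>'\<in>K. J \<kappa>' \<le> c \<longrightarrow> \<not> d \<nu> \<kappa>' < \<rho>)" for k :: nat
    proof -
      have "inverse (real (Suc k)) > 0" by simp
      with neg show ?thesis by blast
    qed
    then obtain \<nu> \<kappa> where \<nu>: "\<And>k :: nat. \<nu> k \<in> M" and \<kappa>: "\<And>k. \<kappa> k \<in> K"
      and close: "\<And>k. d (\<nu> k) (\<kappa> k) < inverse (real (Suc k))"
      and low: "\<And>k. J (\<nu> k) < c + inverse (real (Suc k))"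
      and far: "\<And>k \<kappa>'. \<kappa>' \<in> K \<Longrightarrow> J \<kappa>' \<le> c \<Longrightarrow> \<not> d (\<nu> k) \<kappa>' < \<rho>"
      by metis
    have KM: "K \<subseteq> M" using compactin_subset_topspace[OF K] by simp
    obtain l r where l: "l \<in> K" and r: "strict_mono r" and lim: "limitin mtopology (\<kappa> \<circ> r) l sequentially"
      using K \<kappa> unfolding compactin_sequentially by blast
    have lM: "l \<in> M" using l KM by blast
    have e_mono: "inverse (real (Suc (r k))) \<le> inverse (real (Suc k))" for k
      using seq_suble[OF r, of k] by (intro le_imp_inverse_le) auto
    have lim_d: "(\<lambda>k. d (\<nu> (r k)) l) \<longlonglongrightarrow> 0"
    proof (rule tendsto_sandwich[OF _ _ tendsto_const])
      show "eventually (\<lambda>k. 0 \<le> d (\<nu> (r k)) l) sequentially" by simp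
      show "eventually (\<lambda>k. d (\<nu> (r k)) l \<le> inverse (real (Suc k)) + d (\<kappa> (r k)) l) sequentially"
      proof (intro always_eventually allI)
        fix k
        have "d (\<nu> (r k)) l \<le> d (\<nu> (r k)) (\<kappa> (r k)) + d (\<kappa> (r k)) l"
          using \<nu> \<kappa> KM lM by (intro triangle) auto
        then show "d (\<nu> (r k)) l \<le> inverse (real (Suc k)) + d (\<kappa> (r k)) l"
          using close[of "r k"] e_mono[of k] by linarith
      qed
      have "(\<lambda>k. d (\<kappa> (r k)) l) \<longlonglongrightarrow> 0"
      proof -
        have "\<forall>e>0. \<exists>N. \<forall>n\<ge>N. d (\<kappa> (r n)) l < e"
          using lim unfolding limit_metric_sequentially comp_def by blast
        then show ?thesis by (simp add: lim_sequentially)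
      qed
      from tendsto_add[OF LIMSEQ_inverse_real_of_nat this]
      show "(\<lambda>k. inverse (real (Suc k)) + d (\<kappa> (r k)) l) \<longlonglongrightarrow> 0" by simp
    qed
    then have "limitin mtopology (\<lambda>k. \<nu> (r k)) l sequentially"
      using \<nu> lM by (simp add: limit_metric_sequentially lim_sequentially)
    from continuous_map_limit[OF J this] have J_lim: "(\<lambda>k. J (\<nu> (r k))) \<longlonglongrightarrow> J l"
      by (simp add: limitin_canonical_iff comp_def)
    have "J l \<le> c"
    proof (rule LIMSEQ_le[OF J_lim])
      have "(\<lambda>k. c + inverse (real (Suc k))) \<longlonglongrightarrow> c + 0"
        by (intro tendsto_intros LIMSEQ_inverse_real_of_nat)
      then show "(\<lambda>k. c + inverse (real (Suc k))) \<longlonglongrightarrow> c" by simp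
      have "J (\<nu> (r k)) \<le> c + inverse (real (Suc k))" for k
        using low[of "r k"] e_mono[of k] by linarith
      then show "\<exists>N. \<forall>n\<ge>N. J (\<nu> (r n)) \<le> c + inverse (real (Suc n))" by blast
    qed
    moreover have "\<exists>k. d (\<nu> (r k)) l < \<rho>"
      using order_tendstoD(2)[OF lim_d \<rho>] by (auto simp: eventually_sequentially)
    ultimately show False using far[OF l] by blast
  qed
  then show ?thesis using that by blast
qed

lemma topspace_weak_star: "topspace weak_star_topology = circle_probs"
proof -
  have "\<exists>\<phi> :: complex \<Rightarrow> complex. \<exists>U. circle_probs = {\<mu> \<in> circle_probs. (\<integral>x. \<phi> x \<partial>\<mu>) \<in> U} \<and> continuous_on circle \<phi> \<and> open U"
    by (intro exI[of _ "\<lambda>_. 0"] exI[of _ UNIV]) auto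
  then show ?thesis unfolding weak_star_topology_def topology_generated_by_topspace by blast
qed

lemma continuous_map_integral:
  fixes g :: "complex \<Rightarrow> real"
  assumes g: "continuous_on circle g"
  shows "continuous_map weak_star_topology euclideanreal (\<lambda>\<mu>. \<integral>x. g x \<partial>\<mu>)"
  unfolding continuous_map
proof (intro conjI allI impI)
  fix U :: "real set" assume "openin euclideanreal U"
  then have U: "open U" by simp
  have gc: "continuous_on circle (\<lambda>x. complex_of_real (g x))" by (intro continuous_intros g)
  have "{\<mu> \<in> topspace weak_star_topology. (\<integral>x. g x \<partial>\<mu>) \<in> U}
      = {\<mu> \<in> circle_probs. (\<integral>x. complex_of_real (g x) \<partial>\<mu>) \<in> Re -` U}"
    by (simp add: topspace_weak_star)
  moreover have "open (Re -` U)" using U by (intro open_vimage continuous_intros)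
  ultimately have "{\<mu> \<in> topspace weak_star_topology. (\<integral>x. g x \<partial>\<mu>) \<in> U} \<in>
      {{\<mu> \<in> circle_probs. (\<integral>x. \<phi> x \<partial>\<mu>) \<in> U} | (\<phi> :: complex \<Rightarrow> complex) U. continuous_on circle \<phi> \<and> open U}"
    using gc by blast
  from topology_generated_by_Basis[OF this]
  show "openin weak_star_topology {\<mu> \<in> topspace weak_star_topology. (\<integral>x. g x \<partial>\<mu>) \<in> U}"
    by (simp only: weak_star_topology_def[symmetric])
qed simp

lemma expanding_circle_map_lift:
  assumes "expanding_circle_map f"
  obtains F F' where "expanding_lift f F F'"
proof -
  have f: "C1_circle_map f" and e: "\<And>x. x \<in> circle \<Longrightarrow> circle_deriv_norm f x > 1"
    using assms by (auto simp: expanding_circle_map_def)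
  obtain F F' where "\<And>t. (F has_real_derivative F' t) (at t)" "continuous_on UNIV F'"
    "\<And>t. f (cis t) = cis (F t)" "\<And>t. circle_deriv_norm f (cis t) = \<bar>F' t\<bar>"
    using circle_map_lift[OF f] by blast
  with e show ?thesis by (intro that[of F F'] expanding_lift.intro) auto
qed

theorem corollary7:
  fixes f :: "complex \<Rightarrow> complex"
    and d :: "complex measure \<Rightarrow> complex measure \<Rightarrow> real"
    and K :: "complex measure set"
    and \<mu> :: "complex measure"
  assumes "expanding_circle_map f"
    and "Metric_space circle_probs d"
    and "Metric_space.mtopology circle_probs d = weak_star_topology"
    and "empirically_stochastically_stable d f K"
    and "\<mu> \<in> K"
  shows "metric_entropy \<mu> f = ereal (\<integral>x. ln (circle_deriv_norm f x) \<partial>\<mu>)"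
proof -
  obtain F F' where "expanding_lift f F F'" using expanding_circle_map_lift[OF assms(1)] by blast
  then interpret expanding_lift f F F' .
  interpret Metric_space circle_probs d by (rule assms(2))
  have Kinv: "K \<subseteq> invariant_probs f" and Kcomp: "compactin weak_star_topology K"
    using assms(4) by (simp_all add: empirically_stochastically_stable_def)
  obtain A where A: "A \<in> sets (completion circle_lebesgue)" "emeasure (completion circle_lebesgue) A > 0"
    and A_stable: "\<forall>\<rho>>0. \<exists>N\<ge>1. \<forall>n\<ge>N. \<exists>\<epsilon>\<^sub>0>0. \<forall>\<epsilon>. 0 < \<epsilon> \<and> \<epsilon> \<le> \<epsilon>\<^sub>0 \<longrightarrow>
           (\<forall>x\<in>A. dist_to_set d (empiric_prob f \<epsilon> n x) K < \<rho>)"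
    using assms(4) unfolding empirically_stochastically_stable_def by blast
  have minimal: "K \<subseteq> K'" if "K' \<noteq> {}" "K' \<subseteq> invariant_probs f" "compactin weak_star_topology K'"
      "AE x in circle_lebesgue. x \<in> stability_basin d f K \<longrightarrow> x \<in> stability_basin d f K'" for K'
    using assms(4) that unfolding empirically_stochastically_stable_def by blast
  have \<mu>: "\<mu> \<in> invariant_probs f" using Kinv assms(5) by blast
  have "metric_entropy \<mu> f = ereal (\<integral>x. log_deriv x \<partial>\<mu>)"
  proof (rule ccontr)
    assume "\<not> ?thesis"
    then have "metric_entropy \<mu> f < ereal (\<integral>x. log_deriv x \<partial>\<mu>)"
      using metric_entropy_le[OF \<mu>] by (simp add: order.strict_iff_order)
    then obtain g where g: "continuous_on circle g" and g_pos: "(\<integral>x. g x \<partial>\<mu>) > 0"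
      and g_step: "\<And>u. u \<in> borel_measurable circle_borel \<Longrightarrow>
        (\<integral>\<^sup>+x. u (f x) * ennreal (exp (g x)) \<partial>circle_lebesgue) \<le> (\<integral>\<^sup>+x. u x \<partial>circle_lebesgue)"
      by (rule continuous_minorant[OF \<mu>]) blast
    define J where "J \<nu> = (\<integral>x. g x \<partial>\<nu>)" for \<nu> :: "complex measure"
    \<comment> \<open>Any value strictly between zero and \<open>J \<mu>\<close> would do.\<close>
    define c where "c = J \<mu> / 2"
    have c: "0 < c" "c < J \<mu>" using g_pos by (auto simp: c_def J_def)
    have J: "continuous_map weak_star_topology euclideanreal J"
      unfolding J_def by (rule continuous_map_integral[OF g])
    define K' where "K' = {\<nu> \<in> K. J \<nu> \<le> c}"
    have K'_comp: "compactin weak_star_topology K'"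
    proof -
      have "closedin weak_star_topology {\<nu> \<in> topspace weak_star_topology. J \<nu> \<in> {..c}}"
        by (rule closedin_continuous_map_preimage[OF J]) simp
      from closed_Int_compactin[OF this Kcomp]
      have "compactin weak_star_topology ({\<nu> \<in> topspace weak_star_topology. J \<nu> \<in> {..c}} \<inter> K)" .
      moreover have "{\<nu> \<in> topspace weak_star_topology. J \<nu> \<in> {..c}} \<inter> K = K'"
        using compactin_subset_topspace[OF Kcomp] by (auto simp: K'_def)
      ultimately show ?thesis by simp
    qed
    let ?low = "\<lambda>x. eventually (\<lambda>n. (\<Sum>j=1..n. g ((f ^^ j) x)) \<le> c * real n) sequentially"
    have typical: "AE x in circle_lebesgue. ?low x"
      by (rule AE_average_le[OF g c(1) g_step])
    have attract: "\<exists>N\<ge>1. \<forall>n\<ge>N. \<exists>\<epsilon>\<^sub>0>0. \<forall>\<epsilon>. 0 < \<epsilon> \<and> \<epsilon> \<le> \<epsilon>\<^sub>0 \<longrightarrow> (\<exists>\<kappa>\<in>K'. d (empiric_prob f \<epsilon> n x) \<kappa> < \<rho>)"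
      if x: "x \<in> stability_basin d f K" and av: "?low x"
        and \<rho>: "\<rho> > 0" for x \<rho>
    proof -
      have xc: "x \<in> circle" using x by (simp add: stability_basin_def)
      obtain \<rho>' where \<rho>': "\<rho>' > 0" and near: "\<And>\<nu> \<kappa>. \<nu> \<in> circle_probs \<Longrightarrow> \<kappa> \<in> K \<Longrightarrow> d \<nu> \<kappa> < \<rho>' \<Longrightarrow> J \<nu> < c + \<rho>'
          \<Longrightarrow> \<exists>\<kappa>'\<in>K. J \<kappa>' \<le> c \<and> d \<nu> \<kappa>' < \<rho>"
        using near_compact_sublevel[of K J \<rho> c] Kcomp J \<rho> unfolding assms(3) by metis
      obtain N1 where N1: "N1 \<ge> 1" "\<forall>n\<ge>N1. \<exists>\<epsilon>\<^sub>0>0. \<forall>\<epsilon>. 0 < \<epsilon> \<and> \<epsilon> \<le> \<epsilon>\<^sub>0 \<longrightarrow> dist_to_set d (empiric_prob f \<epsilon> n x) K < \<rho>'"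
        using x \<rho>' unfolding stability_basin_def by blast
      obtain N2 where N2: "\<And>n. n \<ge> N2 \<Longrightarrow> (\<Sum>j=1..n. g ((f ^^ j) x)) \<le> c * real n"
        using av by (auto simp: eventually_sequentially)
      have "\<exists>\<epsilon>\<^sub>0>0. \<forall>\<epsilon>. 0 < \<epsilon> \<and> \<epsilon> \<le> \<epsilon>\<^sub>0 \<longrightarrow> (\<exists>\<kappa>\<in>K'. d (empiric_prob f \<epsilon> n x) \<kappa> < \<rho>)"
        if n: "n \<ge> max N1 N2" for n
      proof -
        have n1: "n \<ge> 1" using n N1(1) by simp
        have "n \<ge> N1" "n \<ge> N2" using n by auto
        obtain e1 where e1: "e1 > 0" "\<And>\<epsilon>. 0 < \<epsilon> \<Longrightarrow> \<epsilon> \<le> e1 \<Longrightarrow> dist_to_set d (empiric_prob f \<epsilon> n x) K < \<rho>'"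
          using N1(2) \<open>n \<ge> N1\<close> by blast
        have "(\<Sum>j=1..n. g ((f ^^ j) x)) / real n \<le> c"
          using N2[OF \<open>n \<ge> N2\<close>] n1 by (simp add: pos_divide_le_eq)
        then have "(\<Sum>j=1..n. g ((f ^^ j) x)) / real n < c + \<rho>'" using \<rho>' by linarith
        from order_tendstoD(2)[OF empiric_prob_tendsto[OF xc n1 g] this]
        have "eventually (\<lambda>\<epsilon>. J (empiric_prob f \<epsilon> n x) < c + \<rho>') (at_right 0)"
          by (simp add: J_def)
        then obtain e2 where e2: "e2 > 0" "\<And>\<epsilon>. 0 < \<epsilon> \<Longrightarrow> \<epsilon> < e2 \<Longrightarrow> J (empiric_prob f \<epsilon> n x) < c + \<rho>'"
          unfolding eventually_at_right_field by blast
        define e where "e = min (min e1 (e2 / 2)) 1"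
        have "\<exists>\<kappa>\<in>K'. d (empiric_prob f \<epsilon> n x) \<kappa> < \<rho>" if \<epsilon>: "0 < \<epsilon>" "\<epsilon> \<le> e" for \<epsilon>
        proof -
          let ?\<sigma> = "empiric_prob f \<epsilon> n x"
          have "\<epsilon> \<le> e1" "\<epsilon> < e2" "\<epsilon> \<le> 1" using \<epsilon> e2(1) by (auto simp: e_def)
          have \<sigma>: "?\<sigma> \<in> circle_probs" by (rule empiric_prob_in_circle_probs[OF \<epsilon>(1) \<open>\<epsilon> \<le> 1\<close> xc n1])
          have "(INF \<nu>\<in>K. d ?\<sigma> \<nu>) < \<rho>'" using e1(2)[OF \<epsilon>(1) \<open>\<epsilon> \<le> e1\<close>] by (simp add: dist_to_set_def)
          moreover have "bdd_below (d ?\<sigma> ` K)" by (rule bdd_belowI[of _ 0]) auto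
          moreover have "K \<noteq> {}" using assms(5) by blast
          ultimately obtain \<kappa> where "\<kappa> \<in> K" "d ?\<sigma> \<kappa> < \<rho>'" using cINF_less_iff by metis
          from near[OF \<sigma> this e2(2)[OF \<epsilon>(1) \<open>\<epsilon> < e2\<close>]] show ?thesis by (auto simp: K'_def)
        qed
        moreover have "e > 0" using e1(1) e2(1) by (simp add: e_def)
        ultimately show ?thesis by blast
      qed
      then show ?thesis using N1(1) by (intro exI[of _ "max N1 N2"]) auto
    qed
    have basin: "x \<in> stability_basin d f K'"
      if x: "x \<in> stability_basin d f K" and av: "?low x" for x
    proof -
      have less: "dist_to_set d \<sigma> K' < \<rho>" if ex: "\<exists>\<kappa>\<in>K'. d \<sigma> \<kappa> < \<rho>" for \<sigma> \<rho>
      proof -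
        obtain \<kappa> where \<kappa>: "\<kappa> \<in> K'" "d \<sigma> \<kappa> < \<rho>" using ex by blast
        have "dist_to_set d \<sigma> K' \<le> d \<sigma> \<kappa>"
          unfolding dist_to_set_def using \<kappa>(1) by (intro cINF_lower bdd_belowI[of _ 0]) auto
        then show ?thesis using \<kappa>(2) by linarith
      qed
      show ?thesis
        unfolding stability_basin_def
      proof (intro CollectI conjI allI impI)
        show "x \<in> circle" using x by (simp add: stability_basin_def)
        fix \<rho> :: real assume "\<rho> > 0"
        from attract[OF x av this] less
        show "\<exists>N\<ge>1. \<forall>n\<ge>N. \<exists>\<epsilon>\<^sub>0>0. \<forall>\<epsilon>. 0 < \<epsilon> \<and> \<epsilon> \<le> \<epsilon>\<^sub>0 \<longrightarrow> dist_to_set d (empiric_prob f \<epsilon> n x) K' < \<rho>"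
          by meson
      qed
    qed
    have "K' \<noteq> {}"
    proof
      assume empty: "K' = {}"
      have A_basin: "x \<in> stability_basin d f K" if xA: "x \<in> A" for x
        unfolding stability_basin_def
      proof (intro CollectI conjI allI impI)
        show "x \<in> circle" using sets.sets_into_space[OF A(1)] xA by auto
        fix \<rho> :: real assume "\<rho> > 0"
        with A_stable obtain N where N: "N \<ge> 1" "\<forall>n\<ge>N. \<exists>\<epsilon>\<^sub>0>0. \<forall>\<epsilon>. 0 < \<epsilon> \<and> \<epsilon> \<le> \<epsilon>\<^sub>0 \<longrightarrow>
           (\<forall>x\<in>A. dist_to_set d (empiric_prob f \<epsilon> n x) K < \<rho>)"
          by blast
        have "\<exists>\<epsilon>\<^sub>0>0. \<forall>\<epsilon>. 0 < \<epsilon> \<and> \<epsilon> \<le> \<epsilon>\<^sub>0 \<longrightarrow> dist_to_set d (empiric_prob f \<epsilon> n x) K < \<rho>" if "n \<ge> N" for n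
          using N(2)[rule_format, OF that] xA by meson
        with N(1) show "\<exists>N\<ge>1. \<forall>n\<ge>N. \<exists>\<epsilon>\<^sub>0>0. \<forall>\<epsilon>. 0 < \<epsilon> \<and> \<epsilon> \<le> \<epsilon>\<^sub>0 \<longrightarrow> dist_to_set d (empiric_prob f \<epsilon> n x) K < \<rho>"
          by meson
      qed
      have "AE x in completion circle_lebesgue. x \<notin> A"
        using AE_completion[OF typical]
      proof eventually_elim
        fix x assume av: "?low x"
        show "x \<notin> A"
        proof
          assume "x \<in> A"
          from attract[OF A_basin[OF this] av zero_less_one]
          obtain N where "\<forall>n\<ge>N. \<exists>\<epsilon>\<^sub>0>0. \<forall>\<epsilon>. 0 < \<epsilon> \<and> \<epsilon> \<le> \<epsilon>\<^sub>0 \<longrightarrow> (\<exists>\<kappa>\<in>K'. d (empiric_prob f \<epsilon> n x) \<kappa> < 1)"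
            by blast
          then obtain e where "e > 0" "\<forall>\<epsilon>. 0 < \<epsilon> \<and> \<epsilon> \<le> e \<longrightarrow> (\<exists>\<kappa>\<in>K'. d (empiric_prob f \<epsilon> N x) \<kappa> < 1)"
            by blast
          then show False using empty by auto
        qed
      qed
      then have "emeasure (completion circle_lebesgue) A = 0"
        using A(1) sets.sets_into_space[OF A(1)]
        by (subst (asm) AE_iff_measurable[of A]) auto
      then show False using A(2) by simp
    qed
    then have "K \<subseteq> K'"
    proof (rule minimal)
      show "K' \<subseteq> invariant_probs f" using Kinv by (auto simp: K'_def)
      show "AE x in circle_lebesgue. x \<in> stability_basin d f K \<longrightarrow> x \<in> stability_basin d f K'"
        using typical by eventually_elim (blast intro: basin)
    qed (rule K'_comp)
    then have "J \<mu> \<le> c" using assms(5) by (auto simp: K'_def)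
    then show False using c(2) by simp
  qed
  then show ?thesis by (simp add: log_deriv_def[abs_def])
qed

end
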